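(* Let $\ell$ be a prime power, let $n$ be a positive integer, let $F=\mathbb{F}_\ell((t))$, let $\mathfrak{g}=\mathfrak{gl}_n(F)$ be the space of $n\times n$ matrices over $F$, let $\mathfrak{c}=F^n$, and let $p:\mathfrak{g}\to\mathfrak{c}$ be the Chevalley map $p(A)=(p_1(A),\dots,p_n(A))$, where $\det(\mathbf{x}I-A)=\mathbf{x}^n+p_1(A)\mathbf{x}^{n-1}+\cdots+p_n(A)$. Let $\mu_{\mathfrak{c}}$ be a Haar measure on $\mathfrak{c}$. Then for any smooth compactly supported measure $\mu$ on $\mathfrak{g}$, the Radon–Nikodym derivative of the pushforward measure $p_*(\mu)$ with respect to $\mu_{\mathfrak{c}}$ satisfies $$\frac{p_*(\mu)}{\mu_{\mathfrak{c}}}\in\bigcap_{1\le q<\infty}L^q(\mathfrak{c}).$$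
   Context: $F=\mathbb{F}_\ell((t))$ is the field of formal Laurent series over the finite field with $\ell$ elements, with its usual topology of a local field. The space $\mathfrak{c}=F^n$ is the set of $F$-points of the categorical quotient $\mathfrak{gl}_n/\!/\mathrm{GL}_n$, identified with affine $n$-space (equivalently, with monic polynomials of degree $n$) via the coefficients of the characteristic polynomial. A smooth compactly supported measure on $\mathfrak{g}$ is a measure of the form $\phi\,dx$, where $dx$ is a Haar measure on $\mathfrak{g}$ and $\phi$ is a locally constant compactly supported function on $\mathfrak{g}$. For such a measure $\mu$, the pushforward $p_*(\mu)$ is absolutely continuous with respect to $\mu_{\mathfrak{c}}$, so that the Radon–Nikodym derivative $p_*(\mu)/\mu_{\mathfrak{c}}$ exists. $L^q(\mathfrak{c})$ is taken with respect to $\mu_{\mathfrak{c}}$. *)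

theory Defs
  imports
    "HOL-Analysis.Analysis"
    "HOL-Computational_Algebra.Computational_Algebra"
begin

text \<open>
  \<open>F = \<F>\<^sub>\<ell>((t))\<close> is \<open>'k fls\<close> with \<open>'k :: {field, finite}\<close>. The metric of the
  library's instance of \<open>metric_space\<close> for \<open>'a fls\<close> is \<open>dist a b = 2 powi (- fls_subdegree (a - b))\<close>
  for \<open>a \<noteq> b\<close>, so its topology is the \<open>t\<close>-adic one. \<open>F^n\<close> and \<open>gl\<^sub>n(F)\<close> are
  \<open>'k fls ^ 'n\<close> and \<open>'k fls ^ 'n ^ 'n\<close> with \<open>n = CARD('n)\<close>, with the product topology.
\<close>

definition charpoly :: "'a::comm_ring_1 ^ 'n ^ 'n \<Rightarrow> 'a poly" where
  "charpoly A = det (mat [:0, 1:] - (\<chi> i j. [:A $ i $ j:]))"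

text \<open>
  The index type \<open>'n\<close> carries no numbering; \<open>e\<close> is a bijection from \<open>'n\<close> onto \<open>{1..n}\<close>, and
  the coordinate of \<open>chevalley e A\<close> at \<open>i\<close> is \<open>p\<^bsub>e i\<^esub>(A)\<close>, the coefficient of \<open>x^(n - e i)\<close>.
\<close>

definition chevalley :: "('n \<Rightarrow> nat) \<Rightarrow> 'a::comm_ring_1 ^ 'n ^ 'n \<Rightarrow> 'a ^ 'n" where
  "chevalley e A = (\<chi> i. coeff (charpoly A) (CARD('n) - e i))"

definition haar_measure :: "'a::{topological_space, ab_group_add} measure \<Rightarrow> bool" where
  "haar_measure M \<longleftrightarrow>
     sets M = sets borel \<and>
     emeasure M UNIV \<noteq> 0 \<and>
     (\<forall>K. compact K \<longrightarrow> emeasure M K < \<infinity>) \<and>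
     (\<forall>x. \<forall>A\<in>sets borel. emeasure M ((\<lambda>y. x + y) ` A) = emeasure M A) \<and>
     (\<forall>A\<in>sets borel. emeasure M A = (INF U\<in>{U. open U \<and> A \<subseteq> U}. emeasure M U)) \<and>
     (\<forall>U. open U \<longrightarrow> emeasure M U = (SUP K\<in>{K. compact K \<and> K \<subseteq> U}. emeasure M K))"

definition locally_constant :: "('a::topological_space \<Rightarrow> 'b) \<Rightarrow> bool" where
  "locally_constant f \<longleftrightarrow> (\<forall>x. \<exists>U. open U \<and> x \<in> U \<and> f constant_on U)"

definition compactly_supported :: "('a::topological_space \<Rightarrow> 'b::zero) \<Rightarrow> bool" where
  "compactly_supported f \<longleftrightarrow> compact (closure {x. f x \<noteq> 0})"

text \<open>
  Since \<open>\<phi>\<close> need not be nonnegative, \<open>\<phi> dx\<close> and its pushforward are complex measures. They are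
  represented by set functions, of which only the values on measurable sets are meaningful.
  \<open>density\<close>, \<open>distr\<close> and \<open>RN_deriv\<close> are the counterparts for nonnegative measures.
\<close>

definition smooth_compactly_supported_measure ::
    "('a::{topological_space, ab_group_add} set \<Rightarrow> complex) \<Rightarrow> bool" where
  "smooth_compactly_supported_measure \<mu> \<longleftrightarrow>
     (\<exists>dx \<phi>. haar_measure dx \<and> locally_constant \<phi> \<and> compactly_supported \<phi> \<and>
        (\<forall>A\<in>sets borel. \<mu> A = set_lebesgue_integral dx A \<phi>))"

definition pushforward :: "('a \<Rightarrow> 'b) \<Rightarrow> ('a set \<Rightarrow> complex) \<Rightarrow> 'b set \<Rightarrow> complex" where
  "pushforward p \<mu> B = \<mu> (p -` B)"

definition has_RN_derivative ::
    "('a set \<Rightarrow> complex) \<Rightarrow> 'a measure \<Rightarrow> ('a \<Rightarrow> complex) \<Rightarrow> bool" where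
  "has_RN_derivative \<nu> M f \<longleftrightarrow>
     integrable M f \<and> (\<forall>B\<in>sets M. \<nu> B = set_lebesgue_integral M B f)"

definition Lq :: "real \<Rightarrow> 'a measure \<Rightarrow> ('a \<Rightarrow> complex) set" where
  "Lq q M = {f \<in> borel_measurable M. integrable M (\<lambda>x. norm (f x) powr q)}"

end

theory Submission
  imports Defs
begin

text \<open>
  After scaling and truncation everything becomes a count of matrices over \<open>\<F>\<^sub>\<ell>[t]/t\<^sup>M\<close>, uniform in \<open>M\<close>.
  Fix all rows of a matrix \<open>A\<close> but row \<open>j\<close>. The characteristic polynomial is an affine function of
  that row, and by the matrix determinant lemma its fibres are cosets of the annihilator of the
  vectors \<open>A\<^sup>i e\<^sub>j\<close>. If \<open>N(A)\<close> is the order of this annihilator, then the number of rows with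
  characteristic polynomial in \<open>V\<close> is at most \<open>min (\<ell>\<^bsup>Mn\<^esup>, N(A) card V)\<close>, hence at most
  \<open>\<ell>\<^bsup>Mn(1-s)\<^esup> (N(A) card V)\<^sup>s\<close> for every \<open>0 \<le> s < 1\<close>. The average of \<open>N(A)\<^sup>s\<close> is bounded
  independently of \<open>M\<close>, by recursion on \<open>n\<close>: modulo a primitive cyclic vector one is left with a
  uniformly random matrix and a uniformly random vector of size \<open>n - 1\<close>, and extracting the content
  \<open>t\<^sup>a\<close> of the cyclic vector costs a factor \<open>\<ell>\<^bsup>ans\<^esup>\<close>, against the probability \<open>\<ell>\<^bsup>-an\<^esup>\<close> of that content.

  For Haar measures this says that the push-forward of a set \<open>B\<close> has mass \<open>O(\<mu>\<^sub>c(B)\<^sup>s)\<close> for every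
  \<open>s < 1\<close>, which is absolute continuity together with a weak \<open>L\<^sup>r\<close> bound for every \<open>r < \<infinity>\<close>.
\<close>

text \<open>The obstacle is that \<open>N(A)\<close> has no bounded average. Already for
  \<open>n = 2\<close> the cyclic vector is a uniformly random scalar, \<open>N(A)\<close> is
  \<open>\<ell>^v\<close> with \<open>v\<close> the order of that scalar cut off at
  \<open>M\<close>, and all values of \<open>v\<close> contribute about equally, so that the mean
  grows linearly in \<open>M\<close>. Hence only moments of order \<open>s < 1\<close> are used.
  \<open>N(A)\<close> can be treated as a constant while row \<open>j\<close> varies: a functional
  killing \<open>e_j\<close> has coordinate \<open>j\<close> equal to 0, and what remains of it
  kills the orbit of column \<open>j\<close> under the block of \<open>A\<close> without row and
  column \<open>j\<close>. For uniform \<open>A\<close> this block and this column are independent,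
  which starts the recursion. Uniformity in \<open>M\<close> is essential because a general open set
  of characteristic polynomials is not a union of cosets of one level; the level has to tend to
  infinity. Matrices in a compact set become integral after multiplication by some
  \<open>t^N\<close>. This multiplies \<open>p_i\<close> by \<open>t^(N i)\<close>, whence the
  weighted lattices on \<open>F^n\<close>.\<close>

no_notation fps_nth (infixl \<open>$\<close> 75)
notation fls_nth (infixl \<open>$$\<close> 75)

section \<open>Ideals and truncation of Laurent series\<close>

text \<open>The fractional ideal generated by \<open>t^k\<close>; for \<open>k = 0\<close> the ring
  of integers. It is given by coefficients because \<open>fls_subdegree 0\<close> has the default
  value 0, which would misplace the zero series.\<close>

definition fls_ideal :: "int \<Rightarrow> 'a::zero fls set" where
  "fls_ideal k = {x. \<forall>i<k. x $$ i = 0}"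

text \<open>Canonical representatives of \<open>fls_ideal a\<close> modulo
  \<open>fls_ideal b\<close>. Working with representatives instead of a quotient type lets the
  modulus vary inside one type.\<close>

definition fls_seg :: "int \<Rightarrow> int \<Rightarrow> 'a::zero fls set" where
  "fls_seg a b = {x. \<forall>i. i < a \<or> b \<le> i \<longrightarrow> x $$ i = 0}"

definition fls_trunc :: "int \<Rightarrow> 'a::zero fls \<Rightarrow> 'a fls" where
  "fls_trunc b x = Abs_fls (\<lambda>i. if i < b then x $$ i else 0)"

lemma fls_trunc_nth [simp]: "fls_trunc b x $$ i = (if i < b then x $$ i else 0)"
proof -
  obtain N where "\<forall>n<N. x $$ n = 0" by (rule fls_nth_vanishes_belowE)
  then show ?thesis
    unfolding fls_trunc_def by (subst nth_Abs_fls_lower_bound) auto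
qed

lemma fls_trunc_0 [simp]: "fls_trunc b 0 = 0"
  by (simp add: fls_eq_iff)

lemma fls_ideal_0 [simp]: "0 \<in> fls_ideal k"
  by (simp add: fls_ideal_def)

lemma fls_ideal_add: "x \<in> fls_ideal k \<Longrightarrow> y \<in> fls_ideal k \<Longrightarrow> x + y \<in> fls_ideal k"
  for x y :: "'a::monoid_add fls"
  by (simp add: fls_ideal_def)

lemma fls_ideal_diff: "x \<in> fls_ideal k \<Longrightarrow> y \<in> fls_ideal k \<Longrightarrow> x - y \<in> fls_ideal k"
  for x y :: "'a::group_add fls"
  by (simp add: fls_ideal_def)

lemma fls_ideal_uminus: "x \<in> fls_ideal k \<Longrightarrow> - x \<in> fls_ideal k"
  for x :: "'a::group_add fls"
  by (simp add: fls_ideal_def)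

lemma fls_ideal_minus_commute: "x - y \<in> fls_ideal k \<longleftrightarrow> y - x \<in> fls_ideal k"
  for x y :: "'a::ab_group_add fls"
  using fls_ideal_uminus[of "x - y" k] fls_ideal_uminus[of "y - x" k] by auto

lemma fls_ideal_sum: "(\<And>i. i \<in> S \<Longrightarrow> f i \<in> fls_ideal k) \<Longrightarrow> (\<Sum>i\<in>S. f i) \<in> fls_ideal k"
  for f :: "'b \<Rightarrow> 'a::comm_monoid_add fls"
  by (induction S rule: infinite_finite_induct) (auto intro: fls_ideal_add)

lemma fls_ideal_antimono: "j \<le> k \<Longrightarrow> x \<in> fls_ideal k \<Longrightarrow> x \<in> fls_ideal j"
  by (simp add: fls_ideal_def)

lemma fls_ideal_iff: "x \<in> fls_ideal k \<longleftrightarrow> x = 0 \<or> k \<le> fls_subdegree x"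
proof
  assume "x \<in> fls_ideal k"
  then show "x = 0 \<or> k \<le> fls_subdegree x"
    using nth_fls_subdegree_nonzero[of x] by (force simp: fls_ideal_def)
qed (auto simp: fls_ideal_def)

lemma fls_ideal_mult: "x \<in> fls_ideal j \<Longrightarrow> y \<in> fls_ideal k \<Longrightarrow> x * y \<in> fls_ideal (j + k)"
  for x y :: "'a::field fls"
  unfolding fls_ideal_iff by (cases "x = 0"; cases "y = 0") auto

lemma fls_ideal_mult0: "x \<in> fls_ideal 0 \<Longrightarrow> y \<in> fls_ideal k \<Longrightarrow> x * y \<in> fls_ideal k"
  for x y :: "'a::field fls"
  using fls_ideal_mult[of x 0 y k] by simp

lemma fls_ideal_mult0': "x \<in> fls_ideal k \<Longrightarrow> y \<in> fls_ideal 0 \<Longrightarrow> x * y \<in> fls_ideal k"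
  for x y :: "'a::field fls"
  using fls_ideal_mult[of x k y 0] by simp

lemma fls_ideal_1 [simp]: "(1::'a::field fls) \<in> fls_ideal 0"
  by (simp add: fls_ideal_iff)

lemma fls_ideal_X_intpow: "fls_X_intpow a \<in> (fls_ideal a :: 'a::field fls set)"
  by (simp add: fls_ideal_iff)

lemma fls_ideal_mult_iff:
  fixes x c :: "'a::field fls"
  assumes "c \<noteq> 0"
  shows "c * x \<in> fls_ideal k \<longleftrightarrow> x \<in> fls_ideal (k - fls_subdegree c)"
  using assms by (cases "x = 0") (auto simp: fls_ideal_iff)

lemma fls_ideal_cong_mult:
  fixes x y x' y' :: "'a::field fls"
  assumes "x - x' \<in> fls_ideal k" "y - y' \<in> fls_ideal k" "x' \<in> fls_ideal 0" "y \<in> fls_ideal 0"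
  shows "x * y - x' * y' \<in> fls_ideal k"
proof -
  have "x * y - x' * y' = (x - x') * y + x' * (y - y')" by (simp add: algebra_simps)
  then show ?thesis using assms by (simp add: fls_ideal_add fls_ideal_mult0 fls_ideal_mult0')
qed

lemma fls_ideal_exhaust: "\<exists>k::nat. x \<in> fls_ideal (- int k)"
proof (cases "x = 0")
  case False
  then show ?thesis
    by (intro exI[of _ "nat (- fls_subdegree x)"]) (simp add: fls_ideal_iff)
qed simp

lemma fls_trunc_diff: "x - fls_trunc b x \<in> fls_ideal b" for x :: "'a::group_add fls"
  by (simp add: fls_ideal_def)

lemma fls_trunc_diff': "fls_trunc b x - x \<in> fls_ideal b" for x :: "'a::group_add fls"
  by (simp add: fls_ideal_def)

lemma fls_trunc_eq_iff: "fls_trunc b x = fls_trunc b y \<longleftrightarrow> x - y \<in> fls_ideal b"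
  for x y :: "'a::group_add fls"
  by (auto simp: fls_ideal_def fls_eq_iff)

lemma fls_trunc_seg: "x \<in> fls_ideal a \<Longrightarrow> fls_trunc b x \<in> fls_seg a b"
  by (simp add: fls_ideal_def fls_seg_def)

lemma fls_trunc_id: "x \<in> fls_seg a b \<Longrightarrow> fls_trunc b x = x"
  by (auto simp: fls_seg_def fls_eq_iff)

lemma fls_seg_ideal: "x \<in> fls_seg a b \<Longrightarrow> x \<in> fls_ideal a"
  by (simp add: fls_ideal_def fls_seg_def)

lemma fls_seg_eqI: "x \<in> fls_seg a b \<Longrightarrow> y \<in> fls_seg a b \<Longrightarrow> x - y \<in> fls_ideal b \<Longrightarrow> x = y"
  for x y :: "'a::group_add fls"
  by (metis fls_trunc_eq_iff fls_trunc_id)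

lemma bij_betw_fls_seg:
  "bij_betw (\<lambda>x. restrict (fls_nth x) {a..<b}) (fls_seg a b) (PiE {a..<b} (\<lambda>_. UNIV::'a::zero set))"
proof (rule bij_betwI[where g = "\<lambda>f. Abs_fls (\<lambda>i. if i \<in> {a..<b} then f i else 0)"])
  show "(\<lambda>f. Abs_fls (\<lambda>i. if i \<in> {a..<b} then f i else 0)) \<in> ({a..<b} \<rightarrow>\<^sub>E UNIV) \<rightarrow> fls_seg a b"
    by (auto simp: fls_seg_def nth_Abs_fls_lower_bound[of a])
next
  fix x :: "'a fls" assume "x \<in> fls_seg a b"
  then show "Abs_fls (\<lambda>i. if i \<in> {a..<b} then restrict (fls_nth x) {a..<b} i else 0) = x"
    by (intro fls_eqI) (auto simp: fls_seg_def nth_Abs_fls_lower_bound[of a])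
next
  fix f :: "int \<Rightarrow> 'a" assume "f \<in> {a..<b} \<rightarrow>\<^sub>E UNIV"
  then show "restrict (fls_nth (Abs_fls (\<lambda>i. if i \<in> {a..<b} then f i else 0))) {a..<b} = f"
    by (auto simp: nth_Abs_fls_lower_bound[of a] fun_eq_iff PiE_def extensional_def)
qed auto

lemma card_fls_seg: "card (fls_seg a b :: 'a::{zero,finite} fls set) = CARD('a) ^ nat (b - a)"
  using bij_betw_same_card[OF bij_betw_fls_seg[of a b, where 'a='a]] by (simp add: card_PiE)

lemma finite_fls_seg [simp]: "finite (fls_seg a b :: 'a::{zero,finite} fls set)"
  using bij_betw_finite[OF bij_betw_fls_seg[of a b, where 'a='a]] by (simp add: finite_PiE)

section \<open>Finite boxes of representatives modulo \<open>t^M\<close>\<close>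

lemma bij_betw_vec_PiE:
  "bij_betw vec_nth {v::'a^'n. \<forall>i. v $ i \<in> S i} (PiE UNIV S)"
  by (rule bij_betwI[where g = vec_lambda]) (auto simp: vec_eq_iff)

lemma card_vec_box: "card {v::'a^'n. \<forall>i. v $ i \<in> S i} = (\<Prod>i\<in>UNIV. card (S i))"
  using bij_betw_same_card[OF bij_betw_vec_PiE[of S]] by (simp add: card_PiE)

lemma finite_vec_box: "(\<And>i. finite (S i)) \<Longrightarrow> finite {v::'a^'n. \<forall>i. v $ i \<in> S i}"
  using bij_betw_finite[OF bij_betw_vec_PiE[of S]] by (simp add: finite_PiE)

definition vec_reps :: "nat \<Rightarrow> ('k::zero fls ^ 'n) set" where
  "vec_reps M = {v. \<forall>i. v $ i \<in> fls_seg 0 (int M)}"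

definition mat_reps :: "nat \<Rightarrow> ('k::zero fls ^ 'n ^ 'n) set" where
  "mat_reps M = {A. \<forall>i j. A $ i $ j \<in> fls_seg 0 (int M)}"

lemma mat_reps_alt: "mat_reps M = {A. \<forall>i. A $ i \<in> vec_reps M}"
  by (auto simp: mat_reps_def vec_reps_def)

lemma finite_vec_reps [simp]: "finite (vec_reps M :: ('k::{zero,finite} fls ^ 'n) set)"
  unfolding vec_reps_def by (rule finite_vec_box) simp

lemma finite_mat_reps [simp]: "finite (mat_reps M :: ('k::{zero,finite} fls ^ 'n ^ 'n) set)"
  unfolding mat_reps_alt by (rule finite_vec_box) simp

lemma card_vec_reps: "card (vec_reps M :: ('k::{zero,finite} fls ^ 'n) set) = CARD('k) ^ (M * CARD('n))"
  unfolding vec_reps_def by (subst card_vec_box) (simp add: card_fls_seg flip: power_mult)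

lemma card_mat_reps:
  "card (mat_reps M :: ('k::{zero,finite} fls ^ 'n ^ 'n) set) = CARD('k) ^ (M * CARD('n) * CARD('n))"
  unfolding mat_reps_alt by (subst card_vec_box) (simp add: card_vec_reps flip: power_mult)

definition vec_trunc :: "nat \<Rightarrow> 'k::zero fls ^ 'n \<Rightarrow> 'k fls ^ 'n" where
  "vec_trunc M v = (\<chi> i. fls_trunc (int M) (v $ i))"

definition mat_trunc :: "nat \<Rightarrow> 'k::zero fls ^ 'n ^ 'n \<Rightarrow> 'k fls ^ 'n ^ 'n" where
  "mat_trunc M A = (\<chi> i. vec_trunc M (A $ i))"

text \<open>The type \<open>'n\<close> cannot shrink during the recursion on the size, so a smaller
  matrix is encoded as the block of \<open>A\<close> with indices in \<open>J\<close>.\<close>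

definition step :: "'n set \<Rightarrow> 'a::comm_ring_1 ^ 'n ^ 'n \<Rightarrow> 'a ^ 'n \<Rightarrow> 'a ^ 'n" where
  "step J A v = (\<chi> l. \<Sum>k\<in>J. A $ l $ k * v $ k)"

definition pairing :: "'n set \<Rightarrow> 'a::comm_ring_1 ^ 'n \<Rightarrow> 'a ^ 'n \<Rightarrow> 'a" where
  "pairing J d v = (\<Sum>l\<in>J. d $ l * v $ l)"

text \<open>The functionals modulo \<open>t\<^sup>M\<close> that vanish on the cyclic submodule generated by \<open>z\<close>.\<close>

definition cyc_ann :: "nat \<Rightarrow> 'n set \<Rightarrow> 'k::field fls ^ 'n ^ 'n \<Rightarrow> 'k fls ^ 'n \<Rightarrow> ('k fls ^ 'n) set" where
  "cyc_ann M J A z = {d \<in> vec_reps M. (\<forall>l. l \<notin> J \<longrightarrow> d $ l = 0) \<and>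
     (\<forall>i. pairing J d ((step J A ^^ i) z) \<in> fls_ideal (int M))}"

lemma finite_cyc_ann [simp]: "finite (cyc_ann M J (A :: 'k::{field,finite} fls ^ 'n ^ 'n) z)"
  by (rule finite_subset[OF _ finite_vec_reps[of M]]) (auto simp: cyc_ann_def)

section \<open>Integrality and congruences modulo \<open>t^M\<close>\<close>

definition int_vec :: "'n set \<Rightarrow> ('k::zero fls ^ 'n) \<Rightarrow> bool" where
  "int_vec J v \<longleftrightarrow> (\<forall>l\<in>J. v $ l \<in> fls_ideal 0)"

definition int_mat :: "'n set \<Rightarrow> ('k::zero fls ^ 'n ^ 'n) \<Rightarrow> bool" where
  "int_mat J A \<longleftrightarrow> (\<forall>l\<in>J. \<forall>k\<in>J. A $ l $ k \<in> fls_ideal 0)"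

lemma int_vec_step: "int_mat J A \<Longrightarrow> int_vec J v \<Longrightarrow> int_vec J (step J A v)"
  for A :: "'k::field fls ^ 'n ^ 'n"
  by (auto simp: int_vec_def int_mat_def step_def intro!: fls_ideal_sum fls_ideal_mult0)

lemma int_vec_reps: "v \<in> vec_reps M \<Longrightarrow> int_vec J v"
  by (auto simp: int_vec_def vec_reps_def intro: fls_seg_ideal)

lemma int_mat_reps: "A \<in> mat_reps M \<Longrightarrow> int_mat J A"
  by (auto simp: int_mat_def mat_reps_def intro: fls_seg_ideal)

lemma step_cong:
  fixes A A' :: "'k::field fls ^ 'n ^ 'n"
  assumes "int_mat J A'" "int_vec J v"
    and "\<And>l k. l \<in> J \<Longrightarrow> k \<in> J \<Longrightarrow> A $ l $ k - A' $ l $ k \<in> fls_ideal m"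
    and "\<And>l. l \<in> J \<Longrightarrow> v $ l - v' $ l \<in> fls_ideal m"
    and "l \<in> J"
  shows "step J A v $ l - step J A' v' $ l \<in> fls_ideal m"
  using assms
  by (auto simp: step_def int_vec_def int_mat_def simp flip: sum_subtractf
      intro!: fls_ideal_sum fls_ideal_cong_mult)

lemma funpow_step_cong:
  fixes A A' :: "'k::field fls ^ 'n ^ 'n"
  assumes A: "int_mat J A" "int_mat J A'" and v: "int_vec J v"
    and "\<And>l k. l \<in> J \<Longrightarrow> k \<in> J \<Longrightarrow> A $ l $ k - A' $ l $ k \<in> fls_ideal m"
    and "\<And>l. l \<in> J \<Longrightarrow> v $ l - v' $ l \<in> fls_ideal m"
  shows "l \<in> J \<Longrightarrow> (step J A ^^ i) v $ l - (step J A' ^^ i) v' $ l \<in> fls_ideal m"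
proof (induction i arbitrary: l)
  case (Suc i)
  have "int_vec J ((step J A ^^ i) v)" for i
    by (induction i) (auto simp: v A int_vec_step)
  then show ?case using Suc assms by (auto intro!: step_cong)
qed (use assms in auto)

lemma pairing_cong:
  fixes v v' :: "'k::field fls ^ 'n"
  assumes "\<And>l. l \<in> J \<Longrightarrow> v $ l - v' $ l \<in> fls_ideal m" "int_vec J d"
  shows "pairing J d v \<in> fls_ideal m \<longleftrightarrow> pairing J d v' \<in> fls_ideal m"
proof -
  have *: "pairing J d v - pairing J d v' \<in> fls_ideal m"
    using assms by (auto simp: pairing_def int_vec_def simp flip: sum_subtractf right_diff_distrib
      intro!: fls_ideal_sum fls_ideal_mult0)
  show ?thesis
    using fls_ideal_add[OF *, of "pairing J d v'"] fls_ideal_diff[OF _ *, of "pairing J d v"] by auto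
qed

text \<open>Integral data enter \<open>cyc_ann\<close> only through their \<open>J\<close>-block
  modulo \<open>t^M\<close>. This is what allows a transformed matrix to be truncated back into
  \<open>mat_reps\<close>, and row or column \<open>j\<close> to be replaced once \<open>j\<close>
  has left \<open>J\<close>.\<close>

lemma cyc_ann_cong:
  fixes A A' :: "'k::field fls ^ 'n ^ 'n"
  assumes "int_mat J A" "int_mat J A'" "int_vec J z"
    and "\<And>l k. l \<in> J \<Longrightarrow> k \<in> J \<Longrightarrow> A $ l $ k - A' $ l $ k \<in> fls_ideal (int M)"
    and "\<And>l. l \<in> J \<Longrightarrow> z $ l - z' $ l \<in> fls_ideal (int M)"
  shows "cyc_ann M J A z = cyc_ann M J A' z'"
proof -
  have "pairing J d ((step J A ^^ i) z) \<in> fls_ideal (int M) \<longleftrightarrow>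
        pairing J d ((step J A' ^^ i) z') \<in> fls_ideal (int M)" if "d \<in> vec_reps M" for d i
    by (rule pairing_cong[OF funpow_step_cong[OF assms] int_vec_reps[OF that]]) auto
  then show ?thesis by (auto simp: cyc_ann_def)
qed

section \<open>Cyclic annihilators and reduction of the size\<close>

lemma funpow_step_diff_smult:
  "(step J A ^^ i) (x - c *s y) = (step J A ^^ i) x - c *s (step J A ^^ i) y"
proof (induction i)
  case (Suc i)
  have "step J A (x - c *s y) = step J A x - c *s step J A y" for x y
    by (simp add: step_def vec_eq_iff sum_subtractf sum_distrib_left algebra_simps)
  then show ?case using Suc by simp
qed simp

lemma pairing_diff_smult: "pairing J d (x - c *s y) = pairing J d x - c * pairing J d y"
  by (simp add: pairing_def sum_subtractf sum_distrib_left algebra_simps)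

text \<open>Let \<open>z $ j = 1\<close>, and let \<open>g\<close> be the identity with column
  \<open>j\<close> replaced by \<open>z\<close>. Off row \<open>j\<close> the \<open>J\<close>-block
  is that of \<open>g^-1 A g\<close>: its columns off \<open>j\<close> give the action on the
  quotient by \<open>z\<close>, and column \<open>j\<close> is the image of \<open>A z\<close>
  there. Row \<open>j\<close> is kept as in \<open>A\<close>, so that \<open>A\<close> can be
  recovered.\<close>

definition red_mat :: "'n set \<Rightarrow> 'n \<Rightarrow> 'a::comm_ring_1 ^ 'n \<Rightarrow> 'a ^ 'n ^ 'n \<Rightarrow> 'a ^ 'n ^ 'n" where
  "red_mat J j z A = (\<chi> l k. if l = j then A $ j $ k
     else if k = j then \<Sum>m\<in>J. (A $ l $ m - z $ l * A $ j $ m) * z $ m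
     else A $ l $ k - z $ l * A $ j $ k)"

text \<open>Projection along \<open>z\<close> onto the coordinates off \<open>j\<close>: for
  \<open>z $ j = 1\<close> it kills \<open>z\<close>, and coordinate \<open>j\<close> of the result
  is 0.\<close>

definition red_vec :: "'n \<Rightarrow> 'a::comm_ring_1 ^ 'n \<Rightarrow> 'a ^ 'n \<Rightarrow> 'a ^ 'n" where
  "red_vec j z v = (\<chi> l. v $ l - z $ l * v $ j)"

lemma int_mat_red_mat:
  fixes A :: "'k::field fls ^ 'n::finite ^ 'n"
  assumes "int_mat UNIV A" "int_vec UNIV z"
  shows "int_mat UNIV (red_mat J j z A)"
  using assms
  by (auto simp: int_mat_def int_vec_def red_mat_def
      intro!: fls_ideal_diff fls_ideal_sum fls_ideal_mult0)

lemma int_vec_red_vec: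
  fixes z v :: "'k::field fls ^ 'n"
  assumes "int_vec J v" "int_vec J z" "j \<in> J"
  shows "int_vec J (red_vec j z v)"
  using assms by (auto simp: int_vec_def red_vec_def intro!: fls_ideal_diff fls_ideal_mult0)

lemma int_vec_funpow_step:
  fixes A :: "'k::field fls ^ 'n ^ 'n"
  shows "int_mat J A \<Longrightarrow> int_vec J v \<Longrightarrow> int_vec J ((step J A ^^ i) v)"
  by (induction i) (auto simp: int_vec_step)

lemma int_mat_subset: "int_mat J A \<Longrightarrow> J' \<subseteq> J \<Longrightarrow> int_mat J' A"
  by (auto simp: int_mat_def)

lemma int_vec_subset: "int_vec J v \<Longrightarrow> J' \<subseteq> J \<Longrightarrow> int_vec J' v"
  by (auto simp: int_vec_def)

lemma pairing_red_vec:
  fixes z d :: "'a::comm_ring_1 ^ 'n::finite"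
  assumes "j \<in> J" "z $ j = 1"
  shows "pairing (J - {j}) d (red_vec j z v) = pairing J d v - v $ j * pairing J d z"
proof -
  have [simp]: "finite J" by simp
  show ?thesis
    using assms unfolding pairing_def red_vec_def
    by (simp add: sum.remove[of J j] sum_subtractf sum_distrib_left algebra_simps)
qed

text \<open>The quotient sees \<open>v\<close> only up to multiples of \<open>z\<close>, so its
  action on the image of \<open>v\<close> is the image of \<open>A\<close> applied to
  \<open>v - v $ j *s z\<close>, the representative with coordinate \<open>j\<close> equal to
  0.\<close>

lemma step_red_mat:
  fixes A :: "'a::comm_ring_1 ^ 'n::finite ^ 'n"
  assumes "j \<in> J" "z $ j = 1" "l \<in> J - {j}"
  shows "step (J - {j}) (red_mat J j z A) (red_vec j z v) $ l
       = red_vec j z (step J A v - v $ j *s step J A z) $ l"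
proof -
  have "finite J" by simp
  have "red_vec j z (step J A v - v $ j *s step J A z) $ l =
     (\<Sum>k\<in>J. (A $ l $ k - z $ l * A $ j $ k) * (v $ k - z $ k * v $ j))"
    by (simp add: red_vec_def step_def sum_subtractf sum.distrib sum_distrib_left algebra_simps)
  also have "\<dots> = (\<Sum>k\<in>J - {j}. (A $ l $ k - z $ l * A $ j $ k) * (v $ k - z $ k * v $ j))"
    using assms \<open>finite J\<close> by (simp add: sum.remove[of J j])
  also have "\<dots> = step (J - {j}) (red_mat J j z A) (red_vec j z v) $ l"
    using assms by (simp add: step_def red_mat_def red_vec_def)
  finally show ?thesis by simp
qed

text \<open>Passing to the quotient by \<open>z\<close>: the functionals annihilating \<open>z\<close> live on the quotient, on
  which the matrix induces the corresponding block of \<open>red_mat\<close>.\<close>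

lemma pairing_reduce:
  fixes A :: "'k::field fls ^ 'n::finite ^ 'n"
  assumes J: "j \<in> J" "z $ j = 1" and A: "int_mat UNIV A" and z: "int_vec UNIV z"
    and d: "int_vec UNIV d" and dz: "\<And>i. pairing J d ((step J A ^^ i) z) \<in> fls_ideal m"
    and v: "int_vec J v" "\<And>i. pairing J d ((step J A ^^ i) v) \<in> fls_ideal m"
  shows "pairing (J - {j}) d ((step (J - {j}) (red_mat J j z A) ^^ i) (red_vec j z v)) \<in> fls_ideal m"
  using v
proof (induction i arbitrary: v)
  case 0
  have "v $ j \<in> fls_ideal 0" using 0 J by (auto simp: int_vec_def)
  then show ?case
    using 0(2)[of 0] dz[of 0] J by (simp add: pairing_red_vec fls_ideal_diff fls_ideal_mult0)
next
  case (Suc i)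
  \<comment> \<open>\<open>v1\<close> is \<open>A\<close> applied to \<open>v - v $ j *s z\<close>,
    and its image in the quotient is the next iterate. Its orbit is annihilated because those of
    \<open>v\<close> and \<open>z\<close> are and \<open>v $ j\<close> is integral.\<close>
  define v1 where "v1 = step J A v - v $ j *s step J A z"
  define B where "B = red_mat J j z A"
  have vj: "v $ j \<in> fls_ideal 0" using Suc J by (auto simp: int_vec_def)
  have AJ: "int_mat J A" and zJ: "int_vec J z"
    using A z int_mat_subset int_vec_subset by blast+
  have B: "int_mat (J - {j}) B"
    unfolding B_def by (rule int_mat_subset[OF int_mat_red_mat[OF A z]]) simp
  have iv1: "int_vec J v1"
    using int_vec_step[OF AJ Suc(2)] int_vec_step[OF AJ zJ] vj
    by (auto simp: v1_def int_vec_def intro!: fls_ideal_diff fls_ideal_mult0)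
  have "pairing J d ((step J A ^^ i) v1) \<in> fls_ideal m" for i
    using Suc(3)[of "Suc i"] dz[of "Suc i"] vj
    by (simp add: v1_def funpow_step_diff_smult pairing_diff_smult funpow_swap1
        fls_ideal_diff fls_ideal_mult0)
  then have IH: "pairing (J - {j}) d ((step (J - {j}) B ^^ i) (red_vec j z v1)) \<in> fls_ideal m"
    unfolding B_def using iv1 Suc.IH by blast
  have eq: "step (J - {j}) B (red_vec j z v) $ l - red_vec j z v1 $ l \<in> fls_ideal m"
    if "l \<in> J - {j}" for l
    unfolding B_def v1_def by (subst step_red_mat[OF J that]) simp
  have iv: "int_vec (J - {j}) (step (J - {j}) B (red_vec j z v))"
    by (rule int_vec_step[OF B]) (rule int_vec_subset[OF int_vec_red_vec[OF Suc(2) zJ J(1)]], simp)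
  have "(step (J - {j}) B ^^ i) (step (J - {j}) B (red_vec j z v)) $ l -
      (step (J - {j}) B ^^ i) (red_vec j z v1) $ l \<in> fls_ideal m" if "l \<in> J - {j}" for l
    by (rule funpow_step_cong[OF B B iv _ _ that]) (use eq in auto)
  from pairing_cong[of "J - {j}", OF this int_vec_subset[OF d]] IH
  show ?case by (simp add: funpow_swap1 B_def)
qed

text \<open>Since \<open>z $ j = 1\<close>, a functional killing \<open>z\<close> modulo
  \<open>t^M\<close> is determined by its coordinates off \<open>j\<close>. It lives on the quotient
  by \<open>z\<close>, where the orbit of \<open>z\<close> restarts at the image of
  \<open>A z\<close>, that is, at column \<open>j\<close> of \<open>B\<close>.\<close>

lemma card_cyc_ann_reduce:
  fixes A :: "'k::{field,finite} fls ^ 'n::finite ^ 'n"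
  assumes J: "j \<in> J" "z $ j = 1" and A: "int_mat UNIV A" and z: "int_vec UNIV z"
  defines "B \<equiv> red_mat J j z A"
  shows "card (cyc_ann M J A z) \<le> card (cyc_ann M (J - {j}) B (column j B))"
proof -
  define f where "f = (\<lambda>d::'k fls ^ 'n. \<chi> l. if l = j then 0 else d $ l)"
  have B: "int_mat (J - {j}) B"
    unfolding B_def by (rule int_mat_subset[OF int_mat_red_mat[OF A z]]) simp
  have AJ: "int_mat J A" and zJ: "int_vec J z"
    using A z int_mat_subset int_vec_subset by blast+
  have w: "int_vec (J - {j}) (red_vec j z (step J A z))"
    by (rule int_vec_subset[OF int_vec_red_vec[OF int_vec_step[OF AJ zJ] zJ J(1)]]) simp
  have "inj_on f (cyc_ann M J A z)"
  proof
    fix d d' assume d: "d \<in> cyc_ann M J A z" and d': "d' \<in> cyc_ann M J A z" and eq: "f d = f d'"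
    have off: "d $ l = d' $ l" if "l \<noteq> j" for l
      using eq that by (auto simp: f_def vec_eq_iff dest: spec[of _ l])
    have "pairing J d z - pairing J d' z \<in> fls_ideal (int M)"
      using d d' by (intro fls_ideal_diff) (auto simp: cyc_ann_def dest!: spec[of _ 0])
    also have "pairing J d z - pairing J d' z = d $ j - d' $ j"
      using J off by (simp add: pairing_def sum.remove[of J j])
    finally have "d $ j = d' $ j"
      using d d' by (intro fls_seg_eqI[of _ 0 "int M"]) (auto simp: cyc_ann_def vec_reps_def)
    then show "d = d'" using off by (metis vec_eq_iff)
  qed
  moreover have "f ` cyc_ann M J A z \<subseteq> cyc_ann M (J - {j}) B (column j B)"
  proof safe
    fix d assume d: "d \<in> cyc_ann M J A z"
    then have dr: "d \<in> vec_reps M" and dz: "\<And>i. pairing J d ((step J A ^^ i) z) \<in> fls_ideal (int M)"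
      by (auto simp: cyc_ann_def)
    have f_pair: "pairing (J - {j}) (f d) x = pairing (J - {j}) d x" for x
      by (simp add: pairing_def f_def)
    have "pairing (J - {j}) (f d) ((step (J - {j}) B ^^ i) (red_vec j z (step J A z))) \<in> fls_ideal (int M)" for i
      unfolding f_pair B_def
    proof (rule pairing_reduce[OF J A z int_vec_reps[OF dr] dz int_vec_step[OF AJ zJ]])
      show "pairing J d ((step J A ^^ i) (step J A z)) \<in> fls_ideal (int M)" for i
        using dz[of "Suc i"] by (simp add: funpow_swap1)
    qed
    moreover have "f d \<in> vec_reps M" using dr by (auto simp: vec_reps_def f_def fls_seg_def)
    ultimately have "f d \<in> cyc_ann M (J - {j}) B (red_vec j z (step J A z))"
      using d by (auto simp: cyc_ann_def f_def)
    also have "cyc_ann M (J - {j}) B (red_vec j z (step J A z)) = cyc_ann M (J - {j}) B (column j B)"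
      by (rule cyc_ann_cong[OF B B w])
        (auto simp: column_def B_def red_mat_def red_vec_def step_def sum_subtractf sum_distrib_left algebra_simps)
    finally show "f d \<in> cyc_ann M (J - {j}) B (column j B)" .
  qed
  ultimately show ?thesis by (intro card_inj_on_le) auto
qed

lemma pairing_cong_left:
  fixes d d' v :: "'k::field fls ^ 'n"
  assumes "\<And>l. l \<in> J \<Longrightarrow> d $ l - d' $ l \<in> fls_ideal m" "int_vec J v"
  shows "pairing J d v \<in> fls_ideal m \<longleftrightarrow> pairing J d' v \<in> fls_ideal m"
  using pairing_cong[OF assms] by (simp add: pairing_def mult.commute)

text \<open>If \<open>d\<close> kills the orbit of \<open>c z'\<close>, then \<open>c d\<close>
  kills that of \<open>z'\<close>. Multiplication by \<open>c\<close> modulo \<open>t^M\<close>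
  forgets the top \<open>a\<close> digits in each of the \<open>card J\<close> coordinates, which
  accounts for the power of \<open>CARD('k)\<close>.\<close>

lemma card_cyc_ann_scale:
  fixes A :: "'k::{field,finite} fls ^ 'n::finite ^ 'n"
  assumes c: "c \<noteq> 0" "fls_subdegree c = int a" and A: "int_mat J A" and z': "int_vec J z'"
    and z: "int_vec J z" "\<And>l. l \<in> J \<Longrightarrow> z $ l - c * z' $ l \<in> fls_ideal (int M)" and a: "a \<le> M"
  shows "card (cyc_ann M J A z) \<le> CARD('k) ^ (a * card J) * card (cyc_ann M J A z')"
proof -
  define W :: "('k fls ^ 'n) set" where
    "W = {w. \<forall>l. w $ l \<in> (if l \<in> J then fls_seg (int (M - a)) (int M) else {0})}"
  have "card W = (\<Prod>l\<in>UNIV. card (if l \<in> J then fls_seg (int (M - a)) (int M) else {0 :: 'k fls}))"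
    unfolding W_def by (rule card_vec_box)
  also have "\<dots> = (\<Prod>l\<in>UNIV. if l \<in> J then CARD('k) ^ a else 1)"
    using a by (intro prod.cong) (auto simp: card_fls_seg nat_diff_distrib)
  also have "\<dots> = CARD('k) ^ (a * card J)"
    by (simp add: prod.If_cases power_mult)
  finally have cardW: "card W = CARD('k) ^ (a * card J)" .
  have finW: "finite W" unfolding W_def by (rule finite_vec_box) auto
  \<comment> \<open>The second component saves the digits from \<open>M - a\<close> on, exactly
    those that \<open>c\<close> pushes beyond \<open>t^M\<close>.\<close>
  define f where "f = (\<lambda>d::'k fls ^ 'n. (vec_trunc M (c *s d), d - vec_trunc (M - a) d))"
  have c0: "c \<in> fls_ideal 0" using c by (simp add: fls_ideal_iff)
  have "inj_on f (cyc_ann M J A z)"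
  proof
    fix d d' assume eq: "f d = f d'"
    have "d $ l - d' $ l \<in> fls_ideal (int (M - a))" for l
    proof -
      have "fls_trunc (int M) (c * d $ l) = fls_trunc (int M) (c * d' $ l)"
        using eq by (auto simp: f_def vec_trunc_def vec_eq_iff)
      then have "c * (d $ l - d' $ l) \<in> fls_ideal (int M)"
        by (simp add: fls_trunc_eq_iff algebra_simps)
      then show ?thesis using c a by (simp add: fls_ideal_mult_iff of_nat_diff)
    qed
    then have "vec_trunc (M - a) d = vec_trunc (M - a) d'"
      by (simp add: vec_trunc_def vec_eq_iff fls_trunc_eq_iff)
    then show "d = d'" using eq by (auto simp: f_def)
  qed
  moreover have "f ` cyc_ann M J A z \<subseteq> cyc_ann M J A z' \<times> W"
  proof safe
    fix d x y assume d: "d \<in> cyc_ann M J A z" and xy: "(x, y) = f d"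
    have dr: "d \<in> vec_reps M" and d0: "\<And>l. l \<notin> J \<Longrightarrow> d $ l = 0"
      and dz: "\<And>i. pairing J d ((step J A ^^ i) z) \<in> fls_ideal (int M)"
      using d by (auto simp: cyc_ann_def)
    have di: "d $ l \<in> fls_ideal 0" for l using dr by (auto simp: vec_reps_def intro: fls_seg_ideal)
    show "x \<in> cyc_ann M J A z'"
      unfolding cyc_ann_def
    proof safe
      show "x \<in> vec_reps M"
        using xy c0 di by (auto simp: f_def vec_reps_def vec_trunc_def intro!: fls_trunc_seg fls_ideal_mult0)
      show "x $ l = 0" if "l \<notin> J" for l
        using xy d0[OF that] by (simp add: f_def vec_trunc_def)
      show "pairing J x ((step J A ^^ i) z') \<in> fls_ideal (int M)" for i
      proof -
        \<comment> \<open>The first instance gives homogeneity up to the value at 0, the second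
          shows that this value is 0.\<close>
        have lin: "(step J A ^^ i) (c *s z') = c *s (step J A ^^ i) z'"
          using funpow_step_diff_smult[where J = J and A = A and i = i and x = 0 and c = "- c" and y = z']
            funpow_step_diff_smult[where J = J and A = A and i = i and x = 0 and c = 1 and y = 0]
          by (simp add: vec_eq_iff)
        have "pairing J x ((step J A ^^ i) z') \<in> fls_ideal (int M) \<longleftrightarrow>
              pairing J (c *s d) ((step J A ^^ i) z') \<in> fls_ideal (int M)"
          using xy by (intro pairing_cong_left int_vec_funpow_step A z')
             (auto simp: f_def vec_trunc_def fls_trunc_diff')
        also have "pairing J (c *s d) ((step J A ^^ i) z') = pairing J d ((step J A ^^ i) (c *s z'))"
          by (simp add: lin) (simp add: pairing_def algebra_simps)
        also have "\<dots> \<in> fls_ideal (int M) \<longleftrightarrow> pairing J d ((step J A ^^ i) z) \<in> fls_ideal (int M)"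
          by (rule pairing_cong[symmetric, OF funpow_step_cong[OF A A z(1)] int_vec_reps[OF dr]])
             (use z in auto)
        finally show ?thesis using dz by simp
      qed
    qed
    show "y \<in> W"
      using xy dr d0 a by (auto simp: f_def W_def vec_trunc_def vec_reps_def fls_seg_def fls_eq_iff)
  qed
  ultimately have "card (cyc_ann M J A z) \<le> card (cyc_ann M J A z' \<times> W)"
    by (intro card_inj_on_le) (auto simp: finW)
  then show ?thesis by (simp add: card_cartesian_product cardW mult.commute)
qed

section \<open>Averaging over matrices\<close>

lemma card_field_gt_1: "1 < real CARD('k::{field,finite})"
proof -
  have "card {0, 1 :: 'k} \<le> CARD('k)" by (intro card_mono) auto
  then show ?thesis by simp
qed

lemma fls_seg_subdegree_less:
  assumes "x \<in> fls_seg a b" "x \<noteq> 0"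
  shows "fls_subdegree x < b"
proof (rule ccontr)
  assume "\<not> fls_subdegree x < b"
  then have "x $$ fls_subdegree x = 0" using assms(1) by (simp add: fls_seg_def)
  then show False using assms(2) by simp
qed

text \<open>The moment of order \<open>s\<close> of the annihilator, unnormalised. Matrices and
  vectors keep full size for every \<open>J\<close>, so one ambient count serves all stages of the
  recursion. The first argument only fixes the field.\<close>

definition cyc_sum :: "'k::{field,finite} itself \<Rightarrow> nat \<Rightarrow> real \<Rightarrow> 'n::finite set \<Rightarrow> real" where
  "cyc_sum _ M s J =
     (\<Sum>(A, z) \<in> (mat_reps M :: ('k fls ^ 'n ^ 'n) set) \<times> vec_reps M. real (card (cyc_ann M J A z)) powr s)"

definition set_col :: "'n \<Rightarrow> 'a ^ 'n \<Rightarrow> 'a ^ 'n ^ 'n \<Rightarrow> 'a ^ 'n ^ 'n" where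
  "set_col j w A = (\<chi> l k. if k = j then w $ l else A $ l $ k)"

definition set_row :: "'n \<Rightarrow> 'a ^ 'n \<Rightarrow> 'a ^ 'n ^ 'n \<Rightarrow> 'a ^ 'n ^ 'n" where
  "set_row j w A = (\<chi> l. if l = j then w else A $ l)"

text \<open>Exchanging \<open>w\<close> with column \<open>j\<close> is an involution on pairs, so
  overwriting a column by an independent uniform one leaves a uniform matrix uniform.\<close>

lemma sum_set_col:
  fixes F :: "'k::{field,finite} fls ^ 'n::finite ^ 'n \<Rightarrow> real"
  shows "(\<Sum>(A, w) \<in> mat_reps M \<times> vec_reps M. F (set_col j w A))
       = real (card (vec_reps M :: ('k fls ^ 'n) set)) * (\<Sum>A\<in>mat_reps M. F A)"
proof -
  have "(\<Sum>(A, w) \<in> mat_reps M \<times> vec_reps M. F (set_col j w A))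
      = (\<Sum>(A, w) \<in> mat_reps M \<times> (vec_reps M :: ('k fls ^ 'n) set). F A)"
    by (rule sum.reindex_bij_witness[where i = "\<lambda>(A, w). (set_col j w A, column j A)"
          and j = "\<lambda>(A, w). (set_col j w A, column j A)"])
      (auto simp: set_col_def column_def mat_reps_def vec_reps_def vec_eq_iff)
  also have "\<dots> = real (card (vec_reps M :: ('k fls ^ 'n) set)) * (\<Sum>A\<in>mat_reps M. F A)"
    by (simp add: sum_distrib_left flip: sum.cartesian_product)
  finally show ?thesis .
qed

lemma sum_set_row:
  fixes F :: "'k::{field,finite} fls ^ 'n::finite ^ 'n \<Rightarrow> real"
  shows "(\<Sum>(A, w) \<in> mat_reps M \<times> vec_reps M. F (set_row j w A))
       = real (card (vec_reps M :: ('k fls ^ 'n) set)) * (\<Sum>A\<in>mat_reps M. F A)"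
proof -
  have "(\<Sum>(A, w) \<in> mat_reps M \<times> vec_reps M. F (set_row j w A))
      = (\<Sum>(A, w) \<in> mat_reps M \<times> (vec_reps M :: ('k fls ^ 'n) set). F A)"
    by (rule sum.reindex_bij_witness[where i = "\<lambda>(A, w). (set_row j w A, A $ j)"
          and j = "\<lambda>(A, w). (set_row j w A, A $ j)"])
      (auto simp: set_row_def mat_reps_def vec_reps_def vec_eq_iff)
  also have "\<dots> = real (card (vec_reps M :: ('k fls ^ 'n) set)) * (\<Sum>A\<in>mat_reps M. F A)"
    by (simp add: sum_distrib_left flip: sum.cartesian_product)
  finally show ?thesis .
qed

text \<open>For \<open>j\<close> outside \<open>J\<close> the \<open>J\<close>-block does not meet
  column \<open>j\<close>. The column of a uniform matrix therefore acts as a uniform vector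
  independent of the block.\<close>

lemma sum_cyc_ann_column:
  fixes j :: "'n::finite"
  assumes "j \<notin> J"
  shows "real (card (vec_reps M :: ('k::{field,finite} fls ^ 'n) set)) *
     (\<Sum>A\<in>(mat_reps M :: ('k fls ^ 'n ^ 'n) set). real (card (cyc_ann M J A (column j A))) powr s)
     = cyc_sum TYPE('k) M s J"
  unfolding sum_set_col[symmetric, where j = j] cyc_sum_def
proof (intro sum.cong refl, clarify)
  fix A :: "'k fls ^ 'n ^ 'n" and w :: "'k fls ^ 'n"
  assume A: "A \<in> mat_reps M" and w: "w \<in> vec_reps M"
  then have r: "set_col j w A \<in> mat_reps M"
    by (auto simp: set_col_def mat_reps_def vec_reps_def)
  have "cyc_ann M J (set_col j w A) (column j (set_col j w A)) = cyc_ann M J A w"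
    by (rule cyc_ann_cong[OF int_mat_reps[OF r] int_mat_reps[OF A]])
       (use assms w in \<open>auto simp: set_col_def column_def intro: int_vec_reps[unfolded int_vec_def, THEN bspec] simp: int_vec_def\<close>)
  then show "real (card (cyc_ann M J (set_col j w A) (column j (set_col j w A)))) powr s =
       real (card (cyc_ann M J A w)) powr s" by simp
qed

lemma fls_ideal_mat_trunc_eqD:
  fixes A B :: "'k::group_add fls ^ 'n ^ 'n"
  shows "mat_trunc M A = mat_trunc M B \<Longrightarrow> A $ l $ k - B $ l $ k \<in> fls_ideal (int M)"
  by (auto simp: mat_trunc_def vec_trunc_def vec_eq_iff fls_trunc_eq_iff)

text \<open>Triangular elimination: row \<open>j\<close> is unchanged, it yields the columns off
  \<open>j\<close>, and these yield column \<open>j\<close>, where \<open>A $ l $ j\<close> occurs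
  with coefficient \<open>z $ j = 1\<close>.\<close>

lemma mat_trunc_red_mat_inj:
  fixes z :: "'k::field fls ^ 'n::finite"
  assumes J: "j \<in> J" "z $ j = 1"
  shows "inj_on (\<lambda>A. mat_trunc M (red_mat J j z A)) (mat_reps M)"
proof
  fix A B :: "'k fls ^ 'n ^ 'n" assume A: "A \<in> mat_reps M" and B: "B \<in> mat_reps M"
    and eq: "mat_trunc M (red_mat J j z A) = mat_trunc M (red_mat J j z B)"
  note D = fls_ideal_mat_trunc_eqD[OF eq]
  have eqI: "A $ l $ k = B $ l $ k" if "A $ l $ k - B $ l $ k \<in> fls_ideal (int M)" for l k
    using fls_seg_eqI[OF _ _ that, of 0] A B by (auto simp: mat_reps_def)
  have row: "A $ j $ k = B $ j $ k" for k
    using D[of j k] by (intro eqI) (simp add: red_mat_def)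
  have off: "A $ l $ k = B $ l $ k" if "k \<noteq> j" for l k
  proof (cases "l = j")
    case False
    then show ?thesis using D[of l k] row that by (intro eqI) (simp add: red_mat_def)
  qed (simp add: row)
  have "A $ l $ j = B $ l $ j" for l
  proof (cases "l = j")
    case False
    have fin: "finite J" by simp
    show ?thesis
      using D[of l j] False J fin by (intro eqI) (simp add: red_mat_def row off sum.remove[of J j])
  qed (simp add: row)
  then show "A = B" unfolding vec_eq_iff using off by metis
qed

text \<open>Reduction followed by truncation injects the finite set \<open>mat_reps M\<close> into
  itself. So for fixed primitive \<open>z\<close> the reduced matrix is again uniform, and its
  column \<open>j\<close> supplies the random vector of the next stage.\<close>

lemma sum_cyc_ann_primitive:
  fixes z :: "'k::{field,finite} fls ^ 'n::finite"
  assumes J: "j \<in> J" "z $ j = 1" and z: "int_vec UNIV z" and s: "s \<ge> 0"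
  shows "real (card (vec_reps M :: ('k fls ^ 'n) set)) *
     (\<Sum>A\<in>mat_reps M. real (card (cyc_ann M J A z)) powr s) \<le> cyc_sum TYPE('k) M s (J - {j})"
proof -
  define H where "H = (\<lambda>A :: 'k fls ^ 'n ^ 'n. real (card (cyc_ann M (J - {j}) A (column j A))) powr s)"
  define \<psi> where "\<psi> = (\<lambda>A. mat_trunc M (red_mat J j z A))"
  have int: "int_mat UNIV (red_mat J j z A)" if "A \<in> mat_reps M" for A
    by (rule int_mat_red_mat[OF int_mat_reps[OF that] z])
  have \<psi>: "\<psi> A \<in> mat_reps M" if "A \<in> mat_reps M" for A
    using int[OF that]
    by (auto simp: \<psi>_def mat_reps_def mat_trunc_def vec_trunc_def int_mat_def intro!: fls_trunc_seg)
  have "real (card (cyc_ann M J A z)) powr s \<le> H (\<psi> A)" if A: "A \<in> mat_reps M" for A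
  proof -
    let ?B = "red_mat J j z A"
    have "card (cyc_ann M J A z) \<le> card (cyc_ann M (J - {j}) ?B (column j ?B))"
      by (rule card_cyc_ann_reduce[OF J int_mat_reps[OF A] z])
    also have "cyc_ann M (J - {j}) ?B (column j ?B) = cyc_ann M (J - {j}) (\<psi> A) (column j (\<psi> A))"
    proof (rule cyc_ann_cong)
      show "int_mat (J - {j}) ?B" "int_mat (J - {j}) (\<psi> A)"
        using int[OF A] int_mat_reps[OF \<psi>[OF A]] int_mat_subset by blast+
      show "int_vec (J - {j}) (column j ?B)"
        using int[OF A] by (auto simp: int_mat_def int_vec_def column_def)
    qed (auto simp: \<psi>_def mat_trunc_def vec_trunc_def column_def fls_trunc_diff)
    finally show ?thesis unfolding H_def using s by (intro powr_mono2) auto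
  qed
  then have "(\<Sum>A\<in>mat_reps M. real (card (cyc_ann M J A z)) powr s) \<le> (\<Sum>A\<in>mat_reps M. H (\<psi> A))"
    by (rule sum_mono)
  also have "\<dots> = sum H (\<psi> ` mat_reps M)"
    using mat_trunc_red_mat_inj[OF J, of M] by (simp add: \<psi>_def sum.reindex)
  also have "\<dots> \<le> sum H (mat_reps M)"
    using \<psi> by (intro sum_mono2) (auto simp: H_def)
  finally have "real (card (vec_reps M :: ('k fls ^ 'n) set)) *
      (\<Sum>A\<in>mat_reps M. real (card (cyc_ann M J A z)) powr s)
      \<le> real (card (vec_reps M :: ('k fls ^ 'n) set)) * sum H (mat_reps M)"
    by (rule mult_left_mono) simp
  also have "\<dots> = cyc_sum TYPE('k) M s (J - {j})"
    unfolding H_def by (rule sum_cyc_ann_column) simp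
  finally show ?thesis .
qed

text \<open>\<open>t^a\<close> is the content of the \<open>J\<close>-part of \<open>z\<close>,
  attained at coordinate \<open>j\<close>, and \<open>z'\<close> is the primitive vector left after
  dividing by \<open>z $ j\<close>.\<close>

lemma vec_reps_primitive_part:
  fixes z :: "'k::{field,finite} fls ^ 'n::finite"
  assumes "J \<noteq> {}" and z: "z \<in> vec_reps M"
  obtains a j z' where "a \<le> M" "j \<in> J" "z' $ j = 1" "int_vec UNIV z'"
    "\<And>l. l \<in> J \<Longrightarrow> z $ l \<in> fls_seg (int a) (int M)"
    "\<And>A. int_mat J A \<Longrightarrow> card (cyc_ann M J A z) \<le> CARD('k) ^ (a * card J) * card (cyc_ann M J A z')"
proof (cases "\<forall>l\<in>J. z $ l = 0")
  case True
  obtain j where j: "j \<in> J" using assms by blast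
  \<comment> \<open>Modulo \<open>t^M\<close> the zero vector is \<open>t^M\<close> times any
    primitive vector, so its content is taken to be \<open>t^M\<close>.\<close>
  show ?thesis
  proof (rule that[of M j "axis j 1"])
    show i: "int_vec UNIV (axis j (1 :: 'k fls))" by (auto simp: int_vec_def axis_def)
    show "card (cyc_ann M J A z) \<le> CARD('k) ^ (M * card J) * card (cyc_ann M J A (axis j 1))"
      if "int_mat J A" for A
    proof (rule card_cyc_ann_scale[where c = "fls_X_intpow (int M)", OF _ _ that])
      show "int_vec J (axis j (1 :: 'k fls))" using i int_vec_subset by blast
      show "z $ l - fls_X_intpow (int M) * axis j 1 $ l \<in> fls_ideal (int M)" if "l \<in> J" for l
        using True that fls_ideal_uminus[OF fls_ideal_X_intpow[of "int M", where 'a='k]]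
        by (auto simp: axis_def)
    qed (use True int_vec_reps[OF z] in auto)
  qed (use j True in \<open>auto simp: axis_def fls_seg_def\<close>)
next
  case False
  define S where "S = {l \<in> J. z $ l \<noteq> 0}"
  have S: "finite S" "S \<noteq> {}" using False by (auto simp: S_def)
  define j where "j = arg_min_on (\<lambda>l. fls_subdegree (z $ l)) S"
  have j: "j \<in> J" "z $ j \<noteq> 0" using arg_min_if_finite(1)[OF S, of "\<lambda>l. fls_subdegree (z $ l)"]
    by (auto simp: S_def j_def)
  have min: "fls_subdegree (z $ j) \<le> fls_subdegree (z $ l)" if "l \<in> J" "z $ l \<noteq> 0" for l
    using arg_min_least[OF S, of l "\<lambda>l. fls_subdegree (z $ l)"] that by (auto simp: j_def S_def)
  define a where "a = nat (fls_subdegree (z $ j))"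
  have zr: "z $ l \<in> fls_seg 0 (int M)" for l using z by (simp add: vec_reps_def)
  then have "z $ j \<in> fls_ideal 0" by (rule fls_seg_ideal)
  then have a: "fls_subdegree (z $ j) = int a" using j by (simp add: fls_ideal_iff a_def)
  have "fls_subdegree (z $ j) < int M"
    by (rule fls_seg_subdegree_less[OF zr j(2)])
  then have aM: "a \<le> M" using a by simp
  have za: "z $ l \<in> fls_ideal (int a)" if "l \<in> J" for l
    using min[OF that] by (auto simp: fls_ideal_iff a)
  \<comment> \<open>Dividing by \<open>z $ j\<close>, a unit times \<open>t^a\<close>, makes
    coordinate \<open>j\<close> exactly 1. Outside \<open>J\<close> the order of
    \<open>z $ l\<close> may be below \<open>a\<close>, so 0 is put there to keep \<open>z'\<close>
    integral.\<close>
  define z' where "z' = (\<chi> l. if l \<in> J then z $ l / z $ j else 0)"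
  have z'i: "int_vec UNIV z'"
    using za fls_ideal_mult_iff[OF j(2), of "z $ l / z $ j" "int a" for l] j(2)
    by (auto simp: int_vec_def z'_def a)
  show ?thesis
  proof (rule that[of a j z'])
    show "z $ l \<in> fls_seg (int a) (int M)" if "l \<in> J" for l
      using za[OF that] zr[of l] by (auto simp: fls_ideal_def fls_seg_def)
    show "card (cyc_ann M J A z) \<le> CARD('k) ^ (a * card J) * card (cyc_ann M J A z')"
      if "int_mat J A" for A
      by (rule card_cyc_ann_scale[OF j(2) a that int_vec_subset[OF z'i subset_UNIV]
            int_vec_reps[OF z] _ aM])
         (use j in \<open>auto simp: z'_def\<close>)
  qed (use aM j z'i in \<open>auto simp: z'_def\<close>)
qed

lemma cyc_sum_empty:
  "cyc_sum TYPE('k::{field,finite}) M s ({} :: 'n::finite set) =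
     real (CARD('k) ^ (M * CARD('n) * CARD('n) + M * CARD('n)))"
proof -
  have "cyc_ann M {} A z = {0}" for A :: "'k fls ^ 'n ^ 'n" and z
    by (auto simp: cyc_ann_def pairing_def vec_reps_def fls_seg_def vec_eq_iff)
  then show ?thesis
    by (simp add: cyc_sum_def card_cartesian_product card_mat_reps card_vec_reps power_add)
qed

text \<open>Each index removed from \<open>J\<close> costs one geometric series over the content,
  with ratio \<open>CARD('k) powr (card J * (s - 1))\<close>. Replacing \<open>card J\<close> by 1
  bounds every such series by \<open>C\<close>. At \<open>s = 1\<close> the ratio would be 1 and the
  bound would grow with \<open>M\<close>.\<close>

lemma cyc_sum_le:
  fixes s :: real and J :: "'n::finite set"
  assumes s: "0 \<le> s" "s < 1"
  defines "C \<equiv> 1 / (1 - real CARD('k) powr (s - 1))"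
  shows "cyc_sum TYPE('k::{field,finite}) M s J \<le>
     C ^ card J * real (CARD('k) ^ (M * CARD('n) * CARD('n) + M * CARD('n)))"
proof (induction "card J" arbitrary: J)
  case 0
  then have "J = {}" by simp
  then show ?case by (simp add: cyc_sum_empty)
next
  case (Suc m)
  let ?q = "real CARD('k)"
  let ?R = "vec_reps M :: ('k fls ^ 'n) set"
  have q1: "?q > 1" by (rule card_field_gt_1)
  then have q0: "?q > 0" by linarith
  define B where "B = C ^ m * real (CARD('k) ^ (M * CARD('n) * CARD('n) + M * CARD('n)))"
  define V where "V = ?q ^ (M * CARD('n))"
  have V: "real (card ?R) = V" by (simp add: V_def card_vec_reps)
  have V0: "V > 0" using q1 by (simp add: V_def)
  have r1: "?q powr (s - 1) < 1" using q1 s by (simp add: powr_less_one)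
  then have C0: "C \<ge> 0" by (simp add: C_def)
  have B0: "B \<ge> 0" using C0 by (simp add: B_def)
  have J: "J \<noteq> {}" using Suc by auto
  define r where "r = ?q powr (real (card J) * (s - 1))"
  have r: "0 \<le> r" "r \<le> ?q powr (s - 1)"
  proof -
    have "real (card J) * (s - 1) \<le> 1 * (s - 1)"
      using Suc(2) s by (intro mult_right_mono_neg) auto
    then show "r \<le> ?q powr (s - 1)" unfolding r_def using q1 by (intro powr_mono) auto
  qed (simp add: r_def)
  define T where "T = (\<lambda>a. {z \<in> ?R. \<forall>l\<in>J. z $ l \<in> fls_seg (int a) (int M)})"
  define h where "h = (\<lambda>a. ?q powr (real (a * card J) * s) * (B / V))"
  have h0: "h a \<ge> 0" for a using B0 V0 by (simp add: h_def)
  have "\<exists>a\<le>M. z \<in> T a \<and> (\<Sum>A\<in>mat_reps M. real (card (cyc_ann M J A z)) powr s) \<le> h a"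
    if z: "z \<in> ?R" for z
  proof -
    obtain a j z' where *: "a \<le> M" "j \<in> J" "z' $ j = 1" "int_vec UNIV z'"
      "\<And>l. l \<in> J \<Longrightarrow> z $ l \<in> fls_seg (int a) (int M)"
      "\<And>A. int_mat J A \<Longrightarrow> card (cyc_ann M J A z) \<le> CARD('k) ^ (a * card J) * card (cyc_ann M J A z')"
      using vec_reps_primitive_part[OF J z] by metis
    have "(\<Sum>A\<in>mat_reps M. real (card (cyc_ann M J A z)) powr s)
       \<le> (\<Sum>A\<in>mat_reps M. ?q powr (real (a * card J) * s) * real (card (cyc_ann M J A z')) powr s)"
    proof (rule sum_mono)
      fix A :: "'k fls ^ 'n ^ 'n" assume "A \<in> mat_reps M"
      then have "real (card (cyc_ann M J A z)) \<le> real (CARD('k) ^ (a * card J) * card (cyc_ann M J A z'))"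
        using *(6)[OF int_mat_reps] by (simp only: of_nat_le_iff)
      then have "real (card (cyc_ann M J A z)) powr s \<le>
           (?q ^ (a * card J) * real (card (cyc_ann M J A z'))) powr s"
        using s by (intro powr_mono2) auto
      also have "?q ^ (a * card J) = ?q powr real (a * card J)"
        by (rule powr_realpow[OF q0, symmetric])
      finally show "real (card (cyc_ann M J A z)) powr s \<le>
           ?q powr (real (a * card J) * s) * real (card (cyc_ann M J A z')) powr s"
        by (simp add: powr_mult powr_powr)
    qed
    also have "\<dots> \<le> h a"
    proof -
      have "V * (\<Sum>A\<in>mat_reps M. real (card (cyc_ann M J A z')) powr s) \<le> cyc_sum TYPE('k) M s (J - {j})"
        unfolding V[symmetric] by (rule sum_cyc_ann_primitive) (use * s in auto)
      also have "\<dots> \<le> B"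
      proof -
        have "card (J - {j}) = m" using Suc(2) *(2) by simp
        then show ?thesis using Suc(1)[of "J - {j}"] by (simp add: B_def)
      qed
      finally have "(\<Sum>A\<in>mat_reps M. real (card (cyc_ann M J A z')) powr s) \<le> B / V"
        using V0 by (simp add: field_simps)
      then show ?thesis
        unfolding h_def by (subst sum_distrib_left[symmetric]) (rule mult_left_mono, auto)
    qed
    finally show ?thesis using * z by (auto simp: T_def)
  qed
  then obtain \<alpha> where \<alpha>: "\<And>z. z \<in> ?R \<Longrightarrow> \<alpha> z \<le> M \<and> z \<in> T (\<alpha> z) \<and>
      (\<Sum>A\<in>mat_reps M. real (card (cyc_ann M J A z)) powr s) \<le> h (\<alpha> z)" by metis
  have card_T: "real (card (T a)) = V * ?q powr (- real (a * card J))" if "a \<le> M" for a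
  proof -
    have "T a = {z. \<forall>l. z $ l \<in> (if l \<in> J then fls_seg (int a) (int M) else fls_seg 0 (int M))}"
      by (auto simp: T_def vec_reps_def fls_seg_def split: if_splits)
    then have "card (T a) = (\<Prod>l\<in>UNIV. card (if l \<in> J then fls_seg (int a) (int M) else fls_seg 0 (int M) :: 'k fls set))"
      by (simp add: card_vec_box)
    also have "\<dots> = (\<Prod>l\<in>UNIV. if l \<in> J then CARD('k) ^ (M - a) else CARD('k) ^ M)"
      by (intro prod.cong) (use that in \<open>auto simp: card_fls_seg simp flip: of_nat_diff\<close>)
    also have "\<dots> = CARD('k) ^ ((M - a) * card J + M * card (- J))"
      by (simp add: prod.If_cases power_mult power_add)
    also have "card (- J) = CARD('n) - card J" by (simp add: Compl_eq_Diff_UNIV card_Diff_subset)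
    finally have "real (card (T a)) = ?q powr real ((M - a) * card J + M * (CARD('n) - card J))"
      by (simp only: of_nat_power powr_realpow[OF q0])
    also have "(M - a) * card J + M * (CARD('n) - card J) = M * CARD('n) - a * card J"
      using that card_mono[of UNIV J] by (simp add: diff_mult_distrib diff_mult_distrib2 mult.commute)
    also have "real \<dots> = real (M * CARD('n)) - real (a * card J)"
      using that card_mono[of UNIV J] by (subst of_nat_diff) (auto intro: mult_le_mono)
    also have "?q powr \<dots> = V * ?q powr (- real (a * card J))"
      by (simp only: V_def powr_realpow[OF q0] powr_diff powr_minus divide_inverse)
    finally show ?thesis .
  qed
  have "cyc_sum TYPE('k) M s J = (\<Sum>z\<in>?R. \<Sum>A\<in>mat_reps M. real (card (cyc_ann M J A z)) powr s)"
    unfolding cyc_sum_def by (subst sum.swap) (simp add: sum.cartesian_product)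
  \<comment> \<open>Each \<open>z\<close> is charged to every \<open>a\<close> with \<open>z\<close>
    in \<open>T a\<close>, not just to its content: the extra terms are nonnegative, and
    \<open>T a\<close>, unlike the set of vectors of exact content, is a box.\<close>
  also have "\<dots> \<le> (\<Sum>z\<in>?R. \<Sum>a\<le>M. if z \<in> T a then h a else 0)"
  proof (rule sum_mono)
    fix z assume z: "z \<in> ?R"
    have "h (\<alpha> z) = (if z \<in> T (\<alpha> z) then h (\<alpha> z) else 0)" using \<alpha>[OF z] by simp
    also have "\<dots> \<le> (\<Sum>a\<le>M. if z \<in> T a then h a else 0)"
      using \<alpha>[OF z] h0 by (intro member_le_sum) auto
    finally show "(\<Sum>A\<in>mat_reps M. real (card (cyc_ann M J A z)) powr s) \<le> (\<Sum>a\<le>M. if z \<in> T a then h a else 0)"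
      using \<alpha>[OF z] by linarith
  qed
  also have "\<dots> = (\<Sum>a\<le>M. real (card (T a)) * h a)"
  proof -
    have "?R \<inter> {z. z \<in> T a} = T a" for a by (auto simp: T_def)
    then show ?thesis by (subst sum.swap) (simp add: sum.If_cases)
  qed
  also have "\<dots> = (\<Sum>a\<le>M. B * r ^ a)"
  proof (intro sum.cong refl)
    fix a assume "a \<in> {..M}"
    then have "real (card (T a)) * h a = B * (?q powr (- real (a * card J)) * ?q powr (real (a * card J) * s))"
      using V0 by (simp add: card_T h_def field_simps)
    also have "?q powr (- real (a * card J)) * ?q powr (real (a * card J) * s) = r ^ a"
    proof -
      have "r ^ a = r powr real a" unfolding r_def using q0 by (subst powr_realpow) auto
      then show ?thesis by (simp add: r_def powr_powr algebra_simps flip: powr_add)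
    qed
    finally show "real (card (T a)) * h a = B * r ^ a" .
  qed
  also have "\<dots> = B * (\<Sum>a\<le>M. r ^ a)" by (simp add: sum_distrib_left)
  also have "(\<Sum>a\<le>M. r ^ a) \<le> (\<Sum>a. r ^ a)"
    using r r1 by (intro sum_le_suminf summable_geometric) auto
  also have "(\<Sum>a. r ^ a) = 1 / (1 - r)" using r r1 by (intro suminf_geometric) auto
  also have "1 / (1 - r) \<le> C" unfolding C_def using r r1 by (intro divide_left_mono) auto
  also have "B * C = C ^ card J * real (CARD('k) ^ (M * CARD('n) * CARD('n) + M * CARD('n)))"
    by (simp add: B_def Suc(2)[symmetric])
  finally show ?case using B0 by (simp add: mult_left_mono)
qed

section \<open>Characteristic polynomials\<close>

text \<open>Serves four homomorphisms below: \<open>x\<close> to \<open>c x\<close>,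
  \<open>x\<close> to \<open>fls_X_inv\<close>, power series into Laurent series, and the constant
  term.\<close>

lemma det_hom:
  fixes h :: "'a::comm_ring_1 \<Rightarrow> 'b::comm_ring_1" and A :: "'a ^ 'n ^ 'n"
  assumes h1: "h 1 = 1" and add: "\<And>x y. h (x + y) = h x + h y" and mult: "\<And>x y. h (x * y) = h x * h y"
  shows "h (det A) = det (\<chi> i j. h (A $ i $ j))"
proof -
  have h0: "h 0 = 0" using add[of 0 0] by simp
  have minus: "h (- x) = - h x" for x using add[of x "- x"] h0 by (simp add: eq_neg_iff_add_eq_0 add.commute)
  have sum: "h (sum f S) = (\<Sum>x\<in>S. h (f x))" for f :: "('n \<Rightarrow> 'n) \<Rightarrow> 'a" and S
    by (induction S rule: infinite_finite_induct) (auto simp: h0 add)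
  have prod: "h (prod f S) = (\<Prod>x\<in>S. h (f x))" for f :: "'n \<Rightarrow> 'a" and S
    by (induction S rule: infinite_finite_induct) (auto simp: h1 mult)
  have sign: "h (of_int (sign p)) = of_int (sign p)" for p :: "'n \<Rightarrow> 'n"
    by (simp add: sign_def h1 minus)
  show ?thesis by (simp add: det_def sum prod mult sign)
qed

lemma det_mem_subring:
  fixes A :: "'a::comm_ring_1 ^ 'n ^ 'n"
  assumes "1 \<in> S" and add: "\<And>x y. x \<in> S \<Longrightarrow> y \<in> S \<Longrightarrow> x + y \<in> S"
    and minus: "\<And>x. x \<in> S \<Longrightarrow> - x \<in> S" and mult: "\<And>x y. x \<in> S \<Longrightarrow> y \<in> S \<Longrightarrow> x * y \<in> S"
    and A: "\<And>i j. A $ i $ j \<in> S"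
  shows "det A \<in> S"
proof -
  have "0 \<in> S" using add[OF \<open>1 \<in> S\<close> minus[OF \<open>1 \<in> S\<close>]] by simp
  have prod: "prod f X \<in> S" if "\<And>x. f x \<in> S" for f :: "'n \<Rightarrow> 'a" and X
    by (induction X rule: infinite_finite_induct) (auto simp: mult that \<open>1 \<in> S\<close>)
  have sum: "sum f X \<in> S" if "\<And>x. f x \<in> S" for f :: "('n \<Rightarrow> 'n) \<Rightarrow> 'a" and X
    by (induction X rule: infinite_finite_induct) (auto simp: add that \<open>0 \<in> S\<close>)
  have "of_int (sign p) \<in> S" for p :: "'n \<Rightarrow> 'n"
    using \<open>1 \<in> S\<close> minus by (simp add: sign_def)
  then show ?thesis unfolding det_def by (intro sum mult prod A)
qed

text \<open>Each product of the Leibniz expansion telescopes: factors are exchanged one at a time,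
  at the cost of a difference in \<open>I\<close> times elements of \<open>S\<close>.\<close>

lemma det_cong_ideal:
  fixes A B :: "'a::comm_ring_1 ^ 'n ^ 'n"
  assumes S: "1 \<in> S" and mult: "\<And>x y. x \<in> S \<Longrightarrow> y \<in> S \<Longrightarrow> x * y \<in> S"
    and I: "0 \<in> I" and add: "\<And>x y. x \<in> I \<Longrightarrow> y \<in> I \<Longrightarrow> x + y \<in> I"
    and minus: "\<And>x. x \<in> I \<Longrightarrow> - x \<in> I" and absorb: "\<And>x y. x \<in> S \<Longrightarrow> y \<in> I \<Longrightarrow> x * y \<in> I"
    and A: "\<And>i j. A $ i $ j \<in> S" and B: "\<And>i j. B $ i $ j \<in> S"
    and AB: "\<And>i j. A $ i $ j - B $ i $ j \<in> I"
  shows "det A - det B \<in> I"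
proof -
  have prod: "prod f X \<in> S" if "\<And>x. f x \<in> S" for f :: "'n \<Rightarrow> 'a" and X
    by (induction X rule: infinite_finite_induct) (auto simp: mult that S)
  have prod_diff: "prod f X - prod g X \<in> I"
    if f: "\<And>x. f x \<in> S" and g: "\<And>x. g x \<in> S" and fg: "\<And>x. f x - g x \<in> I" for f g :: "'n \<Rightarrow> 'a" and X
  proof (induction X rule: infinite_finite_induct)
    case (insert x X)
    have "prod f (insert x X) - prod g (insert x X)
        = f x * (prod f X - prod g X) + prod g X * (f x - g x)"
      using insert by (simp add: algebra_simps)
    then show ?case using insert f g fg prod[of g X] by (simp add: add absorb)
  qed (auto simp: I)
  have sum: "sum f X \<in> I" if "\<And>x. f x \<in> I" for f :: "('n \<Rightarrow> 'n) \<Rightarrow> 'a" and X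
    by (induction X rule: infinite_finite_induct) (auto simp: add that I)
  have sign: "of_int (sign p) * x \<in> I" if "x \<in> I" for p :: "'n \<Rightarrow> 'n" and x
    using that minus by (simp add: sign_def)
  show ?thesis
    unfolding det_def sum_subtractf[symmetric] right_diff_distrib[symmetric]
    by (intro sum sign prod_diff A B AB)
qed

definition poly_ideal :: "int \<Rightarrow> 'k::field fls poly set" where
  "poly_ideal k = {p. \<forall>i. coeff p i \<in> fls_ideal k}"

lemma poly_ideal_mult: "p \<in> poly_ideal 0 \<Longrightarrow> r \<in> poly_ideal k \<Longrightarrow> p * r \<in> poly_ideal k"
  by (auto simp: poly_ideal_def coeff_mult intro!: fls_ideal_sum fls_ideal_mult0)

lemma poly_ideal_closed:
  "0 \<in> poly_ideal k" "1 \<in> poly_ideal 0"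
  "p \<in> poly_ideal k \<Longrightarrow> r \<in> poly_ideal k \<Longrightarrow> p + r \<in> poly_ideal k"
  "p \<in> poly_ideal k \<Longrightarrow> - p \<in> poly_ideal k"
  "a \<in> fls_ideal k \<Longrightarrow> [:a:] \<in> poly_ideal k"
  by (auto simp: poly_ideal_def fls_ideal_add fls_ideal_uminus coeff_pCons split: nat.splits)

lemma poly_ideal_linear: "a \<in> fls_ideal k \<Longrightarrow> b \<in> fls_ideal k \<Longrightarrow> [:a, b:] \<in> poly_ideal k"
  by (auto simp: poly_ideal_def coeff_pCons split: nat.splits)

lemma charpoly_entry:
  fixes A :: "'a::comm_ring_1 ^ 'n ^ 'n"
  shows "(mat [:0, 1:] - (\<chi> i j. [:A $ i $ j:])) $ l $ k = [:- A $ l $ k, if l = k then 1 else 0:]"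
  by (auto simp: mat_def)

lemma charpoly_cong:
  fixes A B :: "'k::field fls ^ 'n ^ 'n"
  assumes "int_mat UNIV A" "int_mat UNIV B" "\<And>i j. A $ i $ j - B $ i $ j \<in> fls_ideal k"
  shows "coeff (charpoly A) m - coeff (charpoly B) m \<in> fls_ideal k"
proof -
  have "charpoly A - charpoly B \<in> poly_ideal k"
    unfolding charpoly_def
  proof (rule det_cong_ideal[where S = "poly_ideal 0"]; (unfold charpoly_entry)?)
    show "[:- A $ i $ j, if i = j then 1 else 0:] - [:- B $ i $ j, if i = j then 1 else 0:] \<in> poly_ideal k" for i j
      using assms(3)[of i j] by (auto simp: fls_ideal_minus_commute intro!: poly_ideal_closed)
  qed (use assms in \<open>auto simp: int_mat_def fls_ideal_uminus intro: poly_ideal_mult poly_ideal_closed poly_ideal_linear\<close>)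
  then show ?thesis by (simp add: poly_ideal_def)
qed

lemma charpoly_integral:
  fixes A :: "'k::field fls ^ 'n ^ 'n"
  assumes "int_mat UNIV A"
  shows "coeff (charpoly A) m \<in> fls_ideal 0"
proof -
  have "charpoly A \<in> poly_ideal 0"
    unfolding charpoly_def
    by (rule det_mem_subring; (unfold charpoly_entry)?)
      (use assms in \<open>auto simp: int_mat_def fls_ideal_uminus intro: poly_ideal_mult poly_ideal_closed poly_ideal_linear\<close>)
  then show ?thesis by (simp add: poly_ideal_def)
qed

text \<open>From \<open>det (c x - c A) = c^n det (x - A)\<close>: in the coefficient of
  \<open>x^(n - k)\<close> the substitution accounts for \<open>c^(n - k)\<close>, and
  \<open>c^k\<close> remains.\<close>

lemma charpoly_scale:
  fixes A :: "'a::field ^ 'n::finite ^ 'n"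
  assumes c: "c \<noteq> 0" and k: "k \<le> CARD('n)"
  shows "coeff (charpoly (\<chi> i j. c * A $ i $ j)) (CARD('n) - k) = c ^ k * coeff (charpoly A) (CARD('n) - k)"
proof -
  let ?B = "\<chi> i j. c * A $ i $ j"
  let ?h = "\<lambda>p. pcompose p [:0, c:]"
  define Ch where "Ch = (\<lambda>A :: 'a ^ 'n ^ 'n. mat [:0, 1:] - (\<chi> i j. [:A $ i $ j:]))"
  have Ch: "Ch A $ l $ k = [:- A $ l $ k, if l = k then 1 else 0:]" for A l k
    unfolding Ch_def by (rule charpoly_entry)
  have "?h (charpoly ?B) = det (\<chi> i j. ?h (Ch ?B $ i $ j))"
    unfolding charpoly_def Ch_def by (rule det_hom) (auto simp: pcompose_1 pcompose_add pcompose_mult)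
  also have "(\<chi> i j. ?h (Ch ?B $ i $ j)) = (\<chi> i. [:c:] *s Ch A $ i)"
    by (auto simp: vec_eq_iff Ch pcompose_pCons)
  also have "det \<dots> = [:c:] ^ CARD('n) * charpoly A"
    by (subst det_rows_mul) (simp add: vec_lambda_eta charpoly_def Ch_def)
  also have "[:c:] ^ CARD('n) = [:c ^ CARD('n):]" by (rule poly_const_pow)
  finally have "coeff (?h (charpoly ?B)) (CARD('n) - k) = coeff ([:c ^ CARD('n):] * charpoly A) (CARD('n) - k)"
    by simp
  then have "c ^ (CARD('n) - k) * coeff (charpoly ?B) (CARD('n) - k)
      = c ^ (CARD('n) - k) * (c ^ k * coeff (charpoly A) (CARD('n) - k))"
    using k by (simp add: coeff_pcompose_linear mult.assoc[symmetric] flip: power_add)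
  then show ?thesis using c by simp
qed

text \<open>Polynomials in \<open>x\<close> become Laurent series in \<open>u = x^-1\<close>, an
  expansion at infinity. There \<open>x - A\<close> has the explicit inverse with coefficient
  \<open>A^i\<close> at \<open>u^(i + 1)\<close>.\<close>

definition eval_X_inv :: "'a::field poly \<Rightarrow> 'a fls" where
  "eval_X_inv p = poly (map_poly fls_const p) fls_X_inv"

lemma eval_X_inv_0 [simp]: "eval_X_inv 0 = 0"
  by (simp add: eval_X_inv_def)

lemma eval_X_inv_pCons: "eval_X_inv (pCons a p) = fls_const a + fls_X_inv * eval_X_inv p"
  by (simp add: eval_X_inv_def map_poly_pCons)

lemma eval_X_inv_nth: "eval_X_inv p $$ n = (if n \<le> 0 then coeff p (nat (- n)) else 0)"
proof (induction p arbitrary: n)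
  case (pCons a p)
  show ?case
    by (auto simp: eval_X_inv_pCons fls_X_inv_times_conv_shift pCons.IH coeff_pCons nat_diff_distrib
        split: nat.splits intro!: arg_cong[of _ _ "coeff p"])
qed simp

lemma eval_X_inv_add: "eval_X_inv (p + r) = eval_X_inv p + eval_X_inv r"
  by (simp add: fls_eq_iff eval_X_inv_nth)

lemma eval_X_inv_smult: "eval_X_inv (smult c p) = fls_const c * eval_X_inv p"
  by (simp add: fls_eq_iff eval_X_inv_nth)

lemma eval_X_inv_mult: "eval_X_inv (p * r) = eval_X_inv p * eval_X_inv r"
  by (induction p) (auto simp: eval_X_inv_pCons eval_X_inv_add eval_X_inv_smult algebra_simps)

definition inv_char_mat :: "'a::field ^ 'n ^ 'n \<Rightarrow> 'a fls ^ 'n ^ 'n" where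
  "inv_char_mat A = (\<chi> l k. (if l = k then fls_X_inv else 0) - fls_const (A $ l $ k))"

lemma eval_X_inv_charpoly: "eval_X_inv (charpoly A) = det (inv_char_mat A)"
proof -
  have "eval_X_inv (charpoly A) = det (\<chi> i j. eval_X_inv ((mat [:0, 1:] - (\<chi> i j. [:A $ i $ j:])) $ i $ j))"
    unfolding charpoly_def
    by (rule det_hom) (auto simp: eval_X_inv_add eval_X_inv_mult eval_X_inv_pCons one_pCons)
  also have "\<dots> = det (inv_char_mat A)"
    unfolding charpoly_entry inv_char_mat_def
    by (intro arg_cong[of _ _ det]) (auto simp: vec_eq_iff eval_X_inv_pCons)
  finally show ?thesis .
qed

text \<open>Multiplying every row by \<open>u\<close> turns \<open>u^-1 - A\<close> into
  \<open>1 - u A\<close>, whose determinant is a power series with constant term 1. Its coefficient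
  at \<open>u^(n - m)\<close> is that of the characteristic polynomial at
  \<open>x^m\<close>.\<close>

lemma charpoly_monic:
  fixes A :: "'a::field ^ 'n::finite ^ 'n"
  shows "coeff (charpoly A) (CARD('n)) = 1" "m > CARD('n) \<Longrightarrow> coeff (charpoly A) m = 0"
proof -
  define R :: "'a fps ^ 'n ^ 'n" where "R = (\<chi> l k. (if l = k then 1 else 0) - fps_X * fps_const (A $ l $ k))"
  have "fls_X ^ CARD('n) * eval_X_inv (charpoly A) = det (\<chi> i. fls_X *s inv_char_mat A $ i)"
    unfolding eval_X_inv_charpoly by (subst det_rows_mul) (simp add: vec_lambda_eta)
  also have "(\<chi> i. fls_X *s inv_char_mat A $ i) = (\<chi> i j. fps_to_fls (R $ i $ j))"
    by (auto simp: R_def inv_char_mat_def vec_eq_iff right_diff_distrib fls_times_fps_to_fls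
       fls_X_times_conv_shift)
  also have "det \<dots> = fps_to_fls (det R)"
    by (rule det_hom[symmetric]) (auto simp: fls_times_fps_to_fls)
  finally have eq: "fls_X ^ CARD('n) * eval_X_inv (charpoly A) = fps_to_fls (det R)" .
  have "fps_nth (det R) 0 = det (\<chi> i j. fps_nth (R $ i $ j) 0)"
    by (rule det_hom) auto
  also have "(\<chi> i j. fps_nth (R $ i $ j) 0) = mat 1"
    by (auto simp: R_def mat_def vec_eq_iff)
  finally have R0: "fps_nth (det R) 0 = 1" by simp
  have *: "coeff (charpoly A) m = fps_to_fls (det R) $$ (int CARD('n) - int m)" for m
    unfolding eq[symmetric] fls_X_power_times_conv_shift by (simp add: eval_X_inv_nth)
  show "coeff (charpoly A) (CARD('n)) = 1" "m > CARD('n) \<Longrightarrow> coeff (charpoly A) m = 0"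
    unfolding * by (auto simp: R0)
qed

text \<open>The outer variable is \<open>u\<close>, the inner one \<open>t\<close>; only the
  \<open>t\<close>-adic size of the coefficients is measured.\<close>

definition fls2_ideal :: "int \<Rightarrow> 'k::field fls fls set" where
  "fls2_ideal k = {g. \<forall>i. g $$ i \<in> fls_ideal k}"

lemma fls2_ideal_mult: "g \<in> fls2_ideal 0 \<Longrightarrow> h \<in> fls2_ideal k \<Longrightarrow> g * h \<in> fls2_ideal k"
  by (auto simp: fls2_ideal_def fls_times_nth(1) intro!: fls_ideal_sum fls_ideal_mult0)

lemma step_UNIV_nth: "step UNIV A v $ l = (\<Sum>k\<in>UNIV. A $ l $ k * v $ k)"
  by (simp add: step_def)

text \<open>With \<open>Q = (u\<^sup>-\<^sup>1 - A)\<^sup>-\<^sup>1\<close> as a matrix of series in \<open>u\<close>, the matrix determinant lemma turns the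
  change of the characteristic polynomial under a change \<open>d\<close> of row \<open>j\<close> into
  \<open>-(\<Sum>i. (d A\<^sup>i e\<^sub>j) u\<^bsup>i+1\<^esup>)\<close>, up to the integral factor \<open>det Q\<close>.\<close>

lemma charpoly_change_row:
  fixes A :: "'k::field fls ^ 'n::finite ^ 'n"
  assumes A: "int_mat UNIV A"
    and cong: "\<And>m. coeff (charpoly (\<chi> l k. if l = j then A $ j $ k + d $ k else A $ l $ k)) m
        - coeff (charpoly A) m \<in> fls_ideal M"
  shows "pairing UNIV d ((step UNIV A ^^ i) (axis j 1)) \<in> fls_ideal M"
proof -
  define A' where "A' = (\<chi> l k. if l = j then A $ j $ k + d $ k else A $ l $ k)"
  define a where "a = (\<lambda>i l k. (step UNIV A ^^ i) (axis k 1) $ l)"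
  have a_Suc: "a (Suc i) l k = (\<Sum>m\<in>UNIV. A $ l $ m * a i m k)" for i l k
    by (simp add: a_def step_UNIV_nth)
  have a_0: "a 0 l k = (if l = k then 1 else 0)" for l k by (simp add: a_def axis_def)
  \<comment> \<open>\<open>a i l k\<close> is the entry of \<open>A^i\<close> at
    \<open>(l, k)\<close>. The shift by one places \<open>A^i\<close> at \<open>u^(i + 1)\<close>,
    so that multiplying by \<open>u^-1 - A\<close> leaves only the identity at
    \<open>u^0\<close>.\<close>
  define Q where "Q = (\<chi> l k. fps_to_fls (Abs_fps (\<lambda>i. if i = 0 then 0 else a (i - 1) l k)))"
  have Q_nth: "Q $ l $ k $$ n = (if n \<le> 0 then 0 else a (nat n - 1) l k)" for l k n
    by (auto simp: Q_def)
  have PQ: "inv_char_mat A ** Q = mat 1"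
  proof -
    have "(inv_char_mat A ** Q) $ l $ k $$ n = (mat 1 :: 'k fls fls ^ 'n ^ 'n) $ l $ k $$ n" for l k n
    proof -
      have "(inv_char_mat A ** Q) $ l $ k = (\<Sum>m\<in>UNIV. (if l = m then fls_X_inv * Q $ m $ k else 0))
          - (\<Sum>m\<in>UNIV. fls_const (A $ l $ m) * Q $ m $ k)"
        by (simp add: matrix_matrix_mult_def inv_char_mat_def left_diff_distrib sum_subtractf if_distrib[of "\<lambda>x. x * _"] cong: if_cong)
      also have "\<dots> = fls_X_inv * Q $ l $ k - (\<Sum>m\<in>UNIV. fls_const (A $ l $ m) * Q $ m $ k)"
        by simp
      also have "\<dots> $$ n = Q $ l $ k $$ (n + 1) - (\<Sum>m\<in>UNIV. A $ l $ m * Q $ m $ k $$ n)"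
        by (simp add: fls_X_inv_times_conv_shift fls_nth_sum)
      also have "\<dots> = (mat 1 :: 'k fls fls ^ 'n ^ 'n) $ l $ k $$ n"
      proof -
        consider "n < 0" | "n = 0" | i where "n = int (Suc i)"
          by (metis linorder_neqE_linordered_idom zero_less_imp_eq_int gr0_conv_Suc of_nat_0_less_iff)
        then show ?thesis
        proof cases
          case 3
          then have "nat (n + 1) - 1 = Suc i" "nat n - 1 = i" by auto
          then show ?thesis using 3 by (simp add: Q_nth a_Suc mat_def)
        qed (auto simp: Q_nth a_0 mat_def)
      qed
      finally show ?thesis .
    qed
    then show ?thesis by (simp add: vec_eq_iff fls_eq_iff)
  qed
  define g where "g = (\<lambda>k. \<Sum>m\<in>UNIV. fls_const (d $ m) * Q $ m $ k)"
  define x where "x = (\<chi> k. (if k = j then 1 else 0) - g k)"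
  \<comment> \<open>Only row \<open>j\<close> of the characteristic matrix changes, so the product
    with \<open>Q\<close> is the identity with row \<open>j\<close> replaced by \<open>x\<close>. By
    Cramer's rule its determinant is \<open>x $ j = 1 - g j\<close>.\<close>
  have "inv_char_mat A' ** Q = (\<chi> l. if l = j then (\<Sum>i\<in>UNIV. x $ i *s row i (mat 1)) else row l (mat 1))"
  proof -
    have "(inv_char_mat A' ** Q) $ l $ k = (inv_char_mat A ** Q) $ l $ k - (if l = j then g k else 0)" for l k
      by (auto simp: matrix_matrix_mult_def inv_char_mat_def A'_def g_def algebra_simps
          sum_subtractf sum.distrib simp flip: fls_plus_const)
    moreover have "(\<Sum>i\<in>UNIV. x $ i *s row i (mat 1)) $ k = x $ k" for k
      by (simp add: row_def mat_def if_distrib[of "\<lambda>y. _ * y"] cong: if_cong)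
    ultimately show ?thesis
      unfolding PQ by (auto simp: vec_eq_iff x_def row_def mat_def)
  qed
  then have "det (inv_char_mat A') * det Q = 1 - g j"
    using cramer_lemma_transpose[of j x "mat 1"] by (simp flip: det_mul) (simp add: x_def)
  moreover have "det (inv_char_mat A) * det Q = 1" by (simp add: PQ flip: det_mul)
  ultimately have eq: "g j = det Q * (det (inv_char_mat A) - det (inv_char_mat A'))"
    by (simp add: algebra_simps)
  have "int_vec UNIV (axis k 1 :: 'k fls ^ 'n)" for k by (auto simp: int_vec_def axis_def)
  then have "a i l k \<in> fls_ideal 0" for i l k
    unfolding a_def using int_vec_funpow_step[OF A] by (auto simp: int_vec_def)
  then have "det Q \<in> fls2_ideal 0"
    by (intro det_mem_subring)
      (auto simp: fls2_ideal_mult, auto simp: fls2_ideal_def Q_nth fls_ideal_uminus intro: fls_ideal_add)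
  moreover have "det (inv_char_mat A) - det (inv_char_mat A') \<in> fls2_ideal M"
    using cong unfolding eval_X_inv_charpoly[symmetric] A'_def[symmetric]
    by (auto simp: fls2_ideal_def eval_X_inv_nth fls_ideal_minus_commute)
  ultimately have "g j \<in> fls2_ideal M" unfolding eq by (rule fls2_ideal_mult)
  then have "g j $$ int (Suc i) \<in> fls_ideal M" by (simp add: fls2_ideal_def)
  also have "g j $$ int (Suc i) = pairing UNIV d ((step UNIV A ^^ i) (axis j 1))"
    by (simp add: g_def fls_nth_sum Q_nth pairing_def a_def nat_add_distrib)
  finally show ?thesis .
qed

section \<open>Counting modulo a power of the uniformiser\<close>

text \<open>\<open>chevalley\<close> records only the coefficients below degree \<open>n\<close>;
  the others are 1 or 0 for both matrices.\<close>

lemma charpoly_cong_of_chevalley: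
  fixes A B :: "'k::field fls ^ 'n::finite ^ 'n"
  assumes e: "bij_betw e UNIV {1..CARD('n)}"
    and eq: "vec_trunc M (chevalley e A) = vec_trunc M (chevalley e B)"
  shows "coeff (charpoly A) m - coeff (charpoly B) m \<in> fls_ideal (int M)"
proof (cases "m < CARD('n)")
  case True
  then have "CARD('n) - m \<in> e ` UNIV" using e by (simp add: bij_betw_def)
  then obtain i where "e i = CARD('n) - m" by auto
  then have "CARD('n) - e i = m" using True by simp
  then show ?thesis
    using eq by (auto simp: vec_trunc_def chevalley_def vec_eq_iff fls_trunc_eq_iff dest!: spec[of _ i])
next
  case False
  then show ?thesis
    using charpoly_monic[where A = A] charpoly_monic[where A = B] by (cases "m = CARD('n)") auto
qed

text \<open>Differences with one fixed row \<open>r0\<close> of the fibre kill the orbit of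
  \<open>e_j\<close> under \<open>A0\<close>. As \<open>e_j\<close> is primitive, one reduction
  removes \<open>j\<close>; the block and column that remain are those of \<open>A\<close> itself,
  so the bound is the same for every fibre.\<close>

lemma card_chevalley_fibre:
  fixes A :: "'k::{field,finite} fls ^ 'n::finite ^ 'n"
  assumes e: "bij_betw e UNIV {1..CARD('n)}" and A: "A \<in> mat_reps M"
  shows "card {r \<in> vec_reps M. vec_trunc M (chevalley e (set_row j r A)) = v}
    \<le> card (cyc_ann M (UNIV - {j}) A (column j A))"
proof (cases "{r \<in> vec_reps M. vec_trunc M (chevalley e (set_row j r A)) = v} = {}")
  case False
  let ?S = "{r \<in> vec_reps M. vec_trunc M (chevalley e (set_row j r A)) = v}"
  let ?z = "axis j 1 :: 'k fls ^ 'n"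
  obtain r0 where r0: "r0 \<in> vec_reps M" "vec_trunc M (chevalley e (set_row j r0 A)) = v"
    using False by auto
  define A0 where "A0 = set_row j r0 A"
  have A0: "int_mat UNIV A0"
    using A r0 by (intro int_mat_reps[of _ M]) (auto simp: A0_def set_row_def mat_reps_alt)
  have z: "int_vec UNIV ?z" by (auto simp: int_vec_def axis_def)
  have "(\<lambda>r. r - r0) ` ?S \<subseteq> cyc_ann M UNIV A0 ?z"
  proof safe
    fix r assume r: "r \<in> vec_reps M" "v = vec_trunc M (chevalley e (set_row j r A))"
    have row: "set_row j r A = (\<chi> l k. if l = j then A0 $ j $ k + (r - r0) $ k else A0 $ l $ k)"
      by (simp add: A0_def set_row_def vec_eq_iff)
    have "pairing UNIV (r - r0) ((step UNIV A0 ^^ i) ?z) \<in> fls_ideal (int M)" for i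
    proof (rule charpoly_change_row[OF A0])
      show "coeff (charpoly (\<chi> l k. if l = j then A0 $ j $ k + (r - r0) $ k else A0 $ l $ k)) m -
         coeff (charpoly A0) m \<in> fls_ideal (int M)" for m
        unfolding row[symmetric] unfolding A0_def
        by (rule charpoly_cong_of_chevalley[OF e]) (use r r0 in simp)
    qed
    moreover have "r - r0 \<in> vec_reps M" using r r0 by (auto simp: vec_reps_def fls_seg_def)
    ultimately show "r - r0 \<in> cyc_ann M UNIV A0 ?z" by (simp add: cyc_ann_def)
  qed
  then have "card ?S \<le> card (cyc_ann M UNIV A0 ?z)"
    by (intro card_inj_on_le[of "\<lambda>r. r - r0"]) (auto simp: inj_on_def)
  also have "\<dots> \<le> card (cyc_ann M (UNIV - {j}) (red_mat UNIV j ?z A0) (column j (red_mat UNIV j ?z A0)))"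
    by (rule card_cyc_ann_reduce[OF _ _ A0 z]) auto
  also have "cyc_ann M (UNIV - {j}) (red_mat UNIV j ?z A0) (column j (red_mat UNIV j ?z A0))
      = cyc_ann M (UNIV - {j}) A (column j A)"
  proof (rule cyc_ann_cong)
    show "int_mat (UNIV - {j}) (red_mat UNIV j ?z A0)" "int_mat (UNIV - {j}) A"
      using int_mat_red_mat[OF A0 z] int_mat_reps[OF A] int_mat_subset by blast+
    then show "int_vec (UNIV - {j}) (column j (red_mat UNIV j ?z A0))"
      using int_mat_red_mat[OF A0 z] by (auto simp: int_mat_def int_vec_def column_def)
  qed (auto simp: red_mat_def A0_def set_row_def column_def axis_def if_distrib[of "\<lambda>x. _ * x"] cong: if_cong)
  finally show ?thesis .
qed (simp only: card.empty le0)

lemma card_chevalley_row: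
  fixes A :: "'k::{field,finite} fls ^ 'n::finite ^ 'n"
  assumes e: "bij_betw e UNIV {1..CARD('n)}" and A: "A \<in> mat_reps M" and V: "finite V"
  shows "card {r \<in> vec_reps M. vec_trunc M (chevalley e (set_row j r A)) \<in> V}
    \<le> card V * card (cyc_ann M (UNIV - {j}) A (column j A))"
proof -
  have "{r \<in> vec_reps M. vec_trunc M (chevalley e (set_row j r A)) \<in> V} =
     (\<Union>v\<in>V. {r \<in> vec_reps M. vec_trunc M (chevalley e (set_row j r A)) = v})" by auto
  also have "card \<dots> \<le> (\<Sum>v\<in>V. card {r \<in> vec_reps M. vec_trunc M (chevalley e (set_row j r A)) = v})"
    by (rule card_UN_le[OF V])
  also have "\<dots> \<le> (\<Sum>v\<in>V. card (cyc_ann M (UNIV - {j}) A (column j A)))"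
    by (rule sum_mono) (rule card_chevalley_fibre[OF e A])
  finally show ?thesis by simp
qed

text \<open>The exponent is \<open>CARD('n) - 1\<close> because the reduction at \<open>e_j\<close>
  has trivial content and costs no series. The constant is independent of \<open>M\<close>.\<close>

lemma card_chevalley_le:
  fixes s :: real and V :: "('k::{field,finite} fls ^ 'n::finite) set"
  assumes e: "bij_betw e UNIV {1..CARD('n)}" and s: "0 \<le> s" "s < 1" and V: "finite V"
  shows "real (card {A \<in> mat_reps M. vec_trunc M (chevalley e A) \<in> V}) \<le>
     (1 / (1 - real CARD('k) powr (s - 1))) ^ (CARD('n) - 1) * real (card (mat_reps M :: ('k fls ^ 'n ^ 'n) set))
       * (real (card V) / real (card (vec_reps M :: ('k fls ^ 'n) set))) powr s"
proof -
  \<comment> \<open>Any index may play the part of the distinguished row.\<close>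
  obtain j :: 'n where True by blast
  define R where "R = real (card (vec_reps M :: ('k fls ^ 'n) set))"
  define D where "D = real (card (mat_reps M :: ('k fls ^ 'n ^ 'n) set))"
  define K where "K = (1 / (1 - real CARD('k) powr (s - 1))) ^ (CARD('n) - 1)"
  define F where "F = (\<lambda>A :: 'k fls ^ 'n ^ 'n. if vec_trunc M (chevalley e A) \<in> V then 1 else 0 :: real)"
  define N where "N = (\<lambda>A :: 'k fls ^ 'n ^ 'n. real (card (cyc_ann M (UNIV - {j}) A (column j A))))"
  have R0: "R > 0" by (simp add: R_def card_vec_reps)
  have row: "(\<Sum>r\<in>vec_reps M. F (set_row j r A)) \<le> R powr (1 - s) * real (card V) powr s * N A powr s"
    if A: "A \<in> mat_reps M" for A
  proof -
    define x where "x = (\<Sum>r\<in>vec_reps M. F (set_row j r A))"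
    have x: "x = real (card {r \<in> vec_reps M. vec_trunc M (chevalley e (set_row j r A)) \<in> V})"
      by (simp add: x_def F_def sum.If_cases Int_def)
    have x1: "x \<le> real (card V) * N A"
      unfolding x N_def of_nat_mult[symmetric] of_nat_le_iff by (rule card_chevalley_row[OF e A V])
    have x2: "x \<le> R" unfolding x R_def of_nat_le_iff by (rule card_mono) auto
    have x0: "x \<ge> 0" by (simp add: x)
    have "x = x powr (1 - s) * x powr s"
      using x0 by (cases "x = 0") (simp_all flip: powr_add)
    also have "\<dots> \<le> R powr (1 - s) * (real (card V) * N A) powr s"
      using x0 x1 x2 s by (intro mult_mono powr_mono2) auto
    also have "\<dots> = R powr (1 - s) * real (card V) powr s * N A powr s"
      by (simp add: powr_mult N_def)
    finally show ?thesis by (simp add: x_def)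
  qed
  have "R * (\<Sum>A\<in>mat_reps M. F A) = (\<Sum>A\<in>mat_reps M. \<Sum>r\<in>vec_reps M. F (set_row j r A))"
    unfolding R_def sum_set_row[symmetric, where j = j] by (simp add: sum.cartesian_product)
  also have "\<dots> \<le> (\<Sum>A\<in>mat_reps M. R powr (1 - s) * real (card V) powr s * N A powr s)"
    by (rule sum_mono) (rule row)
  also have "\<dots> = R powr (1 - s) * real (card V) powr s * (\<Sum>A\<in>mat_reps M. N A powr s)"
    by (simp add: sum_distrib_left)
  also have "\<dots> \<le> R powr (1 - s) * real (card V) powr s * (K * D)"
  proof (rule mult_left_mono)
    have "R * (\<Sum>A\<in>mat_reps M. N A powr s) = cyc_sum TYPE('k) M s (UNIV - {j})"
      unfolding R_def N_def by (rule sum_cyc_ann_column) simp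
    also have "\<dots> \<le> K * real (CARD('k) ^ (M * CARD('n) * CARD('n) + M * CARD('n)))"
      using cyc_sum_le[OF s, where 'k='k and M = M and J = "UNIV - {j}"]
      by (simp add: K_def card_Diff_singleton)
    also have "\<dots> = R * (K * D)"
      by (simp add: R_def D_def card_vec_reps card_mat_reps power_add)
    finally show "(\<Sum>A\<in>mat_reps M. N A powr s) \<le> K * D" using R0 by simp
  qed simp
  also have "\<dots> = R * (K * D * (real (card V) / R) powr s)"
    using R0 by (simp add: powr_diff powr_divide)
  finally have "(\<Sum>A\<in>mat_reps M. F A) \<le> K * D * (real (card V) / R) powr s" using R0 by simp
  moreover have "(\<Sum>A\<in>mat_reps M. F A) = real (card {A \<in> mat_reps M. vec_trunc M (chevalley e A) \<in> V})"
    by (simp add: F_def sum.If_cases Int_def)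
  ultimately show ?thesis by (simp add: K_def D_def R_def)
qed

section \<open>Haar measures on spaces with a lattice filtration\<close>

text \<open>A common frame for \<open>F^n\<close> with arbitrary weights and for matrices: a
  descending chain of open subgroups that is a neighbourhood base of 0, exhausts the group and has
  finite successive indices. Haar measure then reduces to counting cosets.\<close>

locale lattice_filtration =
  fixes L :: "int \<Rightarrow> 'a::{topological_space, ab_group_add} set"
  assumes zero: "0 \<in> L k"
    and diff: "x \<in> L k \<Longrightarrow> y \<in> L k \<Longrightarrow> x - y \<in> L k"
    and antimono: "j \<le> k \<Longrightarrow> L k \<subseteq> L j"
    and exhaust: "\<exists>k. x \<in> L k"
    and open_iff: "open U \<longleftrightarrow> (\<forall>x\<in>U. \<exists>k. \<forall>y. y - x \<in> L k \<longrightarrow> y \<in> U)"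
    and finite_index: "\<exists>X. finite X \<and> (\<forall>x\<in>L j. \<exists>a\<in>X. x - a \<in> L k)"
begin

lemma add: "x \<in> L k \<Longrightarrow> y \<in> L k \<Longrightarrow> x + y \<in> L k"
  using diff[of x k "0 - y"] diff[OF zero, of y k] by simp

definition coset :: "'a \<Rightarrow> int \<Rightarrow> 'a set" where
  "coset x k = {y. y - x \<in> L k}"

lemma coset_self: "x \<in> coset x k"
  by (simp add: coset_def zero)

lemma coset_0: "coset 0 k = L k"
  by (simp add: coset_def)

lemma coset_eq_image: "coset x k = (\<lambda>y. x + y) ` L k"
proof (intro set_eqI iffI)
  fix y assume "y \<in> coset x k"
  then show "y \<in> (\<lambda>y. x + y) ` L k"
    by (intro image_eqI[of _ _ "y - x"]) (auto simp: coset_def)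
qed (auto simp: coset_def)

lemma open_coset: "open (coset x k)"
  unfolding open_iff coset_def
proof safe
  fix y assume y: "y - x \<in> L k"
  have "z - x \<in> L k" if "z - y \<in> L k" for z using add[OF that y] by simp
  then show "\<exists>j. \<forall>z. z - y \<in> L j \<longrightarrow> z \<in> {y. y - x \<in> L k}" by blast
qed

lemma open_L: "open (L k)"
  using open_coset[of 0 k] by (simp add: coset_0)

lemma compact_cover:
  assumes "compact K"
  obtains X where "finite X" "K \<subseteq> (\<Union>x\<in>X. coset x k)"
proof (rule compactE_image[OF assms, of UNIV "\<lambda>x. coset x k"])
  show "K \<subseteq> (\<Union>x\<in>UNIV. coset x k)" using coset_self by blast
qed (auto simp: open_coset intro: that)

lemma compact_subset_L:
  assumes "compact K"
  obtains k where "K \<subseteq> L k"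
proof -
  obtain X where X: "finite X" "K \<subseteq> (\<Union>x\<in>X. coset x 0)" using compact_cover[OF assms] .
  obtain f where f: "\<And>x. x \<in> L (f x)" using exhaust by metis
  \<comment> \<open>0 is included because the differences \<open>y - x\<close> lie in
    \<open>L 0\<close>.\<close>
  define k where "k = Min (insert 0 (f ` X))"
  have "K \<subseteq> L k"
  proof
    fix y assume "y \<in> K"
    then obtain x where x: "x \<in> X" "y - x \<in> L 0" using X by (auto simp: coset_def)
    have "k \<le> f x" "k \<le> 0" using X x by (auto simp: k_def)
    then have "x \<in> L k" "y - x \<in> L k" using f[of x] x antimono by blast+
    from add[OF this] show "y \<in> L k" by simp
  qed
  then show ?thesis by (rule that)
qed

context
  fixes M :: "'a measure"
  assumes haar: "haar_measure M"
begin

lemmas haar_unfolded = haar[unfolded haar_measure_def]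

lemma sets_M: "sets M = sets borel"
  by (rule haar_unfolded[THEN conjunct1])

lemma emeasure_UNIV: "emeasure M UNIV \<noteq> 0"
  by (rule haar_unfolded[THEN conjunct2, THEN conjunct1])

lemma compact_finite: "compact K \<Longrightarrow> emeasure M K < \<infinity>"
  by (rule haar_unfolded[THEN conjunct2, THEN conjunct2, THEN conjunct1, rule_format])

lemma translation: "A \<in> sets borel \<Longrightarrow> emeasure M ((\<lambda>y. x + y) ` A) = emeasure M A"
  by (rule haar_unfolded[THEN conjunct2, THEN conjunct2, THEN conjunct2, THEN conjunct1, rule_format])

lemma outer: "A \<in> sets borel \<Longrightarrow> emeasure M A = (INF U\<in>{U. open U \<and> A \<subseteq> U}. emeasure M U)"
  by (rule haar_unfolded[THEN conjunct2, THEN conjunct2, THEN conjunct2, THEN conjunct2, THEN conjunct1, rule_format])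

lemma inner: "open U \<Longrightarrow> emeasure M U = (SUP K\<in>{K. compact K \<and> K \<subseteq> U}. emeasure M K)"
  by (rule haar_unfolded[THEN conjunct2, THEN conjunct2, THEN conjunct2, THEN conjunct2, THEN conjunct2, rule_format])

lemma space_M: "space M = UNIV"
  using sets_eq_imp_space_eq[OF sets_M] by simp

lemma coset_sets [measurable]: "coset x k \<in> sets M"
  by (simp add: sets_M open_coset)

lemma emeasure_coset: "emeasure M (coset x k) = emeasure M (L k)"
  unfolding coset_eq_image by (rule translation) (simp add: open_L)

lemma emeasure_cosets:
  assumes "finite X" and disj: "\<And>x y. x \<in> X \<Longrightarrow> y \<in> X \<Longrightarrow> x - y \<in> L k \<Longrightarrow> x = y"
  shows "emeasure M (\<Union>x\<in>X. coset x k) = of_nat (card X) * emeasure M (L k)"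
proof -
  have "disjoint_family_on (\<lambda>x. coset x k) X"
    unfolding disjoint_family_on_def
  proof (intro ballI impI equals0I)
    fix x y z assume "x \<in> X" "y \<in> X" "x \<noteq> y" and z: "z \<in> coset x k \<inter> coset y k"
    then have "z - y \<in> L k" "z - x \<in> L k" by (auto simp: coset_def)
    from diff[OF this] have "x - y \<in> L k" by simp
    then show False using disj[of x y] \<open>x \<in> X\<close> \<open>y \<in> X\<close> \<open>x \<noteq> y\<close> by simp
  qed
  then have "emeasure M (\<Union>x\<in>X. coset x k) = (\<Sum>x\<in>X. emeasure M (coset x k))"
    using assms by (intro sum_emeasure[symmetric]) auto
  then show ?thesis by (simp add: emeasure_coset)
qed

lemma emeasure_cover_le:
  assumes "finite X" "K \<subseteq> (\<Union>x\<in>X. coset x k)"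
  shows "emeasure M K \<le> of_nat (card X) * emeasure M (L k)"
proof -
  have "emeasure M K \<le> emeasure M (\<Union>x\<in>X. coset x k)"
    using assms by (intro emeasure_mono) auto
  also have "\<dots> \<le> (\<Sum>x\<in>X. emeasure M (coset x k))"
    using assms by (intro emeasure_subadditive_finite) auto
  finally show ?thesis by (simp add: emeasure_coset)
qed

text \<open>A compact set is covered by finitely many translates of \<open>L k\<close>. If
  \<open>L k\<close> were null, inner regularity would make the whole space null.\<close>

lemma emeasure_L_pos: "emeasure M (L k) > 0"
proof (rule ccontr)
  assume "\<not> emeasure M (L k) > 0"
  then have 0: "emeasure M (L k) = 0" by (simp add: zero_less_iff_neq_zero)
  have "emeasure M K = 0" if K: "compact K" for K
  proof -
    obtain X where "finite X" "K \<subseteq> (\<Union>x\<in>X. coset x k)" using compact_cover[OF K] .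
    from emeasure_cover_le[OF this] show ?thesis by (simp add: 0)
  qed
  then have "(SUP K\<in>{K. compact K \<and> K \<subseteq> UNIV}. emeasure M K) \<le> 0"
    by (intro SUP_least) auto
  then show False using inner[of UNIV] emeasure_UNIV by simp
qed

text \<open>Outer regularity puts a compact set of nonzero measure into an open set of finite
  measure, which contains a coset of some \<open>L j\<close>. Finite index carries finiteness from
  \<open>L j\<close> to every \<open>L k\<close>.\<close>

lemma emeasure_L_finite: "emeasure M (L k) < \<infinity>"
proof -
  obtain K where K: "compact K" "emeasure M K \<noteq> 0"
  proof -
    have "\<exists>K. compact K \<and> emeasure M K \<noteq> 0"
    proof (rule ccontr)
      assume "\<not> ?thesis"
      then have "(SUP K\<in>{K. compact K \<and> K \<subseteq> UNIV}. emeasure M K) \<le> 0"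
        by (intro SUP_least) auto
      then show False using inner[of UNIV] emeasure_UNIV by simp
    qed
    then show ?thesis using that by blast
  qed
  \<comment> \<open>Without a separation axiom a compact set need not be Borel; here nonzero measure
    implies measurability, since \<open>emeasure\<close> is 0 off \<open>sets M\<close>.\<close>
  have "K \<in> sets M" using emeasure_notin_sets K by metis
  then have "(INF U\<in>{U. open U \<and> K \<subseteq> U}. emeasure M U) < \<infinity>"
    using outer[of K] compact_finite[OF K(1)] by (simp add: sets_M)
  then obtain U where U: "open U" "K \<subseteq> U" "emeasure M U < \<infinity>" by (auto simp: INF_less_iff)
  obtain x where "x \<in> K" using K by (metis emeasure_empty equals0I)
  then obtain j where "coset x j \<subseteq> U" using U open_iff[of U] by (fastforce simp: coset_def)
  then have "emeasure M (L j) \<le> emeasure M U"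
    using U by (subst emeasure_coset[symmetric, where x = x]) (auto intro!: emeasure_mono simp: sets_M)
  then have fin: "emeasure M (L j) < \<infinity>" using U by (metis order_le_less_trans)
  obtain X where X: "finite X" "\<forall>x\<in>L k. \<exists>a\<in>X. x - a \<in> L j" using finite_index by metis
  have "emeasure M (L k) \<le> of_nat (card X) * emeasure M (L j)"
    by (rule emeasure_cover_le[OF X(1)]) (use X in \<open>auto simp: coset_def\<close>)
  also have "\<dots> < \<infinity>" using fin by (simp add: ennreal_mult_less_top of_nat_less_top)
  finally show ?thesis .
qed

lemma L_sets [measurable]: "L k \<in> sets M"
  by (simp add: sets_M open_L)

lemma sigma_finite_haar: "sigma_finite_measure M"
proof
  show "\<exists>A. countable A \<and> A \<subseteq> sets M \<and> \<Union>A = space M \<and> (\<forall>a\<in>A. emeasure M a \<noteq> \<infinity>)"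
    using exhaust emeasure_L_finite by (intro exI[of _ "range L"]) (auto simp: space_M less_top)
qed

lemma emeasure_L_eq_measure: "emeasure M (L k) = ennreal (measure M (L k))"
  using emeasure_L_finite by (intro emeasure_eq_ennreal_measure) (simp add: less_top)

lemma measure_L_pos: "measure M (L k) > 0"
  using emeasure_L_pos[of k] emeasure_L_eq_measure[of k] by simp

end

end

text \<open>The weights admit a different scale in each coordinate, as the coefficients of a scaled
  characteristic polynomial demand. Applied twice with weight 0 it gives matrices.\<close>

lemma lattice_filtration_vec:
  fixes L :: "int \<Rightarrow> 'a::{topological_space, ab_group_add} set" and w :: "'n::finite \<Rightarrow> int"
  assumes "lattice_filtration L"
  shows "lattice_filtration (\<lambda>k. {v :: 'a ^ 'n. \<forall>i. v $ i \<in> L (k - w i)})"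
proof -
  interpret lattice_filtration L by fact
  show ?thesis
  proof
    fix j k :: int assume "j \<le> k"
    then show "{v :: 'a ^ 'n. \<forall>i. v $ i \<in> L (k - w i)} \<subseteq> {v. \<forall>i. v $ i \<in> L (j - w i)}"
    proof -
      have "L (k - w i) \<subseteq> L (j - w i)" for i using \<open>j \<le> k\<close> by (intro antimono) simp
      then show ?thesis by blast
    qed
  next
    fix v :: "'a ^ 'n"
    have "\<exists>f. \<forall>i. v $ i \<in> L (f i)" by (intro choice allI exhaust)
    then obtain f where f: "\<And>i. v $ i \<in> L (f i)" by blast
    define k where "k = Min (range (\<lambda>i. f i + w i))"
    have "k \<le> f i + w i" for i by (simp add: k_def)
    then have "v $ i \<in> L (k - w i)" for i
      using f[of i] antimono[of "k - w i" "f i"] by (auto simp: algebra_simps)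
    then show "\<exists>k. v \<in> {v. \<forall>i. v $ i \<in> L (k - w i)}" by blast
  next
    fix U :: "('a ^ 'n) set"
    show "open U \<longleftrightarrow> (\<forall>v\<in>U. \<exists>k. \<forall>y. y - v \<in> {v. \<forall>i. v $ i \<in> L (k - w i)} \<longrightarrow> y \<in> U)"
    proof safe
      fix v assume "open U" "v \<in> U"
      then obtain A where A: "\<And>i. open (A i) \<and> v $ i \<in> A i" "\<And>y. (\<And>i. y $ i \<in> A i) \<Longrightarrow> y \<in> U"
        unfolding open_vec_def by metis
      have "\<exists>k. \<forall>y. y - v $ i \<in> L k \<longrightarrow> y \<in> A i" for i using A(1)[of i] open_iff by blast
      then obtain f where f: "\<And>i y. y - v $ i \<in> L (f i) \<Longrightarrow> y \<in> A i" by metis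
      define k where "k = Max (range (\<lambda>i. f i + w i))"
      have "f i + w i \<le> k" for i by (simp add: k_def)
      then have "L (k - w i) \<subseteq> L (f i)" for i by (intro antimono) (simp add: algebra_simps)
      then have "\<forall>y. y - v \<in> {v. \<forall>i. v $ i \<in> L (k - w i)} \<longrightarrow> y \<in> U"
      proof (intro allI impI A(2))
        fix y i assume "y - v \<in> {v. \<forall>i. v $ i \<in> L (k - w i)}"
        then have "y $ i - v $ i \<in> L (k - w i)" by simp
        then show "y $ i \<in> A i" using f \<open>L (k - w i) \<subseteq> L (f i)\<close> by blast
      qed
      then show "\<exists>k. \<forall>y. y - v \<in> {v. \<forall>i. v $ i \<in> L (k - w i)} \<longrightarrow> y \<in> U" by blast
    next
      assume *: "\<forall>v\<in>U. \<exists>k. \<forall>y. y - v \<in> {v. \<forall>i. v $ i \<in> L (k - w i)} \<longrightarrow> y \<in> U"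
      show "open U"
        unfolding open_vec_def
      proof
        fix v assume "v \<in> U"
        then obtain k where "\<forall>y. y - v \<in> {v. \<forall>i. v $ i \<in> L (k - w i)} \<longrightarrow> y \<in> U"
          using * by blast
        then have k: "\<And>y. (\<And>i. y $ i - v $ i \<in> L (k - w i)) \<Longrightarrow> y \<in> U" by simp
        show "\<exists>A. (\<forall>i. open (A i) \<and> v $ i \<in> A i) \<and> (\<forall>y. (\<forall>i. y $ i \<in> A i) \<longrightarrow> y \<in> U)"
          by (intro exI[of _ "\<lambda>i. coset (v $ i) (k - w i)"])
            (auto simp: open_coset coset_self, auto simp: coset_def intro: k)
      qed
    qed
  next
    fix j k :: int
    have "\<exists>X. \<forall>i. finite (X i) \<and> (\<forall>x\<in>L (j - w i). \<exists>a\<in>X i. x - a \<in> L (k - w i))"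
      by (intro choice allI finite_index)
    then obtain X where X: "\<And>i. finite (X i)" "\<And>i x. x \<in> L (j - w i) \<Longrightarrow> \<exists>a\<in>X i. x - a \<in> L (k - w i)"
      by blast
    show "\<exists>X. finite X \<and> (\<forall>v\<in>{v :: 'a ^ 'n. \<forall>i. v $ i \<in> L (j - w i)}. \<exists>a\<in>X. v - a \<in> {v. \<forall>i. v $ i \<in> L (k - w i)})"
    proof (intro exI[of _ "{v. \<forall>i. v $ i \<in> X i}"] conjI ballI)
      fix v :: "'a ^ 'n" assume "v \<in> {v. \<forall>i. v $ i \<in> L (j - w i)}"
      then have "\<forall>i. \<exists>a\<in>X i. v $ i - a \<in> L (k - w i)" using X by blast
      then obtain f where "\<And>i. f i \<in> X i \<and> v $ i - f i \<in> L (k - w i)" by metis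
      then show "\<exists>a\<in>{v. \<forall>i. v $ i \<in> X i}. v - a \<in> {v. \<forall>i. v $ i \<in> L (k - w i)}"
        by (intro bexI[of _ "\<chi> i. f i"]) auto
    qed (auto intro: finite_vec_box X)
  qed (auto simp: zero diff)
qed

section \<open>The filtrations of Laurent series, vectors and matrices\<close>

lemma dist_fls_powr:
  "dist a b = (if a = b then 0 else 2 powr (- real_of_int (fls_subdegree (a - b))))"
  for a b :: "'a::group_add fls"
proof -
  have "inverse (2 ^ nat m) = (2::real) powr (- real_of_int m)" if "m \<ge> 0" for m :: int
    using that by (simp add: powr_minus flip: powr_realpow)
  moreover have "2 ^ nat (- m) = (2::real) powr (- real_of_int m)" if "\<not> m \<ge> 0" for m :: int
    using that by (simp flip: powr_realpow)
  ultimately show ?thesis by (simp add: dist_fls_def)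
qed

lemma lattice_filtration_fls: "lattice_filtration (fls_ideal :: int \<Rightarrow> 'k::{field,finite} fls set)"
proof
  fix U :: "'k fls set"
  show "open U \<longleftrightarrow> (\<forall>x\<in>U. \<exists>k. \<forall>y. y - x \<in> fls_ideal k \<longrightarrow> y \<in> U)"
    unfolding open_dist
  proof (intro ball_cong refl iffI)
    fix x assume "\<exists>e>0. \<forall>y. dist y x < e \<longrightarrow> y \<in> U"
    then obtain e where e: "e > 0" "\<And>y. dist y x < e \<Longrightarrow> y \<in> U" by blast
    obtain n where n: "(1/2 :: real) ^ n < e" using real_arch_pow_inv[OF e(1), of "1/2"] by auto
    have "dist y x < e" if y: "y - x \<in> fls_ideal (int n)" for y
    proof (cases "y = x")
      case False
      then have "int n \<le> fls_subdegree (y - x)" using y by (simp add: fls_ideal_iff)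
      then have "dist y x \<le> 2 powr (- real n)" using False by (simp add: dist_fls_powr)
      also have "\<dots> = (1/2) ^ n" by (simp add: powr_minus powr_realpow power_divide inverse_eq_divide)
      finally show ?thesis using n by simp
    qed (use e in simp)
    then show "\<exists>k. \<forall>y. y - x \<in> fls_ideal k \<longrightarrow> y \<in> U" using e by blast
  next
    fix x assume "\<exists>k. \<forall>y. y - x \<in> fls_ideal k \<longrightarrow> y \<in> U"
    then obtain k where k: "\<And>y. y - x \<in> fls_ideal k \<Longrightarrow> y \<in> U" by blast
    \<comment> \<open>Nonzero distances are integral powers of 2, so being below
      \<open>2 powr (1 - k)\<close> already forces order at least \<open>k\<close>.\<close>
    have "y \<in> U" if y: "dist y x < 2 powr (1 - real_of_int k)" for y
      using y by (intro k) (auto simp: dist_fls_powr fls_ideal_iff split: if_splits)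
    then show "\<exists>e>0. \<forall>y. dist y x < e \<longrightarrow> y \<in> U"
      by (intro exI[of _ "2 powr (1 - real_of_int k)"]) auto
  qed
next
  fix j k :: int
  show "\<exists>X. finite X \<and> (\<forall>x\<in>(fls_ideal j :: 'k fls set). \<exists>a\<in>X. x - a \<in> fls_ideal k)"
    by (rule exI[of _ "fls_seg j k :: 'k fls set"]) (auto intro: fls_trunc_diff fls_trunc_seg)
next
  fix x :: "'k fls"
  show "\<exists>k. x \<in> fls_ideal k" using fls_ideal_exhaust[of x] by blast
qed (auto simp: fls_ideal_diff intro: fls_ideal_antimono)

definition vec_lattice :: "('n \<Rightarrow> int) \<Rightarrow> int \<Rightarrow> ('k::zero fls ^ 'n) set" where
  "vec_lattice w k = {v. \<forall>i. v $ i \<in> fls_ideal (k - w i)}"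

definition mat_lattice :: "int \<Rightarrow> ('k::zero fls ^ 'n ^ 'n) set" where
  "mat_lattice k = {A. \<forall>i j. A $ i $ j \<in> fls_ideal k}"

interpretation vec_lat: lattice_filtration "vec_lattice w :: int \<Rightarrow> ('k::{field,finite} fls ^ 'n::finite) set"
  for w :: "'n::finite \<Rightarrow> int"
  unfolding vec_lattice_def by (rule lattice_filtration_vec[OF lattice_filtration_fls])

interpretation mat_lat: lattice_filtration "mat_lattice :: int \<Rightarrow> ('k::{field,finite} fls ^ 'n::finite ^ 'n) set"
proof -
  have "lattice_filtration (\<lambda>k. {A :: 'k fls ^ 'n ^ 'n. \<forall>i. A $ i \<in> {v. \<forall>j. v $ j \<in> fls_ideal (k - 0 - 0)}})"
    by (intro lattice_filtration_vec lattice_filtration_fls)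
  then show "lattice_filtration (mat_lattice :: int \<Rightarrow> ('k fls ^ 'n ^ 'n) set)"
    by (simp add: mat_lattice_def[abs_def])
qed

section \<open>The weak-type bound\<close>

definition scale_mat :: "'a::times \<Rightarrow> 'a ^ 'n ^ 'n \<Rightarrow> 'a ^ 'n ^ 'n" where
  "scale_mat c A = (\<chi> i j. c * A $ i $ j)"

lemma scale_mat_nth [simp]: "scale_mat c A $ i $ j = c * A $ i $ j"
  by (simp add: scale_mat_def)

lemma fls_ideal_power_mult_iff:
  fixes c x :: "'a::field fls"
  assumes "c \<noteq> 0"
  shows "c ^ m * x \<in> fls_ideal k \<longleftrightarrow> x \<in> fls_ideal (k - fls_subdegree c * int m)"
proof -
  have "fls_subdegree (c ^ m) = fls_subdegree c * int m"
    by (induction m) (use assms in \<open>auto simp: algebra_simps\<close>)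
  then show ?thesis using assms by (subst fls_ideal_mult_iff) auto
qed

lemma chevalley_scale:
  fixes A :: "'a::field ^ 'n::finite ^ 'n"
  assumes "bij_betw e UNIV {1..CARD('n)}" "c \<noteq> 0"
  shows "chevalley e (scale_mat c A) $ i = c ^ e i * chevalley e A $ i"
proof -
  have "e i \<le> CARD('n)" using assms(1) by (auto simp: bij_betw_def)
  then show ?thesis
    using charpoly_scale[OF assms(2), of "e i" A] by (simp add: chevalley_def scale_mat_def)
qed

text \<open>Multiplication by \<open>t^N\<close> makes both matrices integral, where congruences
  pass to determinants. Undoing it divides \<open>p_i\<close> by \<open>t^(N i)\<close>, which is
  the weight \<open>N * e i\<close>.\<close>

lemma chevalley_cong:
  fixes A A' :: "'k::{field,finite} fls ^ 'n::finite ^ 'n"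
  assumes e: "bij_betw e UNIV {1..CARD('n)}"
    and A: "A \<in> mat_lattice (- int N)" "A' \<in> mat_lattice (- int N)"
    and diff: "A - A' \<in> mat_lattice (l - int N)"
  shows "chevalley e A - chevalley e A' \<in> vec_lattice (\<lambda>i. int N * int (e i)) l"
proof -
  define c :: "'k fls" where "c = fls_X_intpow (int N)"
  have c: "c \<noteq> 0" "fls_subdegree c = int N" by (auto simp: c_def)
  have int: "int_mat UNIV (scale_mat c B)" if "B \<in> mat_lattice (- int N)" for B
    using that c by (auto simp: int_mat_def mat_lattice_def fls_ideal_mult_iff)
  have "chevalley e (scale_mat c A) $ i - chevalley e (scale_mat c A') $ i \<in> fls_ideal l" for i
    using charpoly_cong[OF int[OF A(1)] int[OF A(2)], of l] diff c
    by (auto simp: chevalley_def mat_lattice_def fls_ideal_mult_iff simp flip: right_diff_distrib)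
  then have "c ^ e i * (chevalley e A $ i - chevalley e A' $ i) \<in> fls_ideal l" for i
    using c by (simp add: chevalley_scale[OF e] right_diff_distrib)
  then show ?thesis using c by (simp add: fls_ideal_power_mult_iff vec_lattice_def)
qed

lemma open_vimage_chevalley:
  fixes U :: "('k::{field,finite} fls ^ 'n::finite) set"
  assumes e: "bij_betw e UNIV {1..CARD('n)}" and U: "open U"
  shows "open (chevalley e -` U)"
  unfolding mat_lat.open_iff
proof
  fix A :: "'k fls ^ 'n ^ 'n" assume A: "A \<in> chevalley e -` U"
  obtain j where j: "A \<in> mat_lattice j" using mat_lat.exhaust by blast
  define N where "N = nat (- j)"
  have AN: "A \<in> mat_lattice (- int N)"
    using j mat_lat.antimono[of "- int N" j] by (auto simp: N_def)
  obtain k where k: "\<And>y. y - chevalley e A \<in> vec_lattice (\<lambda>i. int N * int (e i)) k \<Longrightarrow> y \<in> U"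
    using U A vec_lat.open_iff[of U "\<lambda>i. int N * int (e i)"] by auto
  \<comment> \<open>\<open>l\<close> is nonnegative so that \<open>B\<close> stays in the lattice
    \<open>mat_lattice (- int N)\<close> of \<open>A\<close>.\<close>
  define l where "l = max 0 k"
  have "B \<in> chevalley e -` U" if B: "B - A \<in> mat_lattice (l - int N)" for B
  proof -
    have "B - A \<in> mat_lattice (- int N)"
      using B mat_lat.antimono[of "- int N" "l - int N"] by (auto simp: l_def)
    from mat_lat.add[OF this AN] have "B \<in> mat_lattice (- int N)" by simp
    from chevalley_cong[OF e this AN B]
    have "chevalley e B - chevalley e A \<in> vec_lattice (\<lambda>i. int N * int (e i)) k"
      using vec_lat.antimono[of k l "\<lambda>i. int N * int (e i)"] by (auto simp: l_def)
    then show ?thesis using k by simp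
  qed
  then show "\<exists>k. \<forall>B. B - A \<in> mat_lattice k \<longrightarrow> B \<in> chevalley e -` U" by blast
qed

lemma measurable_chevalley:
  assumes e: "bij_betw e UNIV {1..CARD('n::finite)}"
  shows "(chevalley e :: 'k::{field,finite} fls ^ 'n ^ 'n \<Rightarrow> _) \<in> borel_measurable borel"
  by (rule borel_measurableI) (simp add: open_vimage_chevalley[OF e] borel_open)

text \<open>The discretised bound: \<open>Y\<close> is a union of cosets of level \<open>l\<close>,
  and \<open>U\<close> contains the full coset of level \<open>l\<close> around each image. After
  scaling by \<open>t^N\<close> both measures are compared with counts modulo
  \<open>t^l\<close>.\<close>

lemma haar_cosets_chevalley:
  fixes \<mu>\<^sub>c :: "('k::{field,finite} fls ^ 'n::finite) measure"
    and dx :: "('k fls ^ 'n ^ 'n) measure"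
  assumes e: "bij_betw e UNIV {1..CARD('n)}" and haar: "haar_measure \<mu>\<^sub>c" "haar_measure dx"
    and s: "0 \<le> s" "s < 1"
    and U: "U \<in> sets borel" "emeasure \<mu>\<^sub>c U < \<infinity>"
    and Y: "Y \<subseteq> mat_lattice (- int N)"
    and YU: "\<And>A y. A \<in> Y \<Longrightarrow> y - chevalley e A \<in> vec_lattice (\<lambda>i. int N * int (e i)) (int l) \<Longrightarrow> y \<in> U"
    and Y_closed: "\<And>A B. A \<in> Y \<Longrightarrow> B - A \<in> mat_lattice (int l - int N) \<Longrightarrow> B \<in> Y"
  shows "emeasure dx Y \<le> ennreal ((1 / (1 - real CARD('k) powr (s - 1))) ^ (CARD('n) - 1) *
      measure dx (mat_lattice (- int N)) *
      (measure \<mu>\<^sub>c U / measure \<mu>\<^sub>c (vec_lattice (\<lambda>i. int N * int (e i)) 0)) powr s)"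
proof -
  define w where "w = (\<lambda>i. int N * int (e i))"
  define C where "C = (1 / (1 - real CARD('k) powr (s - 1))) ^ (CARD('n) - 1)"
  define c :: "'k fls" where "c = fls_X_intpow (int N)"
  have c: "c \<noteq> 0" "fls_subdegree c = int N" by (auto simp: c_def)
  define d where "d = inverse c"
  have d: "d \<noteq> 0" "fls_subdegree d = - int N" "c * d = 1"
    using c by (auto simp: d_def)
  have cd: "c * (d * x) = x" for x using d(3) by (simp flip: mult.assoc)
  define RM where "RM = (mat_reps l :: ('k fls ^ 'n ^ 'n) set)"
  define RV where "RV = (vec_reps l :: ('k fls ^ 'n) set)"
  \<comment> \<open>\<open>X\<close> indexes the cosets that make up \<open>Y\<close>,
    \<open>V\<close> collects the residues of their characteristic polynomials, and
    \<open>dv\<close> is the effect on these of scaling a matrix by \<open>d\<close>.\<close>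
  define X where "X = {A \<in> RM. scale_mat d A \<in> Y}"
  define V where "V = (\<lambda>A. vec_trunc l (chevalley e A)) ` X"
  define dv where "dv = (\<lambda>v :: 'k fls ^ 'n. \<chi> i. d ^ e i * v $ i)"
  have fin: "finite RM" "finite X" "finite V" "finite RV" by (auto simp: RM_def X_def V_def RV_def)
  have mat_disj: "A = B" if "A \<in> RM" "B \<in> RM" "scale_mat d A - scale_mat d B \<in> mat_lattice (int l - int N)" for A B
  proof -
    have "A $ i $ j = B $ i $ j" for i j
    proof (rule fls_seg_eqI)
      show "A $ i $ j - B $ i $ j \<in> fls_ideal (int l)"
        using that(3) d by (auto simp: mat_lattice_def fls_ideal_mult_iff simp flip: right_diff_distrib)
    qed (use that in \<open>auto simp: RM_def mat_reps_def\<close>)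
    then show ?thesis by (simp add: vec_eq_iff)
  qed
  have mat_cover: "\<exists>A\<in>RM. B - scale_mat d A \<in> mat_lattice (int l - int N)"
    if B: "B \<in> mat_lattice (- int N)" for B
  proof (rule bexI)
    have "B $ i $ j - d * fls_trunc (int l) (c * B $ i $ j) \<in> fls_ideal (int l - int N)" for i j
    proof -
      have "c * (B $ i $ j - d * fls_trunc (int l) (c * B $ i $ j)) \<in> fls_ideal (int l)"
        unfolding right_diff_distrib cd by (rule fls_trunc_diff)
      then show ?thesis using c by (simp add: fls_ideal_mult_iff)
    qed
    then show "B - scale_mat d (mat_trunc l (scale_mat c B)) \<in> mat_lattice (int l - int N)"
      by (simp add: mat_lattice_def mat_trunc_def vec_trunc_def)
    show "mat_trunc l (scale_mat c B) \<in> RM"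
      using B c by (auto simp: RM_def mat_reps_def mat_trunc_def vec_trunc_def mat_lattice_def
          fls_ideal_mult_iff intro!: fls_trunc_seg)
  qed
  define q where "q = measure dx (mat_lattice (int l - int N))"
  have q: "emeasure dx (mat_lattice (int l - int N)) = ennreal q"
    unfolding q_def by (rule mat_lat.emeasure_L_eq_measure[OF haar(2)])
  have cosets: "emeasure dx (\<Union>A\<in>Z. mat_lat.coset (scale_mat d A) (int l - int N)) = ennreal (real (card Z) * q)"
    if "Z \<subseteq> RM" for Z
  proof -
    have inj: "inj_on (scale_mat d) Z"
      by (intro inj_onI mat_disj) (use that mat_lat.zero in auto)
    have "emeasure dx (\<Union>B\<in>scale_mat d ` Z. mat_lat.coset B (int l - int N)) =
        of_nat (card (scale_mat d ` Z)) * emeasure dx (mat_lattice (int l - int N))"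
      using that mat_disj fin by (intro mat_lat.emeasure_cosets[OF haar(2)]) (auto dest: finite_subset)
    then show ?thesis
      using inj by (simp add: card_image q q_def ennreal_mult ennreal_of_nat_eq_real_of_nat)
  qed
  have "Y \<subseteq> (\<Union>A\<in>X. mat_lat.coset (scale_mat d A) (int l - int N))"
  proof
    fix B assume B: "B \<in> Y"
    then obtain A where A: "A \<in> RM" "B - scale_mat d A \<in> mat_lattice (int l - int N)"
      using mat_cover Y by blast
    have "scale_mat d A - B \<in> mat_lattice (int l - int N)"
      using mat_lat.diff[OF mat_lat.zero A(2)] by simp
    then have "scale_mat d A \<in> Y" using B Y_closed by blast
    then show "B \<in> (\<Union>A\<in>X. mat_lat.coset (scale_mat d A) (int l - int N))"
      using A by (auto simp: X_def mat_lat.coset_def)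
  qed
  then have "emeasure dx Y \<le> emeasure dx (\<Union>A\<in>X. mat_lat.coset (scale_mat d A) (int l - int N))"
    using fin by (intro emeasure_mono sets.finite_UN mat_lat.coset_sets[OF haar(2)]) auto
  also have "\<dots> = ennreal (real (card X) * q)" by (rule cosets) (auto simp: X_def)
  finally have dxY: "emeasure dx Y \<le> ennreal (real (card X) * q)" .
  have "mat_lattice (- int N) = (\<Union>A\<in>RM. mat_lat.coset (scale_mat d A) (int l - int N))"
  proof
    show "mat_lattice (- int N) \<subseteq> (\<Union>A\<in>RM. mat_lat.coset (scale_mat d A) (int l - int N))"
      using mat_cover by (auto simp: mat_lat.coset_def)
    show "(\<Union>A\<in>RM. mat_lat.coset (scale_mat d A) (int l - int N)) \<subseteq> mat_lattice (- int N)"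
    proof safe
      fix A B assume A: "A \<in> RM" and B: "B \<in> mat_lat.coset (scale_mat d A) (int l - int N)"
      have "scale_mat d A \<in> mat_lattice (- int N)"
        using A d by (auto simp: mat_lattice_def fls_ideal_mult_iff RM_def mat_reps_def intro: fls_seg_ideal)
      moreover have "B - scale_mat d A \<in> mat_lattice (- int N)"
        using B mat_lat.antimono[of "- int N" "int l - int N"] by (auto simp: mat_lat.coset_def)
      ultimately show "B \<in> mat_lattice (- int N)" using mat_lat.add by fastforce
    qed
  qed
  then have dxL: "measure dx (mat_lattice (- int N)) = real (card RM) * q"
    using cosets[of RM] by (simp add: measure_def q_def)
  define q' where "q' = measure \<mu>\<^sub>c (vec_lattice w (int l))"
  have q': "emeasure \<mu>\<^sub>c (vec_lattice w (int l)) = ennreal q'" "q' > 0"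
    unfolding q'_def using vec_lat.emeasure_L_eq_measure[OF haar(1)] vec_lat.measure_L_pos[OF haar(1)] by auto
  have dv_diff: "dv x - dv y \<in> vec_lattice w k \<longleftrightarrow> (\<forall>i. x $ i - y $ i \<in> fls_ideal k)" for x y k
    using d by (simp add: dv_def vec_lattice_def w_def fls_ideal_power_mult_iff flip: right_diff_distrib)
  have vec_disj: "x = y" if "x \<in> RV" "y \<in> RV" "dv x - dv y \<in> vec_lattice w (int l)" for x y
  proof -
    have "x $ i = y $ i" for i
      by (rule fls_seg_eqI[of _ 0 "int l"]) (use that in \<open>auto simp: RV_def vec_reps_def dv_diff\<close>)
    then show ?thesis by (simp add: vec_eq_iff)
  qed
  have vcosets: "emeasure \<mu>\<^sub>c (\<Union>v\<in>Z. vec_lat.coset w (dv v) (int l)) = ennreal (real (card Z) * q')"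
    if "Z \<subseteq> RV" for Z
  proof -
    have inj: "inj_on dv Z"
      by (intro inj_onI vec_disj) (use that vec_lat.zero in auto)
    have "emeasure \<mu>\<^sub>c (\<Union>v\<in>dv ` Z. vec_lat.coset w v (int l)) =
        of_nat (card (dv ` Z)) * emeasure \<mu>\<^sub>c (vec_lattice w (int l))"
      using that vec_disj fin by (intro vec_lat.emeasure_cosets[OF haar(1)]) (auto dest: finite_subset)
    then show ?thesis
      using inj ennreal_mult[of "real (card Z)" q'] q'(2)
      by (simp add: card_image q'(1) ennreal_of_nat_eq_real_of_nat)
  qed
  have VRV: "V \<subseteq> RV"
    by (auto simp: V_def RV_def vec_reps_def vec_trunc_def chevalley_def X_def RM_def
        intro!: fls_trunc_seg charpoly_integral int_mat_reps)
  have "(\<Union>v\<in>V. vec_lat.coset w (dv v) (int l)) \<subseteq> U"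
  proof safe
    fix v y assume "v \<in> V" and y: "y \<in> vec_lat.coset w (dv v) (int l)"
    then obtain A where A: "A \<in> X" "v = vec_trunc l (chevalley e A)" by (auto simp: V_def)
    have "chevalley e (scale_mat d A) = dv (chevalley e A)"
      using d by (simp add: vec_eq_iff dv_def chevalley_scale[OF e])
    then have "dv v - chevalley e (scale_mat d A) \<in> vec_lattice w (int l)"
      by (simp add: dv_diff A vec_trunc_def fls_trunc_diff')
    from vec_lat.add[OF _ this, of "y - dv v"] y
    have "y - chevalley e (scale_mat d A) \<in> vec_lattice w (int l)" by (simp add: vec_lat.coset_def)
    then show "y \<in> U" using A YU unfolding X_def w_def by blast
  qed
  then have "emeasure \<mu>\<^sub>c (\<Union>v\<in>V. vec_lat.coset w (dv v) (int l)) \<le> emeasure \<mu>\<^sub>c U"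
    using U by (intro emeasure_mono) (auto simp: vec_lat.sets_M[OF haar(1)])
  also have "emeasure \<mu>\<^sub>c U = ennreal (measure \<mu>\<^sub>c U)"
    using U by (intro emeasure_eq_ennreal_measure) (simp add: less_top)
  finally have VU: "real (card V) * q' \<le> measure \<mu>\<^sub>c U"
    by (simp add: vcosets[OF VRV])
  have "vec_lattice w 0 = (\<Union>v\<in>RV. vec_lat.coset w (dv v) (int l))"
  proof
    show "vec_lattice w 0 \<subseteq> (\<Union>v\<in>RV. vec_lat.coset w (dv v) (int l))"
    proof
      fix y :: "'k fls ^ 'n" assume y: "y \<in> vec_lattice w 0"
      define x where "x = (\<chi> i. c ^ e i * y $ i)"
      have "d ^ m * c ^ m = 1" for m
        using d(3) by (simp add: mult.commute flip: power_mult_distrib)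
      then have y_eq: "y = dv x" by (simp add: x_def dv_def vec_eq_iff flip: mult.assoc)
      have "x $ i \<in> fls_ideal 0" for i
        using y c by (auto simp: x_def vec_lattice_def fls_ideal_power_mult_iff w_def)
      then have "vec_trunc l x \<in> RV" by (auto simp: RV_def vec_reps_def vec_trunc_def intro: fls_trunc_seg)
      moreover have "y - dv (vec_trunc l x) \<in> vec_lattice w (int l)"
        by (simp add: y_eq dv_diff vec_trunc_def fls_trunc_diff)
      ultimately show "y \<in> (\<Union>v\<in>RV. vec_lat.coset w (dv v) (int l))" by (auto simp: vec_lat.coset_def)
    qed
    show "(\<Union>v\<in>RV. vec_lat.coset w (dv v) (int l)) \<subseteq> vec_lattice w 0"
    proof safe
      fix v y assume v: "v \<in> RV" and y: "y \<in> vec_lat.coset w (dv v) (int l)"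
      have "dv v - dv 0 \<in> vec_lattice w 0"
        using v by (auto simp: dv_diff RV_def vec_reps_def intro: fls_seg_ideal)
      moreover have "dv 0 = 0" by (simp add: dv_def vec_eq_iff)
      moreover have "y - dv v \<in> vec_lattice w 0"
        using y vec_lat.antimono[of 0 "int l" w] by (auto simp: vec_lat.coset_def)
      ultimately show "y \<in> vec_lattice w 0" using vec_lat.add[of "y - dv v" w 0 "dv v"] by simp
    qed
  qed
  then have \<mu>L: "measure \<mu>\<^sub>c (vec_lattice w 0) = real (card RV) * q'"
    using vcosets[of RV] q' by (simp add: measure_def)
  have RV0: "real (card RV) > 0" by (simp add: RV_def card_vec_reps)
  have r1: "real CARD('k) powr (s - 1) < 1" using card_field_gt_1[where 'k='k] s by (simp add: powr_less_one)
  then have C0: "C \<ge> 0" by (simp add: C_def)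
  have "real (card X) \<le> real (card {A \<in> RM. vec_trunc l (chevalley e A) \<in> V})"
    unfolding of_nat_le_iff using fin by (intro card_mono) (auto simp: X_def V_def)
  also have "\<dots> \<le> C * real (card RM) * (real (card V) / real (card RV)) powr s"
    unfolding C_def RM_def RV_def by (rule card_chevalley_le[OF e s fin(3)])
  also have "\<dots> \<le> C * real (card RM) * (measure \<mu>\<^sub>c U / measure \<mu>\<^sub>c (vec_lattice w 0)) powr s"
  proof (intro mult_left_mono powr_mono2)
    show "real (card V) / real (card RV) \<le> measure \<mu>\<^sub>c U / measure \<mu>\<^sub>c (vec_lattice w 0)"
      using VU RV0 q' by (simp add: \<mu>L field_simps)
  qed (use s C0 in auto)
  finally have "real (card X) * q \<le> C * measure dx (mat_lattice (- int N)) * (measure \<mu>\<^sub>c U / measure \<mu>\<^sub>c (vec_lattice w 0)) powr s"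
    unfolding dxL using mult_right_mono[of _ _ q] by (fastforce simp: q_def algebra_simps)
  then show ?thesis
    using dxY unfolding C_def w_def by (meson ennreal_leI order_trans)
qed

text \<open>\<open>Y m\<close> consists of the matrices whose image has its coset of level
  \<open>m\<close> inside \<open>U\<close>. These sets increase to the preimage of \<open>U\<close>,
  and the bound for them is the same for all \<open>m\<close>.\<close>

lemma haar_chevalley_open:
  fixes \<mu>\<^sub>c :: "('k::{field,finite} fls ^ 'n::finite) measure"
    and dx :: "('k fls ^ 'n ^ 'n) measure"
  assumes e: "bij_betw e UNIV {1..CARD('n)}" and haar: "haar_measure \<mu>\<^sub>c" "haar_measure dx"
    and s: "0 \<le> s" "s < 1"
  obtains K where "K \<ge> 0" "\<And>U. open U \<Longrightarrow> emeasure \<mu>\<^sub>c U < \<infinity> \<Longrightarrow>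
     emeasure dx (mat_lattice (- int N) \<inter> chevalley e -` U) \<le> ennreal (K * measure \<mu>\<^sub>c U powr s)"
proof -
  define w where "w = (\<lambda>i. int N * int (e i))"
  define C where "C = (1 / (1 - real CARD('k) powr (s - 1))) ^ (CARD('n) - 1)"
  define \<Lambda> :: "('k fls ^ 'n ^ 'n) set" where "\<Lambda> = mat_lattice (- int N)"
  define K where "K = C * measure dx \<Lambda> / measure \<mu>\<^sub>c (vec_lattice w 0) powr s"
  have r1: "real CARD('k) powr (s - 1) < 1" using card_field_gt_1[where 'k='k] s by (simp add: powr_less_one)
  then have K0: "K \<ge> 0" by (simp add: K_def C_def)
  have "emeasure dx (\<Lambda> \<inter> chevalley e -` U) \<le> ennreal (K * measure \<mu>\<^sub>c U powr s)"
    if U: "open U" "emeasure \<mu>\<^sub>c U < \<infinity>" for U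
  proof -
    define Y where "Y = (\<lambda>m::nat. {A \<in> \<Lambda>. \<forall>y. y - chevalley e A \<in> vec_lattice w (int m) \<longrightarrow> y \<in> U})"
    have Y_closed: "B \<in> Y m" if A: "A \<in> Y m" and BA: "B - A \<in> mat_lattice (int m - int N)" for A B m
    proof -
      have "B - A \<in> \<Lambda>" using BA mat_lat.antimono[of "- int N" "int m - int N"] by (auto simp: \<Lambda>_def)
      then have B: "B \<in> \<Lambda>" using A mat_lat.add[of "B - A" "- int N" A] by (simp add: \<Lambda>_def Y_def)
      have BA': "chevalley e B - chevalley e A \<in> vec_lattice w (int m)"
        unfolding w_def by (rule chevalley_cong[OF e]) (use A B BA in \<open>auto simp: \<Lambda>_def Y_def\<close>)
      have "y \<in> U" if "y - chevalley e B \<in> vec_lattice w (int m)" for y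
        using vec_lat.add[OF that BA'] A by (simp add: Y_def)
      then show ?thesis using B by (simp add: Y_def)
    qed
    have openY: "open (Y m)" for m
      unfolding mat_lat.open_iff using Y_closed by blast
    have incY: "incseq Y"
    proof (rule incseq_SucI, rule subsetI)
      fix m A assume "A \<in> Y m"
      then show "A \<in> Y (Suc m)"
        using vec_lat.antimono[of "int m" "int (Suc m)" w] unfolding Y_def by fastforce
    qed
    have UN: "(\<Union>m. Y m) = \<Lambda> \<inter> chevalley e -` U"
    proof (intro equalityI subsetI)
      fix A assume "A \<in> (\<Union>m. Y m)"
      then obtain m where m: "A \<in> Y m" by blast
      have "chevalley e A - chevalley e A \<in> vec_lattice w (int m)" by (simp add: vec_lat.zero)
      then show "A \<in> \<Lambda> \<inter> chevalley e -` U" using m unfolding Y_def by blast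
    next
      fix A assume A: "A \<in> \<Lambda> \<inter> chevalley e -` U"
      then obtain k where k: "\<And>y. y - chevalley e A \<in> vec_lattice w k \<Longrightarrow> y \<in> U"
        using U vec_lat.open_iff[of U w] by auto
      have "vec_lattice w (int (nat k)) \<subseteq> (vec_lattice w k :: ('k fls ^ 'n) set)"
        by (rule vec_lat.antimono) simp
      then have "A \<in> Y (nat k)" using A k by (auto simp: Y_def)
      then show "A \<in> (\<Union>m. Y m)" by blast
    qed
    have "emeasure dx (Y m) \<le> ennreal (K * measure \<mu>\<^sub>c U powr s)" for m
    proof -
      have "emeasure dx (Y m) \<le> ennreal (C * measure dx \<Lambda> * (measure \<mu>\<^sub>c U / measure \<mu>\<^sub>c (vec_lattice w 0)) powr s)"
        unfolding C_def \<Lambda>_def w_def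
      proof (rule haar_cosets_chevalley[OF e haar s])
        show "B \<in> Y m" if "A \<in> Y m" "B - A \<in> mat_lattice (int m - int N)" for A B
          using Y_closed that .
        show "y \<in> U" if "A \<in> Y m" "y - chevalley e A \<in> vec_lattice (\<lambda>i. int N * int (e i)) (int m)" for A y
          using that by (auto simp: Y_def w_def)
      qed (use U in \<open>auto simp: Y_def \<Lambda>_def\<close>)
      then show ?thesis by (simp add: K_def powr_divide)
    qed
    then have "(SUP m. emeasure dx (Y m)) \<le> ennreal (K * measure \<mu>\<^sub>c U powr s)" by (rule SUP_least)
    also have "(SUP m. emeasure dx (Y m)) = emeasure dx (\<Lambda> \<inter> chevalley e -` U)"
      unfolding UN[symmetric] using incY openY
      by (intro SUP_emeasure_incseq) (auto simp: mat_lat.sets_M[OF haar(2)])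
    finally show ?thesis .
  qed
  then show ?thesis using K0 that unfolding \<Lambda>_def by blast
qed

text \<open>The exponent \<open>s < 1\<close> is arbitrary, so this is a weak-type bound for every Lebesgue exponent.\<close>

lemma haar_chevalley_le:
  fixes \<mu>\<^sub>c :: "('k::{field,finite} fls ^ 'n::finite) measure"
    and dx :: "('k fls ^ 'n ^ 'n) measure"
  assumes e: "bij_betw e UNIV {1..CARD('n)}" and haar: "haar_measure \<mu>\<^sub>c" "haar_measure dx"
    and s: "0 < s" "s < 1"
  obtains K where "K \<ge> 0" "\<And>B. B \<in> sets borel \<Longrightarrow> emeasure \<mu>\<^sub>c B < \<infinity> \<Longrightarrow>
     emeasure dx (mat_lattice (- int N) \<inter> chevalley e -` B) \<le> ennreal (K * measure \<mu>\<^sub>c B powr s)"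
proof -
  obtain K where K: "K \<ge> 0" "\<And>U. open U \<Longrightarrow> emeasure \<mu>\<^sub>c U < \<infinity> \<Longrightarrow>
     emeasure dx (mat_lattice (- int N) \<inter> chevalley e -` U) \<le> ennreal (K * measure \<mu>\<^sub>c U powr s)"
    using haar_chevalley_open[OF e haar less_imp_le[OF s(1)] s(2)] by metis
  have "emeasure dx (mat_lattice (- int N) \<inter> chevalley e -` B) \<le> ennreal (K * measure \<mu>\<^sub>c B powr s)"
    if B: "B \<in> sets borel" "emeasure \<mu>\<^sub>c B < \<infinity>" for B
  proof -
    have Beq: "emeasure \<mu>\<^sub>c B = ennreal (measure \<mu>\<^sub>c B)"
      using B by (intro emeasure_eq_ennreal_measure) (simp add: less_top)
    have approx: "emeasure dx (mat_lattice (- int N) \<inter> chevalley e -` B)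
        \<le> ennreal (K * (measure \<mu>\<^sub>c B + inverse (real (Suc m))) powr s)" for m
    proof -
      have "emeasure \<mu>\<^sub>c B < ennreal (measure \<mu>\<^sub>c B + inverse (real (Suc m)))"
        unfolding Beq by (intro ennreal_lessI) (auto intro!: add_nonneg_pos)
      then obtain U where U: "open U" "B \<subseteq> U" "emeasure \<mu>\<^sub>c U < ennreal (measure \<mu>\<^sub>c B + inverse (real (Suc m)))"
        using vec_lat.outer[OF haar(1) B(1)] by (auto simp: INF_less_iff)
      then have fin: "emeasure \<mu>\<^sub>c U < \<infinity>" using order_less_trans[OF U(3) ennreal_less_top] by simp
      then have "emeasure \<mu>\<^sub>c U = ennreal (measure \<mu>\<^sub>c U)"
        by (intro emeasure_eq_ennreal_measure) (simp add: less_top)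
      with U(3) have le: "measure \<mu>\<^sub>c U \<le> measure \<mu>\<^sub>c B + inverse (real (Suc m))"
        by (simp add: ennreal_less_iff del: ennreal_plus of_nat_Suc)
      have "emeasure dx (mat_lattice (- int N) \<inter> chevalley e -` B)
        \<le> emeasure dx (mat_lattice (- int N) \<inter> chevalley e -` U)"
        using U open_vimage_chevalley[OF e U(1)]
        by (intro emeasure_mono) (auto simp: mat_lat.sets_M[OF haar(2)] intro!: sets.Int borel_open mat_lat.open_L)
      also have "\<dots> \<le> ennreal (K * measure \<mu>\<^sub>c U powr s)" by (rule K(2)[OF U(1) fin])
      also have "\<dots> \<le> ennreal (K * (measure \<mu>\<^sub>c B + inverse (real (Suc m))) powr s)"
        using K(1) le s by (intro ennreal_leI mult_left_mono powr_mono2) auto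
      finally show ?thesis .
    qed
    \<comment> \<open>Convergence at measure 0 relies on \<open>s > 0\<close>:
      \<open>0 powr 0\<close> is 0, whereas the approximating values would be 1.\<close>
    have "(\<lambda>m. (measure \<mu>\<^sub>c B + inverse (real (Suc m))) powr s) \<longlonglongrightarrow> (measure \<mu>\<^sub>c B + 0) powr s"
      using s by (intro tendsto_powr2 tendsto_add tendsto_const LIMSEQ_inverse_real_of_nat) auto
    then have "(\<lambda>m. ennreal (K * (measure \<mu>\<^sub>c B + inverse (real (Suc m))) powr s)) \<longlonglongrightarrow> ennreal (K * (measure \<mu>\<^sub>c B) powr s)"
      by (intro tendsto_ennrealI tendsto_mult_left) simp
    from LIMSEQ_le_const[OF this] approx show ?thesis by blast
  qed
  then show ?thesis using K(1) that by blast
qed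

section \<open>Radon-Nikodym derivatives\<close>

text \<open>\<open>ac\<close> concerns only points with \<open>g x\<close> nonzero, because
  preimages of null sets are controlled only inside a lattice containing the support. The
  push-forward is finite, so its density is finite almost everywhere and can be taken real.\<close>

lemma pushforward_density_nonneg:
  fixes g :: "'a \<Rightarrow> real"
  assumes N: "sigma_finite_measure N" and p [measurable]: "p \<in> measurable M N"
    and g: "integrable M g" "\<And>x. 0 \<le> g x"
    and ac: "\<And>B. B \<in> null_sets N \<Longrightarrow> AE x in M. p x \<in> B \<longrightarrow> g x = 0"
  shows "\<exists>h :: 'b \<Rightarrow> real. integrable N h \<and>
     (\<forall>B\<in>sets N. set_lebesgue_integral N B h = set_lebesgue_integral M (p -` B \<inter> space M) g)"
proof -
  interpret N: sigma_finite_measure N by fact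
  have [measurable]: "g \<in> borel_measurable M" using g by simp
  define \<nu> where "\<nu> = distr (density M (\<lambda>x. ennreal (g x))) N p"
  have sets_\<nu> [measurable_cong]: "sets \<nu> = sets N" by (simp add: \<nu>_def)
  have space_\<nu>: "space \<nu> = space N" by (simp add: \<nu>_def)
  have em: "emeasure \<nu> B = (\<integral>\<^sup>+x. ennreal (g x) * indicator (p -` B \<inter> space M) x \<partial>M)"
    if [measurable]: "B \<in> sets N" for B
    by (simp add: \<nu>_def emeasure_distr emeasure_density)
  have fin: "finite_measure \<nu>"
  proof
    have "emeasure \<nu> (space N) \<le> (\<integral>\<^sup>+x. ennreal (g x) \<partial>M)"
      by (subst em) (auto intro!: nn_integral_mono simp: indicator_def)
    also have "\<dots> < \<infinity>" using g by (simp add: nn_integral_eq_integral)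
    finally show "emeasure \<nu> (space \<nu>) \<noteq> \<infinity>" by (simp add: space_\<nu>)
  qed
  interpret \<nu>: finite_measure \<nu> by (rule fin)
  have "absolutely_continuous N \<nu>"
    unfolding absolutely_continuous_def
  proof
    fix B assume B: "B \<in> null_sets N"
    then have [measurable]: "B \<in> sets N" by auto
    have "(\<integral>\<^sup>+x. ennreal (g x) * indicator (p -` B \<inter> space M) x \<partial>M) = (\<integral>\<^sup>+x. 0 \<partial>M)"
      using ac[OF B] by (intro nn_integral_cong_AE) (auto simp: indicator_def)
    then show "B \<in> null_sets \<nu>" using em[of B] by (simp add: null_sets_def sets_\<nu>)
  qed
  then obtain f where f [measurable]: "f \<in> borel_measurable N" and df: "density N f = \<nu>"
    using N.Radon_Nikodym sets_\<nu> by blast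
  define h where "h = (\<lambda>x. enn2real (f x))"
  have h [measurable]: "h \<in> borel_measurable N" by (simp add: h_def)
  have "(\<integral>\<^sup>+x. f x \<partial>N) = emeasure \<nu> (space N)"
    by (simp add: df[symmetric] emeasure_density cong: nn_integral_cong)
  then have "AE x in N. f x \<noteq> \<infinity>"
    using \<nu>.emeasure_finite by (intro nn_integral_PInf_AE) auto
  then have dh: "density N (\<lambda>x. ennreal (h x)) = \<nu>"
    unfolding df[symmetric] by (intro density_cong) (auto simp: h_def less_top)
  have int: "integrable N h"
  proof -
    have "integrable (density N (\<lambda>x. ennreal (h x))) (\<lambda>_. 1 :: real)" unfolding dh by simp
    then show ?thesis by (subst (asm) integrable_density) (auto simp: h_def)
  qed
  have "set_lebesgue_integral N B h = set_lebesgue_integral M (p -` B \<inter> space M) g" if B [measurable]: "B \<in> sets N" for B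
  proof -
    have "set_lebesgue_integral N B h = (\<integral>x. h x *\<^sub>R indicat_real B x \<partial>N)"
      by (simp add: set_lebesgue_integral_def mult.commute)
    also have "\<dots> = (\<integral>x. indicat_real B x \<partial>density N (\<lambda>x. ennreal (h x)))"
      by (rule integral_density[symmetric]) (auto simp: h_def)
    also have "\<dots> = (\<integral>x. indicat_real B (p x) \<partial>density M (\<lambda>x. ennreal (g x)))"
      unfolding dh \<nu>_def by (rule integral_distr) auto
    also have "\<dots> = (\<integral>x. g x *\<^sub>R indicat_real B (p x) \<partial>M)"
      by (rule integral_density) (auto simp: g)
    also have "\<dots> = set_lebesgue_integral M (p -` B \<inter> space M) g"
      unfolding set_lebesgue_integral_def by (intro Bochner_Integration.integral_cong) (auto simp: indicator_def)
    finally show ?thesis .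
  qed
  then show ?thesis using int by blast
qed

lemma pushforward_density:
  fixes \<phi> :: "'a \<Rightarrow> complex"
  assumes N: "sigma_finite_measure N" and p [measurable]: "p \<in> measurable M N"
    and \<phi>: "integrable M \<phi>"
    and ac: "\<And>B. B \<in> null_sets N \<Longrightarrow> AE x in M. p x \<in> B \<longrightarrow> \<phi> x = 0"
  shows "\<exists>f :: 'b \<Rightarrow> complex. integrable N f \<and>
     (\<forall>B\<in>sets N. set_lebesgue_integral M (p -` B \<inter> space M) \<phi> = set_lebesgue_integral N B f)"
proof -
  have ex: "\<exists>h :: 'b \<Rightarrow> real. integrable N h \<and>
     (\<forall>B\<in>sets N. set_lebesgue_integral N B h = set_lebesgue_integral M (p -` B \<inter> space M) (\<lambda>x. max (u (\<phi> x)) 0))"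
    if u: "integrable M (\<lambda>x. u (\<phi> x))" "u 0 = (0::real)" for u
  proof (rule pushforward_density_nonneg[OF N p integrable_max[OF u(1)]])
    fix B assume "B \<in> null_sets N"
    from ac[OF this] show "AE x in M. p x \<in> B \<longrightarrow> max (u (\<phi> x)) 0 = 0"
      by (rule eventually_mono) (use u(2) in auto)
  qed auto
  \<comment> \<open>Four nonnegative densities: the positive parts of \<open>Re\<close>,
    \<open>- Re\<close>, \<open>Im\<close>, \<open>- Im\<close>, to be recombined with the
    coefficients 1, -1, i, -i.\<close>
  define u where "u = (\<lambda>i::nat. [Re, \<lambda>z. - Re z, Im, \<lambda>z. - Im z] ! i)"
  have u: "integrable M (\<lambda>x. u i (\<phi> x))" "u i 0 = 0" if "i < 4" for i
    using \<phi> that by (auto simp: u_def less_Suc_eq numeral_eq_Suc)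
  define H where "H = (\<lambda>i (h :: 'b \<Rightarrow> real). integrable N h \<and> (\<forall>B\<in>sets N. set_lebesgue_integral N B h
      = set_lebesgue_integral M (p -` B \<inter> space M) (\<lambda>x. max (u i (\<phi> x)) 0)))"
  have "\<exists>h. H i h" if "i < 4" for i
    unfolding H_def by (rule ex) (use u[OF that] in auto)
  then obtain h where h: "\<And>i. i < 4 \<Longrightarrow> H i (h i)" by metis
  define c :: "nat \<Rightarrow> complex" where "c = (\<lambda>i. [1, -1, \<i>, -\<i>] ! i)"
  have dec: "\<phi> x = (\<Sum>i<4. c i * complex_of_real (max (u i (\<phi> x)) 0))" for x
    by (auto simp: c_def u_def numeral_eq_Suc complex_eq_iff max_def)
  define f where "f = (\<lambda>y. \<Sum>i<4. c i * complex_of_real (h i y))"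
  have set_int: "set_lebesgue_integral K X (\<lambda>x. \<Sum>i<4. c i * complex_of_real (g i x))
     = (\<Sum>i<4. c i * complex_of_real (set_lebesgue_integral K X (g i)))"
    if "\<And>i. i < 4 \<Longrightarrow> integrable K (g i)" "X \<in> sets K" for K :: "'d measure" and X g
  proof -
    have int: "integrable K (\<lambda>x. indicat_real X x *\<^sub>R g i x)" if "i < 4" for i
      using \<open>\<And>i. i < 4 \<Longrightarrow> integrable K (g i)\<close>[OF that] \<open>X \<in> sets K\<close> by (intro integrable_mult_indicator)
    have "set_lebesgue_integral K X (\<lambda>x. \<Sum>i<4. c i * complex_of_real (g i x))
       = (\<integral>x. (\<Sum>i<4. c i * complex_of_real (indicat_real X x *\<^sub>R g i x)) \<partial>K)"
      by (simp add: set_lebesgue_integral_def scaleR_conv_of_real sum_distrib_left mult_ac)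
    also have "\<dots> = (\<Sum>i<4. \<integral>x. c i * complex_of_real (indicat_real X x *\<^sub>R g i x) \<partial>K)"
    proof (rule Bochner_Integration.integral_sum)
      fix i :: nat assume "i \<in> {..<4}"
      then show "integrable K (\<lambda>x. c i * complex_of_real (indicat_real X x *\<^sub>R g i x))"
        by (intro integrable_mult_right integrable_bounded_linear[OF bounded_linear_of_real int]) auto
    qed
    also have "\<dots> = (\<Sum>i<4. c i * complex_of_real (\<integral>x. indicat_real X x *\<^sub>R g i x \<partial>K))"
      by (simp only: integral_mult_right_zero integral_complex_of_real)
    finally show ?thesis by (simp add: set_lebesgue_integral_def)
  qed
  have "integrable N f" unfolding f_def using h by (auto simp: H_def)
  moreover have "set_lebesgue_integral M (p -` B \<inter> space M) \<phi> = set_lebesgue_integral N B f" if "B \<in> sets N" for B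
  proof -
    have "set_lebesgue_integral M (p -` B \<inter> space M) (\<lambda>x. \<Sum>i<4. c i * complex_of_real (max (u i (\<phi> x)) 0))
      = set_lebesgue_integral N B f"
      unfolding f_def using that h u measurable_sets[OF p that]
      by (subst (1 2) set_int) (auto simp: H_def)
    then show ?thesis by (simp flip: dec)
  qed
  ultimately show ?thesis by blast
qed

text \<open>If \<open>u\<close> is one of \<open>\<plusminus> Re f\<close>, \<open>\<plusminus> Im f\<close>, then \<open>B = {u \<ge> \<tau>}\<close> satisfies
  \<open>\<tau> M(B) \<le> \<bar>\<integral>\<^sub>B f\<bar> \<le> K M(B)\<^sup>s\<close>, hence \<open>M(B) \<le> (K / \<tau>)\<^bsup>1/(1-s)\<^esup>\<close>.\<close>

lemma weak_type_tail:
  fixes f :: "'a \<Rightarrow> complex" and u :: "complex \<Rightarrow> real"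
  assumes f: "integrable M f" and s: "0 < s" "s < 1" and K: "K \<ge> 0"
    and bound: "\<And>B. B \<in> sets M \<Longrightarrow> emeasure M B < \<infinity> \<Longrightarrow> norm (set_lebesgue_integral M B f) \<le> K * measure M B powr s"
    and u: "bounded_linear u" "\<And>z. \<bar>u z\<bar> \<le> norm z" and \<tau>: "\<tau> > 0"
  shows "emeasure M {x \<in> space M. u (f x) \<ge> \<tau>} \<le> ennreal ((K / \<tau>) powr (1 / (1 - s)))"
proof -
  interpret u: bounded_linear u by fact
  have fm [measurable]: "f \<in> borel_measurable M" using f by simp
  have uf: "integrable M (\<lambda>x. u (f x))" by (rule integrable_bounded_linear[OF u(1) f])
  have [measurable]: "(\<lambda>x. u (f x)) \<in> borel_measurable M" using uf by simp
  define B where "B = {x \<in> space M. u (f x) \<ge> \<tau>}"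
  have B [measurable]: "B \<in> sets M" by (simp add: B_def)
  define b where "b = measure M B"
  \<comment> \<open>Markov's inequality makes the measure of \<open>B\<close> finite, as
    \<open>bound\<close> demands.\<close>
  have "emeasure M B \<le> emeasure M {x \<in> space M. \<bar>u (f x)\<bar> \<ge> \<tau>}"
    unfolding B_def by (intro emeasure_mono) auto
  also have "\<dots> < \<infinity>"
  proof -
    have "emeasure M {x \<in> space M. 1 \<le> ennreal (1 / \<tau>) * ennreal \<bar>u (f x)\<bar>} 
        \<le> ennreal (1 / \<tau>) * (\<integral>\<^sup>+x. ennreal \<bar>u (f x)\<bar> \<partial>M)"
      using nn_integral_Markov_inequality[where u = "\<lambda>x. ennreal \<bar>u (f x)\<bar>" and M = M
        and A = "space M" and c = "ennreal (1 / \<tau>)"]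
      by (simp cong: nn_integral_cong)
    also have "\<dots> < \<infinity>"
      using integrable_abs[OF uf] by (subst nn_integral_eq_integral) (auto simp: ennreal_mult_less_top)
    also have "{x \<in> space M. 1 \<le> ennreal (1 / \<tau>) * ennreal \<bar>u (f x)\<bar>} = {x \<in> space M. \<bar>u (f x)\<bar> \<ge> \<tau>}"
      using \<tau> by (auto simp: ennreal_mult[symmetric] field_simps simp flip: ennreal_1)
    finally show ?thesis .
  qed
  finally have fin: "emeasure M B < \<infinity>" .
  then have Beq: "emeasure M B = ennreal b"
    unfolding b_def by (intro emeasure_eq_ennreal_measure) (simp add: less_top)
  have "\<tau> * b = (\<integral>x. \<tau> * indicat_real B x \<partial>M)" using fin by (simp add: b_def)
  also have "\<dots> \<le> (\<integral>x. indicat_real B x *\<^sub>R u (f x) \<partial>M)"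
  proof (rule integral_mono)
    show "integrable M (\<lambda>x. \<tau> * indicat_real B x)"
      using fin by (intro integrable_mult_right integrable_real_indicator B)
    show "integrable M (\<lambda>x. indicat_real B x *\<^sub>R u (f x))"
      by (intro integrable_mult_indicator B uf)
  qed (auto simp: B_def indicator_def)
  also have "\<dots> = (\<integral>x. u (indicat_real B x *\<^sub>R f x) \<partial>M)" by (simp add: u.scaleR)
  also have "\<dots> = u (set_lebesgue_integral M B f)"
    unfolding set_lebesgue_integral_def by (intro integral_bounded_linear u(1) integrable_mult_indicator B f)
  also have "\<dots> \<le> norm (set_lebesgue_integral M B f)" using u(2) abs_le_D1 by blast
  also have "\<dots> \<le> K * b powr s" unfolding b_def by (rule bound[OF B fin])
  finally have le: "\<tau> * b \<le> K * b powr s" .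
  have "b \<le> (K / \<tau>) powr (1 / (1 - s))"
  proof (cases "b = 0")
    case False
    then have b: "b > 0" by (simp add: b_def less_le)
    have "b powr (1 - s) \<le> K / \<tau>" using le b \<tau> by (simp add: powr_diff field_simps)
    then have "(b powr (1 - s)) powr (1 / (1 - s)) \<le> (K / \<tau>) powr (1 / (1 - s))"
      using s by (intro powr_mono2) auto
    then show ?thesis using s b by (simp add: powr_powr)
  qed simp
  then show ?thesis unfolding B_def[symmetric] Beq by (rule ennreal_leI)
qed

text \<open>Since \<open>q \<ge> 1\<close>, values up to 1 are dominated by \<open>y\<close> itself,
  which will be integrable. A larger \<open>y\<close> between \<open>2^k\<close> and
  \<open>2^(k+1)\<close> is dominated by term \<open>k\<close> alone.\<close>

lemma powr_le_dyadic:
  fixes y q :: real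
  assumes "y \<ge> 0" "q \<ge> 1"
  shows "ennreal (y powr q) \<le> ennreal y + (\<Sum>k. ennreal (2 powr (q * real (Suc k))) * indicator {y. y \<ge> 2 ^ k} y)"
proof (cases "y \<le> 1")
  case True
  have "y powr q \<le> y"
    using assms True powr_mono'[of 1 q y] by (cases "y = 0") auto
  then have "ennreal (y powr q) \<le> ennreal y" by (rule ennreal_leI)
  then show ?thesis by (rule order_trans) simp
next
  case False
  define m where "m = nat \<lfloor>y\<rfloor>"
  have rm: "real m = real_of_int \<lfloor>y\<rfloor>" using False by (simp add: m_def)
  have m: "real m \<le> y" "y < real (m + 1)" "m \<ge> 1" using False rm by linarith+
  obtain k where "2 ^ k \<le> m" "m < 2 ^ (k + 1)" using ex_power_ivl1[of 2 m] m by auto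
  then have "2 ^ k \<le> real m" "real (m + 1) \<le> 2 ^ Suc k"
    using of_nat_le_iff[of "2 ^ k" m, where 'a=real] of_nat_le_iff[of "m + 1" "2 ^ Suc k", where 'a=real]
    by auto
  then have k: "2 ^ k \<le> y" "y < 2 ^ Suc k" using m by linarith+
  have "y powr q \<le> (2 ^ Suc k) powr q" using k assms by (intro powr_mono2) auto
  also have "(2 ^ Suc k :: real) = 2 powr real (Suc k)" by (rule powr_realpow[symmetric]) simp
  finally have "ennreal (y powr q) \<le> ennreal (2 powr (q * real (Suc k)))"
    by (intro ennreal_leI) (simp add: powr_powr mult.commute)
  also have "\<dots> = ennreal (2 powr (q * real (Suc k))) * indicator {y. y \<ge> 2 ^ k} y" using k by simp
  also have "\<dots> \<le> (\<Sum>k. ennreal (2 powr (q * real (Suc k))) * indicator {y. y \<ge> 2 ^ k} y)"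
  proof -
    define d where "d = (\<lambda>k. ennreal (2 powr (q * real (Suc k))) * indicator {y. y \<ge> 2 ^ k} y)"
    have "d k \<le> suminf d" using sum_le_suminf[of d "{k}"] by simp
    then show ?thesis by (simp only: d_def)
  qed
  finally show ?thesis by (simp add: add_increasing)
qed

lemma Lq_of_weak_type:
  fixes f :: "'a \<Rightarrow> complex"
  assumes f: "integrable M f" and q: "q \<ge> 1"
    and bound: "\<And>s. 0 < s \<Longrightarrow> s < 1 \<Longrightarrow> \<exists>K\<ge>0. \<forall>B\<in>sets M. emeasure M B < \<infinity> \<longrightarrow>
        norm (set_lebesgue_integral M B f) \<le> K * measure M B powr s"
  shows "f \<in> Lq q M"
proof -
  \<comment> \<open>This \<open>s\<close> gives the tail exponent
    \<open>1 / (1 - s) = q + 1\<close>, one more than \<open>q\<close>, so the dyadic sum converges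
    like that of \<open>(1 / 2)^k\<close>.\<close>
  define s where "s = q / (q + 1)"
  have s: "0 < s" "s < 1" "1 / (1 - s) = q + 1" using q by (auto simp: s_def field_simps)
  obtain K where K: "K \<ge> 0" "\<And>B. B \<in> sets M \<Longrightarrow> emeasure M B < \<infinity> \<Longrightarrow>
        norm (set_lebesgue_integral M B f) \<le> K * measure M B powr s"
    using bound[OF s(1,2)] by blast
  have [measurable]: "f \<in> borel_measurable M" using f by simp
  \<comment> \<open>If \<open>norm z \<ge> \<tau>\<close>, one of \<open>Re z\<close>,
    \<open>- Re z\<close>, \<open>Im z\<close>, \<open>- Im z\<close> is at least
    \<open>\<tau> / 2\<close>: hence the factors 4 and 2.\<close>
  define D where "D = 4 * (2 * K) powr (q + 1)"
  have tail: "emeasure M {x \<in> space M. norm (f x) \<ge> \<tau>} \<le> ennreal (D * \<tau> powr (- (q + 1)))" if \<tau>: "\<tau> > 0" for \<tau>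
  proof -
    define t where "t = (2 * K / \<tau>) powr (q + 1)"
    define X where "X = (\<lambda>u :: complex \<Rightarrow> real. {x \<in> space M. u (f x) \<ge> \<tau> / 2})"
    have X: "emeasure M (X u) \<le> ennreal t" if "bounded_linear u" "\<And>z. \<bar>u z\<bar> \<le> norm z" for u
      using weak_type_tail[OF f s(1,2) K that, of "\<tau> / 2"] \<tau> by (simp add: s(3) t_def X_def mult.commute)
    have Xm: "X u \<in> sets M" if "bounded_linear u" for u
    proof -
      have "(\<lambda>x. u (f x)) \<in> borel_measurable M"
        using integrable_bounded_linear[OF that f] by simp
      then show ?thesis by (simp add: X_def)
    qed
    have bl: "bounded_linear Re" "bounded_linear (\<lambda>z. - Re z)" "bounded_linear Im" "bounded_linear (\<lambda>z. - Im z)"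
      by (auto intro: bounded_linear_Re bounded_linear_Im bounded_linear_minus)
    have "emeasure M {x \<in> space M. norm (f x) \<ge> \<tau>}
       \<le> emeasure M ((X Re \<union> X (\<lambda>z. - Re z)) \<union> (X Im \<union> X (\<lambda>z. - Im z)))"
    proof (intro emeasure_mono sets.Un Xm bl subsetI)
      fix x assume x: "x \<in> {x \<in> space M. norm (f x) \<ge> \<tau>}"
      then have "\<tau> \<le> \<bar>Re (f x)\<bar> + \<bar>Im (f x)\<bar>" using cmod_le[of "f x"] by simp
      then have "\<tau> / 2 \<le> \<bar>Re (f x)\<bar> \<or> \<tau> / 2 \<le> \<bar>Im (f x)\<bar>" by linarith
      then show "x \<in> (X Re \<union> X (\<lambda>z. - Re z)) \<union> (X Im \<union> X (\<lambda>z. - Im z))"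
        using x by (auto simp: X_def abs_if split: if_splits)
    qed
    also have "\<dots> \<le> (emeasure M (X Re) + emeasure M (X (\<lambda>z. - Re z))) + (emeasure M (X Im) + emeasure M (X (\<lambda>z. - Im z)))"
      by (intro order_trans[OF emeasure_subadditive] add_mono emeasure_subadditive sets.Un Xm bl)
    also have "\<dots> \<le> (ennreal t + ennreal t) + (ennreal t + ennreal t)"
      by (intro add_mono X bl) (auto simp: abs_Re_le_cmod abs_Im_le_cmod)
    also have "\<dots> = ennreal (4 * t)" by (simp add: t_def flip: ennreal_plus)
    also have "4 * t = D * \<tau> powr (- (q + 1))"
    proof -
      have "t = (2 * K) powr (q + 1) / \<tau> powr (q + 1)"
        unfolding t_def by (rule powr_divide)
      then show ?thesis by (simp only: D_def powr_minus divide_inverse mult_ac)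
    qed
    finally show ?thesis .
  qed
  have "(\<integral>\<^sup>+x. ennreal (norm (f x) powr q) \<partial>M) \<le> (\<integral>\<^sup>+x. ennreal (norm (f x)) +
      (\<Sum>k. ennreal (2 powr (q * real (Suc k))) * indicator {y. y \<ge> 2 ^ k} (norm (f x))) \<partial>M)"
    by (intro nn_integral_mono powr_le_dyadic q) simp
  also have "\<dots> = (\<integral>\<^sup>+x. ennreal (norm (f x)) \<partial>M) +
      (\<Sum>k. \<integral>\<^sup>+x. ennreal (2 powr (q * real (Suc k))) * indicator {y. y \<ge> 2 ^ k} (norm (f x)) \<partial>M)"
    by (subst nn_integral_add) (auto simp: nn_integral_suminf)
  also have "(\<Sum>k. \<integral>\<^sup>+x. ennreal (2 powr (q * real (Suc k))) * indicator {y. y \<ge> 2 ^ k} (norm (f x)) \<partial>M)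
     \<le> (\<Sum>k. ennreal (2 powr q * D * (1 / 2) ^ k))"
  proof (intro suminf_le summableI)
    fix k :: nat
    have "(\<integral>\<^sup>+x. ennreal (2 powr (q * real (Suc k))) * indicator {y. y \<ge> 2 ^ k} (norm (f x)) \<partial>M)
       = (\<integral>\<^sup>+x. ennreal (2 powr (q * real (Suc k))) * indicator {x \<in> space M. norm (f x) \<ge> 2 ^ k} x \<partial>M)"
      by (intro nn_integral_cong) (auto simp: indicator_def)
    also have "\<dots> = ennreal (2 powr (q * real (Suc k))) * emeasure M {x \<in> space M. norm (f x) \<ge> 2 ^ k}"
      by (subst nn_integral_cmult_indicator) auto
    also have "\<dots> \<le> ennreal (2 powr (q * real (Suc k))) * ennreal (D * (2 ^ k) powr (- (q + 1)))"
      by (intro mult_left_mono tail) auto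
    also have "\<dots> = ennreal (2 powr (q * real (Suc k)) * (D * (2 ^ k) powr (- (q + 1))))"
      by (simp add: ennreal_mult D_def)
    also have "2 powr (q * real (Suc k)) * (D * (2 ^ k) powr (- (q + 1))) =
        D * (2 powr (q * real (Suc k)) * 2 powr (real k * - (q + 1)))"
      by (simp add: powr_powr flip: powr_realpow)
    also have "2 powr (q * real (Suc k)) * 2 powr (real k * - (q + 1)) = 2 powr q * (1 / 2) ^ k"
    proof -
      have "(1 / 2 :: real) ^ k = 2 powr (- real k)"
        by (simp add: powr_minus powr_realpow power_one_over inverse_eq_divide)
      then show ?thesis by (simp add: algebra_simps flip: powr_add)
    qed
    finally show "(\<integral>\<^sup>+x. ennreal (2 powr (q * real (Suc k))) * indicator {y. y \<ge> 2 ^ k} (norm (f x)) \<partial>M)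
       \<le> ennreal (2 powr q * D * (1 / 2) ^ k)" by (simp add: mult_ac)
  qed
  also have "(\<Sum>k. ennreal (2 powr q * D * (1 / 2) ^ k)) = ennreal (\<Sum>k. 2 powr q * D * (1 / 2) ^ k)"
    by (rule suminf_ennreal2) (auto simp: D_def intro!: summable_mult summable_geometric)
  also have "(\<integral>\<^sup>+x. ennreal (norm (f x)) \<partial>M) + ennreal (\<Sum>k. 2 powr q * D * (1 / 2) ^ k) < \<infinity>"
    using integrable_norm[OF f] by (simp add: nn_integral_eq_integral)
  finally have "(\<integral>\<^sup>+x. ennreal (norm (f x) powr q) \<partial>M) < \<infinity>" by simp
  then have "integrable M (\<lambda>x. norm (f x) powr q)"
    by (intro integrableI_nonneg) auto
  then show ?thesis by (simp add: Lq_def)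
qed

section \<open>Locally constant functions of compact support, and the theorem\<close>

lemma locally_constant_vimage_open: "locally_constant \<phi> \<Longrightarrow> open (\<phi> -` S)"
  unfolding locally_constant_def
proof (subst open_subopen, safe)
  fix x assume "\<forall>x. \<exists>U. open U \<and> x \<in> U \<and> \<phi> constant_on U" "\<phi> x \<in> S"
  then obtain U where U: "open U" "x \<in> U" "\<phi> constant_on U" by blast
  have "U \<subseteq> \<phi> -` S"
  proof
    fix y assume "y \<in> U"
    then show "y \<in> \<phi> -` S" using U \<open>\<phi> x \<in> S\<close> by (auto simp: constant_on_def)
  qed
  then show "\<exists>T. open T \<and> x \<in> T \<and> T \<subseteq> \<phi> -` S" using U by blast
qed

text \<open>The level sets are open, so by compactness finitely many values suffice on the support;
  the sum of their norms is a bound.\<close>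

lemma locally_constant_bounded:
  fixes \<phi> :: "'a::topological_space \<Rightarrow> complex"
  assumes "locally_constant \<phi>" "compactly_supported \<phi>"
  obtains c where "c \<ge> 0" "\<And>x. norm (\<phi> x) \<le> c"
proof -
  let ?S = "closure {x. \<phi> x \<noteq> 0}"
  have cpt: "compact ?S" using assms(2) by (simp add: compactly_supported_def)
  define W where "W = (\<lambda>z. \<phi> -` {z})"
  have W: "open (W z)" "x \<in> W (\<phi> x)" "x \<in> W z \<Longrightarrow> \<phi> x = z" for x z
    unfolding W_def by (auto intro: locally_constant_vimage_open[OF assms(1)])
  have "?S \<subseteq> (\<Union>z\<in>UNIV. W z)" using W(2) by blast
  then obtain Z where Z: "finite Z" "?S \<subseteq> (\<Union>z\<in>Z. W z)"
    using compactE_image[OF cpt, of UNIV W] W(1) by metis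
  have "norm (\<phi> x) \<le> (\<Sum>z\<in>Z. norm z)" for x
  proof (cases "\<phi> x = 0")
    case False
    then have "x \<in> ?S" by (intro subsetD[OF closure_subset]) simp
    then obtain z where "z \<in> Z" "x \<in> W z" using Z(2) by blast
    then have "\<phi> x \<in> Z" using W(3) by simp
    then show ?thesis using Z by (intro member_le_sum) auto
  qed (simp add: sum_nonneg)
  then show ?thesis using that[of "\<Sum>z\<in>Z. norm z"] by (simp add: sum_nonneg)
qed

text \<open>A derivative is determined only up to null sets, so integrability is claimed for each
  choice of \<open>f\<close>, next to existence.\<close>

theorem theoremA:
  fixes e :: "'n::finite \<Rightarrow> nat"
    and \<mu>\<^sub>c :: "('k::{field, finite} fls ^ 'n) measure"
    and \<mu> :: "('k fls ^ 'n ^ 'n) set \<Rightarrow> complex"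
  assumes e: "bij_betw e UNIV {1..CARD('n)}"
    and haar: "haar_measure \<mu>\<^sub>c"
    and smooth: "smooth_compactly_supported_measure \<mu>"
  shows "(\<exists>f. has_RN_derivative (pushforward (chevalley e) \<mu>) \<mu>\<^sub>c f) \<and>
         (\<forall>f. has_RN_derivative (pushforward (chevalley e) \<mu>) \<mu>\<^sub>c f
              \<longrightarrow> f \<in> (\<Inter>q\<in>{1..}. Lq q \<mu>\<^sub>c))"
proof -
  obtain dx \<phi> where dx: "haar_measure dx" and \<phi>: "locally_constant \<phi>" "compactly_supported \<phi>"
    and \<mu>: "\<And>A. A \<in> sets borel \<Longrightarrow> \<mu> A = set_lebesgue_integral dx A \<phi>"
    using smooth by (auto simp: smooth_compactly_supported_measure_def)
  obtain c where c: "c \<ge> 0" "\<And>x. norm (\<phi> x) \<le> c" by (rule locally_constant_bounded[OF \<phi>]) blast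
  obtain k where k: "closure {x. \<phi> x \<noteq> 0} \<subseteq> mat_lattice k"
    using mat_lat.compact_subset_L \<phi>(2) unfolding compactly_supported_def by metis
  \<comment> \<open>For either sign of \<open>k\<close>, the lattice
    \<open>mat_lattice (- int N)\<close> contains \<open>mat_lattice k\<close>, hence the
    support.\<close>
  define N where "N = nat (- k)"
  define \<Lambda> :: "('k fls ^ 'n ^ 'n) set" where "\<Lambda> = mat_lattice (- int N)"
  have supp: "x \<in> \<Lambda>" if "\<phi> x \<noteq> 0" for x
  proof -
    have "x \<in> closure {x. \<phi> x \<noteq> 0}" using that by (intro subsetD[OF closure_subset]) simp
    then have "x \<in> mat_lattice k" using k by blast
    then show ?thesis using mat_lat.antimono[of "- int N" k] by (auto simp: \<Lambda>_def N_def)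
  qed
  note sets_dx [measurable_cong] = mat_lat.sets_M[OF dx]
  note sets_c [measurable_cong] = vec_lat.sets_M[OF haar]
  have [measurable]: "\<phi> \<in> borel_measurable dx"
  proof (rule borel_measurableI)
    show "\<phi> -` S \<inter> space dx \<in> sets dx" for S
      using locally_constant_vimage_open[OF \<phi>(1)] by (simp add: sets_dx mat_lat.space_M[OF dx])
  qed
  have p [measurable]: "chevalley e \<in> measurable dx \<mu>\<^sub>c"
    using measurable_chevalley[OF e, where 'k='k] measurable_cong_sets[OF sets_dx sets_c] by blast
  have \<Lambda> [measurable]: "\<Lambda> \<in> sets dx" "emeasure dx \<Lambda> < \<infinity>"
    unfolding \<Lambda>_def using mat_lat.L_sets[OF dx] mat_lat.emeasure_L_finite[OF dx] by auto
  have int\<phi>: "integrable dx \<phi>"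
    by (rule integrableI_bounded_set[OF \<Lambda>(1) _ \<Lambda>(2), of _ c]) (use c supp in auto)
  have pre: "chevalley e -` B \<inter> space dx = chevalley e -` B" for B
    by (simp add: mat_lat.space_M[OF dx])
  have pre_sets: "chevalley e -` B \<in> sets dx" if "B \<in> sets \<mu>\<^sub>c" for B
    using measurable_sets[OF p that] by (simp add: pre)
  have push: "pushforward (chevalley e) \<mu> B = set_lebesgue_integral dx (chevalley e -` B) \<phi>"
    if "B \<in> sets \<mu>\<^sub>c" for B
    using pre_sets[OF that] by (simp add: pushforward_def \<mu> sets_dx)
  have bound: "\<exists>K\<ge>0. \<forall>B\<in>sets \<mu>\<^sub>c. emeasure \<mu>\<^sub>c B < \<infinity> \<longrightarrow>
      emeasure dx (\<Lambda> \<inter> chevalley e -` B) \<le> ennreal (K * measure \<mu>\<^sub>c B powr s)"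
    if "0 < s" "s < 1" for s
    using haar_chevalley_le[OF e haar dx that, of N] unfolding \<Lambda>_def sets_c by metis
  have "\<exists>f. integrable \<mu>\<^sub>c f \<and> (\<forall>B\<in>sets \<mu>\<^sub>c.
      set_lebesgue_integral dx (chevalley e -` B \<inter> space dx) \<phi> = set_lebesgue_integral \<mu>\<^sub>c B f)"
  proof (rule pushforward_density[OF vec_lat.sigma_finite_haar[OF haar] p int\<phi>])
    fix B assume B: "B \<in> null_sets \<mu>\<^sub>c"
    obtain K where K: "\<And>B. B \<in> sets \<mu>\<^sub>c \<Longrightarrow> emeasure \<mu>\<^sub>c B < \<infinity> \<Longrightarrow>
        emeasure dx (\<Lambda> \<inter> chevalley e -` B) \<le> ennreal (K * measure \<mu>\<^sub>c B powr (1/2))"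
      using bound[of "1/2"] by auto
    \<comment> \<open>The bound at measure 0 is absolute continuity; any exponent strictly between 0
      and 1 would do.\<close>
    have "emeasure dx (\<Lambda> \<inter> chevalley e -` B) = 0"
      using K[of B] B by (simp add: null_sets_def measure_def)
    moreover have "\<Lambda> \<inter> chevalley e -` B \<in> sets dx" using B pre_sets by auto
    ultimately have "AE x in dx. x \<notin> \<Lambda> \<inter> chevalley e -` B" by (intro AE_not_in) auto
    then show "AE x in dx. chevalley e x \<in> B \<longrightarrow> \<phi> x = 0"
      by (rule eventually_mono) (use supp in auto)
  qed
  then have ex: "\<exists>f. has_RN_derivative (pushforward (chevalley e) \<mu>) \<mu>\<^sub>c f"
    by (auto simp: has_RN_derivative_def push pre)
  have "f \<in> Lq q \<mu>\<^sub>c" if f: "has_RN_derivative (pushforward (chevalley e) \<mu>) \<mu>\<^sub>c f" and q: "q \<ge> 1" for f q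
  proof (rule Lq_of_weak_type[OF _ q])
    show "integrable \<mu>\<^sub>c f" using f by (simp add: has_RN_derivative_def)
    fix s :: real assume s: "0 < s" "s < 1"
    then obtain K where K: "K \<ge> 0" "\<And>B. B \<in> sets \<mu>\<^sub>c \<Longrightarrow> emeasure \<mu>\<^sub>c B < \<infinity> \<Longrightarrow>
        emeasure dx (\<Lambda> \<inter> chevalley e -` B) \<le> ennreal (K * measure \<mu>\<^sub>c B powr s)"
      using bound by metis
    \<comment> \<open>The integral over \<open>B\<close> is that of \<open>\<phi>\<close> over the
      part of the preimage in \<open>\<Lambda>\<close>, and \<open>c\<close> bounds
      \<open>\<phi>\<close> there.\<close>
    have "norm (set_lebesgue_integral \<mu>\<^sub>c B f) \<le> (c * K) * measure \<mu>\<^sub>c B powr s"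
      if B: "B \<in> sets \<mu>\<^sub>c" "emeasure \<mu>\<^sub>c B < \<infinity>" for B
    proof -
      let ?A = "\<Lambda> \<inter> chevalley e -` B"
      have A: "?A \<in> sets dx" using pre_sets[OF B(1)] by auto
      have le: "emeasure dx ?A \<le> ennreal (K * measure \<mu>\<^sub>c B powr s)" by (rule K(2)[OF B])
      then have finA: "emeasure dx ?A < \<infinity>" using order_le_less_trans[OF le ennreal_less_top] by simp
      have "measure dx ?A \<le> K * measure \<mu>\<^sub>c B powr s"
        using le K(1) by (simp add: measure_def enn2real_leI)
      have "set_lebesgue_integral \<mu>\<^sub>c B f = set_lebesgue_integral dx (chevalley e -` B) \<phi>"
        using f B push by (simp add: has_RN_derivative_def)
      also have "\<dots> = (\<integral>x. indicat_real ?A x *\<^sub>R \<phi> x \<partial>dx)"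
        unfolding set_lebesgue_integral_def
        by (intro Bochner_Integration.integral_cong) (use supp in \<open>auto simp: indicator_def\<close>)
      also have "norm \<dots> \<le> (\<integral>x. norm (indicat_real ?A x *\<^sub>R \<phi> x) \<partial>dx)"
        by (rule integral_norm_bound)
      also have "\<dots> \<le> (\<integral>x. c * indicat_real ?A x \<partial>dx)"
      proof (rule integral_mono)
        show "integrable dx (\<lambda>x. c * indicat_real ?A x)"
          using finA by (intro integrable_mult_right integrable_real_indicator A)
        show "integrable dx (\<lambda>x. norm (indicat_real ?A x *\<^sub>R \<phi> x))"
          by (intro integrable_norm integrable_mult_indicator A int\<phi>)
      qed (use c in \<open>auto simp: indicator_def\<close>)
      also have "\<dots> = c * measure dx ?A" using A finA by simp
      also have "\<dots> \<le> c * (K * measure \<mu>\<^sub>c B powr s)"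
        using \<open>measure dx ?A \<le> _\<close> c by (rule_tac mult_left_mono) auto
      finally show ?thesis by (simp add: mult.assoc)
    qed
    then show "\<exists>K\<ge>0. \<forall>B\<in>sets \<mu>\<^sub>c. emeasure \<mu>\<^sub>c B < \<infinity> \<longrightarrow>
        norm (set_lebesgue_integral \<mu>\<^sub>c B f) \<le> K * measure \<mu>\<^sub>c B powr s"
      using K(1) c(1) by (intro exI[of _ "c * K"]) auto
  qed
  then show ?thesis using ex by auto
qed

end
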